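(* Let $F$ be an algebraically closed field of characteristic $0$, let $H$ be a Hopf algebra over $F$ with a bijective antipode, and let $A$ be a nonzero finite dimensional $H$-module associative algebra over $F$. Suppose the Jacobson radical $J(A)$ is $H$-invariant. Then $\mathrm{PIexp}^H(A)=\dim A$ if and only if $A$ is $H$-simple.
   Context: Associative algebras $A$ are not assumed unital. $A$ is an $H$-module algebra if it is endowed with a unital algebra homomorphism $H\to\mathrm{End}_F(A)$ such that $h(ab)=(h_{(1)}a)(h_{(2)}b)$ for all $h\in H$, $a,b\in A$ (Sweedler notation $\Delta h=h_{(1)}\otimes h_{(2)}$). $A$ is $H$-simple if $A^2\neq0$ and its only $H$-invariant two-sided ideals are $0$ and $A$. $H$-codimensions. Let $(\gamma_\beta)_{\beta\in\Lambda}$ be a basis of $H$ and let $F\langle X|H\rangle$ be the free associative algebra without $1$ on free generators $x_i^{\gamma_\beta}$, $i\in\mathbb N$, $\beta\in\Lambda$; define $x_i^h$ for $h\in H$ by linearity in $h$. Let $P_n^H$ be the span of all $x_{\sigma(1)}^{h_1}\cdots x_{\sigma(n)}^{h_n}$, $h_i\in H$, $\sigma\in S_n$, and let $\mathrm{Id}^H(A)$ be the set of $f\in F\langle X|H\rangle$ vanishing under every substitution $x_i^h\mapsto ha_i$, $a_i\in A$. Put $c_n^H(A):=\dim\bigl(P_n^H/(P_n^H\cap\mathrm{Id}^H(A))\bigr)$ and $\mathrm{PIexp}^H(A):=\lim_{n\to\infty}\sqrt[n]{c_n^H(A)}$; the equality $\mathrm{PIexp}^H(A)=\dim A$ means that the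 limit exists and equals $\dim A$. *)

theory Defs
  imports Complex_Main "HOL-Library.Poly_Mapping" "HOL-Combinatorics.Permutations"
    "HOL-Computational_Algebra.Polynomial"
begin

section \<open>Free vector spaces and quotient dimensions\<close>

definition fscale :: "'f::field \<Rightarrow> ('x \<Rightarrow>\<^sub>0 'f) \<Rightarrow> ('x \<Rightarrow>\<^sub>0 'f)" where
  "fscale c p = Poly_Mapping.map ((*) c) p"

lemma lookup_fscale [simp]: "Poly_Mapping.lookup (fscale c p) x = c * Poly_Mapping.lookup p x"
  unfolding fscale_def by transfer (simp add: when_def)

interpretation free_vs: vector_space fscale
  by standard (auto intro!: poly_mapping_eqI simp: lookup_add algebra_simps)

text \<open>\<open>T\<close> is a system of representatives of a basis of \<open>V/W\<close>, for a subspace \<open>W\<close> of \<open>V\<close>: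
  the cosets \<open>t + W\<close> (\<open>t \<in> T\<close>) are pairwise distinct, linearly independent, and span \<open>V/W\<close>.
  The dimension of the quotient is the cardinality of \<open>T\<close> (with value \<open>0\<close> if that is infinite,
  as for \<^const>\<open>vector_space.dim\<close>).\<close>

definition quotient_basis ::
  "('f::field \<Rightarrow> 'v::ab_group_add \<Rightarrow> 'v) \<Rightarrow> 'v set \<Rightarrow> 'v set \<Rightarrow> 'v set \<Rightarrow> bool" where
  "quotient_basis scale V W T \<longleftrightarrow> T \<subseteq> V \<and>
     (\<forall>v\<in>V. \<exists>u\<in>module.span scale T. v - u \<in> W) \<and>
     (\<forall>U c. finite U \<and> U \<subseteq> T \<and> (\<Sum>t\<in>U. scale (c t) t) \<in> W \<longrightarrow> (\<forall>t\<in>U. c t = 0))"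

definition quotient_dim ::
  "('f::field \<Rightarrow> 'v::ab_group_add \<Rightarrow> 'v) \<Rightarrow> 'v set \<Rightarrow> 'v set \<Rightarrow> nat" where
  "quotient_dim scale V W = card (SOME T. quotient_basis scale V W T)"


section \<open>Associative algebras\<close>

text \<open>The class \<^class>\<open>ring\<close> has no unit, so algebras are not assumed unital.\<close>

locale assoc_algebra = vector_space scale
  for scale :: "'f::field \<Rightarrow> 'a::ring \<Rightarrow> 'a" +
  assumes scale_mult_left: "scale c (x * y) = scale c x * y"
    and scale_mult_right: "scale c (x * y) = x * scale c y"
begin

definition left_ideal :: "'a set \<Rightarrow> bool" where
  "left_ideal L \<longleftrightarrow> subspace L \<and> (\<forall>a. \<forall>x\<in>L. a * x \<in> L)"

definition two_sided_ideal :: "'a set \<Rightarrow> bool" where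
  "two_sided_ideal I \<longleftrightarrow> subspace I \<and> (\<forall>a. \<forall>x\<in>I. a * x \<in> I \<and> x * a \<in> I)"

definition maximal_left_ideal :: "'a set \<Rightarrow> bool" where
  "maximal_left_ideal L \<longleftrightarrow> left_ideal L \<and> L \<noteq> UNIV \<and>
     (\<forall>M. left_ideal M \<and> L \<subseteq> M \<longrightarrow> M = L \<or> M = UNIV)"

definition modular_left_ideal :: "'a set \<Rightarrow> bool" where
  "modular_left_ideal L \<longleftrightarrow> left_ideal L \<and> (\<exists>e. \<forall>x. x - x * e \<in> L)"

text \<open>The Jacobson radical of a possibly non-unital algebra is the intersection of its modular
  maximal left ideals; it is the whole algebra if there are none. In the unital case all
  left ideals are modular.\<close>

definition jacobson_radical :: "'a set" where
  "jacobson_radical = \<Inter>{L. maximal_left_ideal L \<and> modular_left_ideal L}"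

end


section \<open>Tensors\<close>

text \<open>A list \<open>[(x\<^sub>1,y\<^sub>1), \<dots>, (x\<^sub>k,y\<^sub>k)]\<close> stands for the tensor
  \<open>x\<^sub>1 \<otimes> y\<^sub>1 + \<dots> + x\<^sub>k \<otimes> y\<^sub>k\<close>. The tensor product \<open>V \<otimes> V\<close> is the free vector space on
  \<open>V \<times> V\<close> modulo the span of the bilinearity relations, and two lists denote the
  same tensor iff their formal sums differ by an element of that span. Likewise for
  \<open>V \<otimes> V \<otimes> V\<close>.\<close>

definition formal_sum :: "'x list \<Rightarrow> ('x \<Rightarrow>\<^sub>0 'f::field)" where
  "formal_sum ts = (\<Sum>t\<leftarrow>ts. Poly_Mapping.single t 1)"

definition tensor2_relations ::
  "('f::field \<Rightarrow> 'v::ab_group_add \<Rightarrow> 'v) \<Rightarrow> ('v \<times> 'v \<Rightarrow>\<^sub>0 'f) set" where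
  "tensor2_relations scale = (let e = (\<lambda>x y. Poly_Mapping.single (x, y) (1 :: 'f)) in
     free_vs.span
      ({e (x + x') y - e x y - e x' y | x x' y. True} \<union>
       {e x (y + y') - e x y - e x y' | x y y'. True} \<union>
       {e (scale c x) y - fscale c (e x y) | c x y. True} \<union>
       {e x (scale c y) - fscale c (e x y) | c x y. True}))"

definition tensor3_relations ::
  "('f::field \<Rightarrow> 'v::ab_group_add \<Rightarrow> 'v) \<Rightarrow> ('v \<times> 'v \<times> 'v \<Rightarrow>\<^sub>0 'f) set" where
  "tensor3_relations scale = (let e = (\<lambda>x y z. Poly_Mapping.single (x, y, z) (1 :: 'f)) in
     free_vs.span
      ({e (x + x') y z - e x y z - e x' y z | x x' y z. True} \<union>
       {e x (y + y') z - e x y z - e x y' z | x y y' z. True} \<union>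
       {e x y (z + z') - e x y z - e x y z' | x y z z'. True} \<union>
       {e (scale c x) y z - fscale c (e x y z) | c x y z. True} \<union>
       {e x (scale c y) z - fscale c (e x y z) | c x y z. True} \<union>
       {e x y (scale c z) - fscale c (e x y z) | c x y z. True}))"

definition tensor2_eq ::
  "('f::field \<Rightarrow> 'v::ab_group_add \<Rightarrow> 'v) \<Rightarrow> ('v \<times> 'v) list \<Rightarrow> ('v \<times> 'v) list \<Rightarrow> bool" where
  "tensor2_eq scale s t \<longleftrightarrow> formal_sum s - formal_sum t \<in> tensor2_relations scale"

definition tensor3_eq ::
  "('f::field \<Rightarrow> 'v::ab_group_add \<Rightarrow> 'v) \<Rightarrow>
     ('v \<times> 'v \<times> 'v) list \<Rightarrow> ('v \<times> 'v \<times> 'v) list \<Rightarrow> bool" where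
  "tensor3_eq scale s t \<longleftrightarrow> formal_sum s - formal_sum t \<in> tensor3_relations scale"


section \<open>Hopf algebras and their module algebras\<close>

text \<open>\<open>comult h\<close> is a representative of the tensor \<open>h\<^sub>(\<^sub>1\<^sub>) \<otimes> h\<^sub>(\<^sub>2\<^sub>)\<close>, so the
  axioms on \<open>comult\<close> with values in a tensor power are stated modulo \<^const>\<open>tensor2_eq\<close> and
  \<^const>\<open>tensor3_eq\<close>. The other axioms are bilinear in \<open>h\<^sub>(\<^sub>1\<^sub>)\<close> and \<open>h\<^sub>(\<^sub>2\<^sub>)\<close> and do not depend
  on the representative.\<close>

locale hopf_algebra = assoc_algebra scale
  for scale :: "'f::field \<Rightarrow> 'h::ring_1 \<Rightarrow> 'h" +
  fixes comult :: "'h \<Rightarrow> ('h \<times> 'h) list"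
    and counit :: "'h \<Rightarrow> 'f"
    and antipode :: "'h \<Rightarrow> 'h"
  assumes comult_add: "tensor2_eq scale (comult (g + h)) (comult g @ comult h)"
    and comult_scale:
      "tensor2_eq scale (comult (scale c h)) [(scale c x, y). (x, y) \<leftarrow> comult h]"
    and comult_mult: "tensor2_eq scale (comult (g * h))
      [(x * x', y * y'). (x, y) \<leftarrow> comult g, (x', y') \<leftarrow> comult h]"
    and comult_one: "tensor2_eq scale (comult 1) [(1, 1)]"
    and coassoc: "tensor3_eq scale
      [(u, v, y). (x, y) \<leftarrow> comult h, (u, v) \<leftarrow> comult x]
      [(x, u, v). (x, y) \<leftarrow> comult h, (u, v) \<leftarrow> comult y]"
    and counit_linear: "Vector_Spaces.linear scale (*) counit"
    and counit_mult: "counit (g * h) = counit g * counit h"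
    and counit_one: "counit 1 = 1"
    and counit_left: "(\<Sum>(x, y)\<leftarrow>comult h. scale (counit x) y) = h"
    and counit_right: "(\<Sum>(x, y)\<leftarrow>comult h. scale (counit y) x) = h"
    and antipode_linear: "Vector_Spaces.linear scale scale antipode"
    and antipode_left: "(\<Sum>(x, y)\<leftarrow>comult h. antipode x * y) = scale (counit h) 1"
    and antipode_right: "(\<Sum>(x, y)\<leftarrow>comult h. x * antipode y) = scale (counit h) 1"

locale H_module_algebra =
  H: hopf_algebra scaleH comult counit antipode + A: assoc_algebra scaleA
  for scaleH :: "'f::field \<Rightarrow> 'h::ring_1 \<Rightarrow> 'h"
    and comult :: "'h \<Rightarrow> ('h \<times> 'h) list"
    and counit :: "'h \<Rightarrow> 'f"
    and antipode :: "'h \<Rightarrow> 'h"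
    and scaleA :: "'f \<Rightarrow> 'a::ring \<Rightarrow> 'a" +
  fixes act :: "'h \<Rightarrow> 'a \<Rightarrow> 'a"
  assumes act_linear: "Vector_Spaces.linear scaleA scaleA (act h)"
    and act_linear_left: "Vector_Spaces.linear scaleH scaleA (\<lambda>h. act h a)"
    and act_mult: "act (g * h) a = act g (act h a)"
    and act_one: "act 1 a = a"
    and act_prod: "act h (a * b) = (\<Sum>(x, y)\<leftarrow>comult h. act x a * act y b)"

definition H_invariant :: "('h \<Rightarrow> 'a \<Rightarrow> 'a) \<Rightarrow> 'a set \<Rightarrow> bool" where
  "H_invariant act I \<longleftrightarrow> (\<forall>h. \<forall>x\<in>I. act h x \<in> I)"

definition H_simple :: "('f::field \<Rightarrow> 'a::ring \<Rightarrow> 'a) \<Rightarrow> ('h \<Rightarrow> 'a \<Rightarrow> 'a) \<Rightarrow> bool" where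
  "H_simple scaleA act \<longleftrightarrow>
     module.span scaleA {a * b | a b. True} \<noteq> {0} \<and>
     (\<forall>I. assoc_algebra.two_sided_ideal scaleA I \<and> H_invariant act I \<longrightarrow> I = {0} \<or> I = UNIV)"


section \<open>\<open>H\<close>-polynomials and \<open>H\<close>-codimensions\<close>

text \<open>The free monoid, written additively in order to obtain the free associative algebra with
  \<open>1\<close> as the monoid algebra \<open>'x word \<Rightarrow>\<^sub>0 'f\<close> of \<^theory>\<open>HOL-Library.Poly_Mapping\<close>.\<close>

datatype 'x word = Word (letters: "'x list")

instantiation word :: (type) monoid_add
begin
definition zero_word :: "'a word" where "zero_word = Word []"
definition plus_word :: "'a word \<Rightarrow> 'a word \<Rightarrow> 'a word" where
  "plus_word u v = Word (letters u @ letters v)"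
instance by standard (auto simp: zero_word_def plus_word_def)
end

type_synonym ('h, 'f) hpoly = "(nat \<times> 'h) word \<Rightarrow>\<^sub>0 'f"

text \<open>\<open>B\<close> is a basis of \<open>H\<close> (indexed by itself). The letter \<open>(i, b)\<close> with \<open>b \<in> B\<close> is the free
  generator \<open>x\<^sub>i\<^sup>b\<close>; \<open>H_polys B\<close> is the free algebra without \<open>1\<close> on these generators.\<close>

definition H_polys :: "'h set \<Rightarrow> ('h, 'f::field) hpoly set" where
  "H_polys B = {p. \<forall>w\<in>Poly_Mapping.keys p. letters w \<noteq> [] \<and> snd ` set (letters w) \<subseteq> B}"

text \<open>\<open>x\<^sub>i\<^sup>h\<close> for arbitrary \<open>h\<close>, by linearity in \<open>h\<close>.\<close>

definition H_var ::
  "('f::field \<Rightarrow> 'h::ab_group_add \<Rightarrow> 'h) \<Rightarrow> 'h set \<Rightarrow> nat \<Rightarrow> 'h \<Rightarrow> ('h, 'f) hpoly" where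
  "H_var scaleH B i h =
     (\<Sum>b | module.representation scaleH B h b \<noteq> 0.
        Poly_Mapping.single (Word [(i, b)]) (module.representation scaleH B h b))"

text \<open>The space \<open>P\<^sub>n\<^sup>H\<close> of multilinear \<open>H\<close>-polynomials, for \<open>n \<ge> 1\<close>.\<close>

definition H_multilinear ::
  "('f::field \<Rightarrow> 'h::ab_group_add \<Rightarrow> 'h) \<Rightarrow> 'h set \<Rightarrow> nat \<Rightarrow> ('h, 'f) hpoly set" where
  "H_multilinear scaleH B n = free_vs.span
     {prod_list (map (\<lambda>k. H_var scaleH B (\<sigma> k) (h k)) [1..<Suc n]) | \<sigma> h. \<sigma> permutes {1..n}}"

text \<open>Products of nonempty lists in an algebra without unit; the value at \<open>[]\<close> is never used.\<close>

fun nonempty_prod :: "'a::ring list \<Rightarrow> 'a" where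
  "nonempty_prod [] = 0"
| "nonempty_prod [x] = x"
| "nonempty_prod (x # y # zs) = x * nonempty_prod (y # zs)"

text \<open>The value of \<open>f\<close> under the substitution \<open>x\<^sub>i\<^sup>h \<mapsto> h a\<^sub>i\<close>.\<close>

definition H_eval ::
  "('f::field \<Rightarrow> 'a::ring \<Rightarrow> 'a) \<Rightarrow> ('h \<Rightarrow> 'a \<Rightarrow> 'a) \<Rightarrow> (nat \<Rightarrow> 'a) \<Rightarrow> ('h, 'f) hpoly \<Rightarrow> 'a" where
  "H_eval scaleA act a f =
     (\<Sum>w\<in>Poly_Mapping.keys f. scaleA (Poly_Mapping.lookup f w)
        (nonempty_prod (map (\<lambda>(i, b). act b (a i)) (letters w))))"

context H_module_algebra
begin

lemma H_eval_superset:
  assumes "finite K" "Poly_Mapping.keys f \<subseteq> K"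
  shows "H_eval scaleA act a f = (\<Sum>w\<in>K. scaleA (Poly_Mapping.lookup f w)
        (nonempty_prod (map (\<lambda>(i, b). act b (a i)) (letters w))))"
  unfolding H_eval_def using assms
  by (intro sum.mono_neutral_left) (auto simp: in_keys_iff)

lemma H_eval_add:
  "H_eval scaleA act a (f + g) = H_eval scaleA act a f + H_eval scaleA act a g"
proof -
  let ?K = "Poly_Mapping.keys f \<union> Poly_Mapping.keys g"
  have "Poly_Mapping.keys (f + g) \<subseteq> ?K" by (rule Poly_Mapping.keys_add)
  then show ?thesis
    by (simp add: H_eval_superset[of ?K] lookup_add A.scale_left_distrib sum.distrib)
qed

lemma H_eval_sum:
  "H_eval scaleA act a (sum F I) = (\<Sum>i\<in>I. H_eval scaleA act a (F i))"
  by (induct I rule: infinite_finite_induct) (simp_all add: H_eval_add, simp_all add: H_eval_def)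

lemma H_eval_single:
  "H_eval scaleA act a (Poly_Mapping.single w c) =
     scaleA c (nonempty_prod (map (\<lambda>(i, b). act b (a i)) (letters w)))"
  by (subst H_eval_superset[of "{w}"]) (auto)

text \<open>Although the substitution is only given on the generators \<open>x\<^sub>i\<^sup>b\<close>, \<open>b \<in> B\<close>, it sends
  \<open>x\<^sub>i\<^sup>h\<close> to \<open>h a\<^sub>i\<close> for every \<open>h\<close>.\<close>

lemma H_eval_H_var:
  assumes "H.independent B" "H.span B = UNIV"
  shows "H_eval scaleA act a (H_var scaleH B i h) = act h (a i)"
proof -
  interpret l: Vector_Spaces.linear scaleH scaleA "\<lambda>h. act h (a i)" by (rule act_linear_left)
  have "H_eval scaleA act a (H_var scaleH B i h) =
     (\<Sum>b | H.representation B h b \<noteq> 0. scaleA (H.representation B h b) (act b (a i)))"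
    unfolding H_var_def H_eval_sum by (simp add: H_eval_single)
  also have "\<dots> = act (\<Sum>b | H.representation B h b \<noteq> 0. scaleH (H.representation B h b) b) (a i)"
    by (simp add: l.sum l.scale)
  also have "\<dots> = act h (a i)"
    using assms by (simp add: H.sum_nonzero_representation_eq)
  finally show ?thesis .
qed

end

definition H_identities ::
  "('f::field \<Rightarrow> 'a::ring \<Rightarrow> 'a) \<Rightarrow> ('h \<Rightarrow> 'a \<Rightarrow> 'a) \<Rightarrow> 'h set \<Rightarrow> ('h, 'f) hpoly set" where
  "H_identities scaleA act B = {f \<in> H_polys B. \<forall>a. H_eval scaleA act a f = 0}"

definition H_codim ::
  "('f::field \<Rightarrow> 'h::ab_group_add \<Rightarrow> 'h) \<Rightarrow> ('f \<Rightarrow> 'a::ring \<Rightarrow> 'a) \<Rightarrow> ('h \<Rightarrow> 'a \<Rightarrow> 'a) \<Rightarrow>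
     'h set \<Rightarrow> nat \<Rightarrow> nat" where
  "H_codim scaleH scaleA act B n = quotient_dim fscale
     (H_multilinear scaleH B n) (H_multilinear scaleH B n \<inter> H_identities scaleA act B)"

end

theory Submission
  imports Defs
begin

text \<open>
  Let \<open>d = dim A\<close>, let \<open>J\<close> be the Jacobson radical and \<open>c\<^sub>n\<close> the \<open>n\<close>-th \<open>H\<close>-codimension. Evaluation
  identifies \<open>P\<^sub>n\<^sup>H\<close> modulo identities with the space of multilinear functions of
  \<open>a\<^sub>1, \<dots>, a\<^sub>n\<close> spanned by the products \<open>(h\<^sub>1 a\<^sub>\<sigma>\<^sub>1) \<dots> (h\<^sub>n a\<^sub>\<sigma>\<^sub>n)\<close> (\<open>H_fun\<close>, \<open>H_codim_bounds\<close>),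
  so \<open>c\<^sub>n\<close> is the dimension of that space. Such a function is determined by its values on tuples of
  basis vectors, and therefore \<open>c\<^sub>n \<le> d\<^sup>n d\<close>.

  Suppose that \<open>A\<close> is not \<open>H\<close>-simple. Then all these functions vanish on so many basis tuples
  that \<open>c\<^sub>n\<close> is bounded by a constant times \<open>(d - 1/2)\<^sup>n\<close>. If \<open>J \<noteq> 0\<close>, take a basis adapted to the
  \<open>H\<close>-invariant nilpotent ideal \<open>J\<close>: a product with \<open>p\<close> factors in \<open>J\<close> is zero, so only tuples with
  fewer than \<open>p\<close> entries in \<open>J\<close> matter (\<open>H_codim_bound_radical\<close>). If \<open>J = 0\<close>, a proper nonzero invariant
  ideal \<open>I\<close> has an identity element, \<open>A\<close> is the direct sum of \<open>I\<close> and the left annihilator of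
  \<open>I\<close>, the antipode shows that this annihilator is again \<open>H\<close>-invariant, and tuples with entries from both
  summands do not matter (\<open>H_codim_bound_direct_sum\<close>).

  Suppose that \<open>A\<close> is \<open>H\<close>-simple. Then \<open>J = 0\<close>, \<open>A\<close> is unital, and by density over the
  algebraically closed field the maps \<open>x \<mapsto> \<Sum> c (h x) b\<close> separate the vectors of a basis. Hence some
  \<open>H\<close>-polynomial \<open>f\<close> in \<open>3 d\<close> variables alternates in \<open>d\<close> of them and is not an identity
  (\<open>alternating_poly_nonzero\<close>). Alternation in \<open>d = dim A\<close> variables \<open>x\<^sub>i\<close> absorbs traces: replacing each \<open>x\<^sub>i\<close>
  in turn by \<open>\<phi> x\<^sub>i\<close> and adding up multiplies \<open>f\<close> by \<open>tr \<phi>\<close> (\<open>alternating_absorbs_trace\<close>). With \<open>\<phi>\<close> the left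
  multiplication by \<open>y y'\<close> this multiplies \<open>f\<close> by \<open>\<beta>(y, y') = tr (x \<mapsto> y y' x)\<close> at the price of just
  the two variables \<open>y\<close> and \<open>y'\<close>. So, up to the bounded number of variables of \<open>f\<close>, the codimension \<open>c\<^sub>n\<close>
  with \<open>n = 2 k + 3 d\<close> is at least the dimension of the span of the functions
  \<open>\<Prod>\<^sub>i \<beta>(y\<^sub>i, y'\<^sub>\<sigma>\<^sub>i)\<close>, where \<open>\<sigma>\<close> runs through the permutations of \<open>k\<close> letters. The form \<open>\<beta>\<close> is
  nondegenerate, because a nonzero left ideal contains an idempotent \<open>e \<noteq> 0\<close> and \<open>\<beta>(e, e)\<close> is the rank of
  \<open>x \<mapsto> e x\<close>. On basis tuples and dual basis tuples, the functions become explicit 0/1 vectors.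

  The span of these vectors is the image of the group algebra of \<open>S\<^sub>k\<close> in the endomorphisms of the
  \<open>k\<close>-th tensor power. Its dimension is estimated by an elementary inequality: a family of rational
  vectors of rank \<open>r\<close> with Gram matrix \<open>G\<close> satisfies \<open>(tr G)\<^sup>2 \<le> r tr (G\<^sup>2)\<close>. Here \<open>tr G = k! d\<^sup>k\<close>, while
  \<open>tr (G\<^sup>2)\<close> is \<open>(k!)\<^sup>2\<close> times the number of orbits of \<open>S\<^sub>k\<close> on words of length \<open>k\<close> over \<open>d\<^sup>2\<close> letters,
  at most \<open>(k + 1)\<close> to the power \<open>d\<^sup>2\<close>. So the dimension is at least \<open>d\<^sup>2\<^sup>k\<close> divided by a polynomial in \<open>k\<close>
  (\<open>permutation_vectors_rank\<close>), and the \<open>n\<close>-th root of \<open>c\<^sub>n\<close> tends to \<open>d\<close>.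
\<close>

section \<open>Counting permutation invariants of tensor powers\<close>

lemma sum_combination_mult:
  "(\<Sum>x\<in>X. (\<Sum>i\<in>I. c i * g i x) * h x) = (\<Sum>i\<in>I. c i * (\<Sum>x\<in>X. g i x * (h x :: 'a::comm_ring)))"
proof -
  have "(\<Sum>x\<in>X. (\<Sum>i\<in>I. c i * g i x) * h x) = (\<Sum>x\<in>X. \<Sum>i\<in>I. c i * (g i x * h x))"
    by (simp add: sum_distrib_right mult.assoc)
  also have "\<dots> = (\<Sum>i\<in>I. \<Sum>x\<in>X. c i * (g i x * h x))" by (rule sum.swap)
  finally show ?thesis by (simp add: sum_distrib_left)
qed

text \<open>The outcome of Gram-Schmidt orthogonalisation of the family \<open>v\<close>: the vectors \<open>u s\<close> for \<open>s \<in> S0\<close> are an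
  orthogonal basis of its span, and \<open>v\<close> restricted to \<open>S0\<close> is independent. Orthogonality needs an ordered
  field, but independence is wanted over the ground field of the algebra; the type argument carries that
  field, into which the rational coordinates are mapped by \<^const>\<open>of_rat\<close>.\<close>

definition orthogonal_system ::
  "'f::field_char_0 itself \<Rightarrow> 'x set \<Rightarrow> ('i \<Rightarrow> 'x \<Rightarrow> rat) \<Rightarrow> 'i set \<Rightarrow> 'i set \<Rightarrow> ('i \<Rightarrow> 'x \<Rightarrow> rat) \<Rightarrow> bool" where
  "orthogonal_system F X v S S0 u \<longleftrightarrow>
      (\<forall>i\<in>S0. \<forall>j\<in>S0. i \<noteq> j \<longrightarrow> (\<Sum>x\<in>X. u i x * u j x) = 0) \<and>
      (\<forall>i\<in>S0. (\<Sum>x\<in>X. u i x * u i x) > 0) \<and>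
      (\<forall>s\<in>S. \<exists>c. \<forall>x\<in>X. v s x = (\<Sum>i\<in>S0. c i * u i x)) \<and>
      (\<forall>c :: 'i \<Rightarrow> 'f. (\<forall>x\<in>X. (\<Sum>s\<in>S0. c s * of_rat (v s x)) = 0)
         \<longrightarrow> (\<forall>s\<in>S0. c s = 0))"

text \<open>Gram-Schmidt, without normalisation. Pairing a vanishing combination over the field \<open>'f\<close> with the new
  orthogonal vector isolates the new coefficient, which is why independence transfers to any field
  of characteristic \<open>0\<close>.\<close>

lemma orthogonal_system_exists:
  fixes v :: "'i \<Rightarrow> 'x \<Rightarrow> rat"
  assumes "finite S" "finite X"
  shows "\<exists>S0\<subseteq>S. \<exists>u. orthogonal_system TYPE('f::field_char_0) X v S S0 u"
  using assms(1)
proof (induct S)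
  case empty
  show ?case by (auto simp: orthogonal_system_def)
next
  case (insert s S)
  then obtain S0 u where S0: "S0 \<subseteq> S"
    and sys: "orthogonal_system TYPE('f) X v S S0 u"
    by blast
  have orth: "\<And>i j. i \<in> S0 \<Longrightarrow> j \<in> S0 \<Longrightarrow> i \<noteq> j \<Longrightarrow> (\<Sum>x\<in>X. u i x * u j x) = 0"
    and pos: "\<And>i. i \<in> S0 \<Longrightarrow> (\<Sum>x\<in>X. u i x * u i x) > 0"
    and gen: "\<And>s. s \<in> S \<Longrightarrow> \<exists>c. \<forall>x\<in>X. v s x = (\<Sum>i\<in>S0. c i * u i x)"
    and ind: "\<And>c :: 'i \<Rightarrow> 'f. (\<forall>x\<in>X. (\<Sum>s\<in>S0. c s * of_rat (v s x)) = 0) \<Longrightarrow> (\<forall>s\<in>S0. c s = 0)"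
    using sys unfolding orthogonal_system_def by simp_all
  have fin0: "finite S0" using S0 insert finite_subset by blast
  have sS0: "s \<notin> S0" using S0 insert by blast
  define n where "n i = (\<Sum>x\<in>X. u i x * u i x)" for i
  define c0 where "c0 i = (\<Sum>x\<in>X. v s x * u i x) / n i" for i
  \<comment> \<open>the component of \<open>v s\<close> orthogonal to the vectors found so far\<close>
  define w where "w x = v s x - (\<Sum>i\<in>S0. c0 i * u i x)" for x
  have npos: "n i > 0" if "i \<in> S0" for i using pos[OF that] by (simp add: n_def)
  have wu: "(\<Sum>x\<in>X. w x * u j x) = 0" if j: "j \<in> S0" for j
  proof -
    have "(\<Sum>x\<in>X. (\<Sum>i\<in>S0. c0 i * u i x) * u j x) = (\<Sum>i\<in>S0. c0 i * (\<Sum>x\<in>X. u i x * u j x))"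
      by (rule sum_combination_mult)
    also have "\<dots> = (\<Sum>i\<in>S0. if i = j then c0 j * n j else 0)"
      using orth j by (intro sum.cong) (auto simp: n_def)
    also have "\<dots> = c0 j * n j" using fin0 j by simp
    also have "\<dots> = (\<Sum>x\<in>X. v s x * u j x)" using npos[OF j] by (simp add: c0_def)
    finally show ?thesis by (simp add: w_def left_diff_distrib sum_subtractf)
  qed
  show ?case
  proof (cases "\<forall>x\<in>X. w x = 0")
    case True
    have "\<exists>c. \<forall>x\<in>X. v t x = (\<Sum>i\<in>S0. c i * u i x)" if "t \<in> insert s S" for t
    proof (cases "t = s")
      case True
      then show ?thesis using \<open>\<forall>x\<in>X. w x = 0\<close> by (intro exI[of _ c0]) (auto simp: w_def)
    qed (use gen that in auto)
    then have "orthogonal_system TYPE('f) X v (insert s S) S0 u"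
      using sys unfolding orthogonal_system_def by simp
    then show ?thesis using S0 by blast
  next
    case False
    let ?S = "insert s S0" and ?u = "u(s := w)"
    have u': "?u i = u i" if "i \<in> S0" for i using that sS0 by auto
    have ww: "(\<Sum>x\<in>X. w x * w x) > 0"
    proof -
      obtain x where "x \<in> X" "w x \<noteq> 0" using False by blast
      moreover have "w x * w x > 0" using \<open>w x \<noteq> 0\<close> by (simp add: zero_less_mult_iff) linarith
      ultimately show ?thesis using assms(2) by (intro sum_pos2[of X x]) auto
    qed
    have vw: "(\<Sum>x\<in>X. v t x * w x) = 0" if t: "t \<in> S" for t
    proof -
      obtain c where c: "\<forall>x\<in>X. v t x = (\<Sum>i\<in>S0. c i * u i x)" using gen[OF t] by blast
      have "(\<Sum>x\<in>X. v t x * w x) = (\<Sum>x\<in>X. (\<Sum>i\<in>S0. c i * u i x) * w x)"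
        using c by (intro sum.cong) auto
      also have "\<dots> = (\<Sum>i\<in>S0. c i * (\<Sum>x\<in>X. u i x * w x))" by (rule sum_combination_mult)
      also have "\<dots> = 0" using wu by (simp add: mult.commute)
      finally show ?thesis .
    qed
    have vsw: "(\<Sum>x\<in>X. v s x * w x) = (\<Sum>x\<in>X. w x * w x)"
    proof -
      have "(\<Sum>x\<in>X. (\<Sum>i\<in>S0. c0 i * u i x) * w x) = (\<Sum>i\<in>S0. c0 i * (\<Sum>x\<in>X. u i x * w x))"
        by (rule sum_combination_mult)
      also have "\<dots> = 0" using wu by (simp add: mult.commute)
      finally have 0: "(\<Sum>x\<in>X. (\<Sum>i\<in>S0. c0 i * u i x) * w x) = 0" .
      have "(\<Sum>x\<in>X. w x * w x) = (\<Sum>x\<in>X. v s x * w x - (\<Sum>i\<in>S0. c0 i * u i x) * w x)"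
        by (intro sum.cong) (auto simp: w_def left_diff_distrib)
      then show ?thesis by (simp add: sum_subtractf 0)
    qed
    have g: "\<exists>c. \<forall>x\<in>X. v t x = (\<Sum>i\<in>?S. c i * ?u i x)" if t: "t \<in> insert s S" for t
    proof (cases "t = s")
      case True
      have "(\<Sum>i\<in>?S. (c0(s := 1)) i * ?u i x) = v t x" for x
      proof -
        have "(\<Sum>i\<in>S0. (c0(s := 1)) i * ?u i x) = (\<Sum>i\<in>S0. c0 i * u i x)"
          using sS0 by (intro sum.cong) auto
        then show ?thesis using True fin0 sS0 by (simp add: w_def)
      qed
      then show ?thesis by metis
    next
      case False
      then obtain c where c: "\<forall>x\<in>X. v t x = (\<Sum>i\<in>S0. c i * u i x)" using gen t by blast
      have "(\<Sum>i\<in>?S. (c(s := 0)) i * ?u i x) = (\<Sum>i\<in>S0. c i * u i x)" for x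
      proof -
        have "(\<Sum>i\<in>S0. (c(s := 0)) i * ?u i x) = (\<Sum>i\<in>S0. c i * u i x)"
          using sS0 by (intro sum.cong) auto
        then show ?thesis using fin0 sS0 by simp
      qed
      then show ?thesis using c by (intro exI[of _ "c(s := 0)"]) simp
    qed
    have i: "\<forall>t\<in>?S. c t = 0" if c: "\<forall>x\<in>X. (\<Sum>t\<in>?S. c t * of_rat (v t x)) = 0" for c :: "'i \<Rightarrow> 'f"
    proof -
      have "0 = (\<Sum>x\<in>X. (\<Sum>t\<in>?S. c t * of_rat (v t x)) * of_rat (w x))" using c by simp
      also have "\<dots> = (\<Sum>x\<in>X. \<Sum>t\<in>?S. c t * of_rat (v t x * w x))"
        by (simp only: sum_distrib_right of_rat_mult mult.assoc)
      also have "\<dots> = (\<Sum>t\<in>?S. \<Sum>x\<in>X. c t * of_rat (v t x * w x))"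
        by (rule sum.swap)
      also have "\<dots> = (\<Sum>t\<in>?S. c t * of_rat (\<Sum>x\<in>X. v t x * w x))"
        by (simp add: sum_distrib_left of_rat_sum)
      also have "\<dots> = c s * of_rat (\<Sum>x\<in>X. v s x * w x)"
        using fin0 sS0 vw S0 by (simp add: subset_iff)
      finally have "c s * of_rat (\<Sum>x\<in>X. w x * w x) = 0" by (simp add: vsw)
      then have cs: "c s = 0" using ww by (simp del: of_rat_sum)
      then have "\<forall>x\<in>X. (\<Sum>t\<in>S0. c t * of_rat (v t x)) = 0" using c fin0 sS0 by simp
      then show ?thesis using ind cs by blast
    qed
    have "\<forall>i\<in>?S. \<forall>j\<in>?S. i \<noteq> j \<longrightarrow> (\<Sum>x\<in>X. ?u i x * ?u j x) = 0"
      using orth wu sS0 by (auto simp: mult.commute[of _ "w _"])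
    moreover have "\<forall>i\<in>?S. (\<Sum>x\<in>X. ?u i x * ?u i x) > 0" using pos ww by auto
    moreover have "\<forall>t\<in>insert s S. \<exists>c. \<forall>x\<in>X. v t x = (\<Sum>i\<in>?S. c i * ?u i x)" using g by blast
    moreover have "\<forall>c :: 'i \<Rightarrow> 'f. (\<forall>x\<in>X. (\<Sum>t\<in>?S. c t * of_rat (v t x)) = 0)
        \<longrightarrow> (\<forall>t\<in>?S. c t = 0)" using i by blast
    ultimately have "orthogonal_system TYPE('f) X v (insert s S) ?S ?u"
      unfolding orthogonal_system_def by (intro conjI)
    then show ?thesis using S0 by blast
  qed
qed

text \<open>In the orthogonal basis, let \<open>q\<^sub>i\<close> be the contribution of the \<open>i\<close>-th basis vector to the sum of the squared
  norms. By Cauchy-Schwarz \<open>(\<Sum> q\<^sub>i)\<^sup>2 \<le> r \<Sum> q\<^sub>i\<^sup>2\<close>, and the \<open>q\<^sub>i\<^sup>2\<close> are the diagonal terms when the sum of the squared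
  inner products is written as a sum of nonnegative terms over pairs of basis vectors. This is
  \<open>(tr G)\<^sup>2 \<le> r tr (G\<^sup>2)\<close> for the Gram matrix \<open>G\<close>.\<close>

lemma gram_rank_bound:
  fixes v :: "'i \<Rightarrow> 'x \<Rightarrow> rat"
  assumes S: "finite S" and X: "finite X"
  shows "\<exists>S0\<subseteq>S. (\<Sum>s\<in>S. \<Sum>x\<in>X. v s x * v s x)\<^sup>2
        \<le> of_nat (card S0) * (\<Sum>s\<in>S. \<Sum>t\<in>S. (\<Sum>x\<in>X. v s x * v t x)\<^sup>2) \<and>
      (\<forall>c :: 'i \<Rightarrow> 'f::field_char_0. (\<forall>x\<in>X. (\<Sum>s\<in>S0. c s * of_rat (v s x)) = 0)
         \<longrightarrow> (\<forall>s\<in>S0. c s = 0))"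
proof -
  obtain S0 u where S0: "S0 \<subseteq> S" and sys: "orthogonal_system TYPE('f) X v S S0 u"
    using orthogonal_system_exists[OF assms, of v] by blast
  have orth: "\<And>i j. i \<in> S0 \<Longrightarrow> j \<in> S0 \<Longrightarrow> i \<noteq> j \<Longrightarrow> (\<Sum>x\<in>X. u i x * u j x) = 0"
    and pos: "\<And>i. i \<in> S0 \<Longrightarrow> (\<Sum>x\<in>X. u i x * u i x) > 0"
    and gen: "\<forall>s\<in>S. \<exists>c. \<forall>x\<in>X. v s x = (\<Sum>i\<in>S0. c i * u i x)"
    and ind: "\<forall>c :: 'i \<Rightarrow> 'f. (\<forall>x\<in>X. (\<Sum>s\<in>S0. c s * of_rat (v s x)) = 0) \<longrightarrow> (\<forall>s\<in>S0. c s = 0)"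
    using sys unfolding orthogonal_system_def by simp_all
  obtain c where c: "\<And>s x. s \<in> S \<Longrightarrow> x \<in> X \<Longrightarrow> v s x = (\<Sum>i\<in>S0. c s i * u i x)"
    using bchoice[OF gen] by blast
  have fin0: "finite S0" using S0 S finite_subset by blast
  define n where "n i = (\<Sum>x\<in>X. u i x * u i x)" for i
  have npos: "n i > 0" if "i \<in> S0" for i using pos[OF that] by (simp add: n_def)
  have ip: "(\<Sum>x\<in>X. v s x * v t x) = (\<Sum>i\<in>S0. c s i * c t i * n i)" if "s \<in> S" "t \<in> S" for s t
  proof -
    have "(\<Sum>x\<in>X. v s x * v t x) = (\<Sum>x\<in>X. \<Sum>i\<in>S0. \<Sum>j\<in>S0. (c s i * c t j) * (u i x * u j x))"
      using c that by (intro sum.cong) (auto simp: sum_product algebra_simps)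
    also have "\<dots> = (\<Sum>i\<in>S0. \<Sum>x\<in>X. \<Sum>j\<in>S0. (c s i * c t j) * (u i x * u j x))"
      by (rule sum.swap)
    also have "\<dots> = (\<Sum>i\<in>S0. \<Sum>j\<in>S0. (c s i * c t j) * (\<Sum>x\<in>X. u i x * u j x))"
      by (intro sum.cong refl) (subst sum.swap, simp add: sum_distrib_left)
    also have "\<dots> = (\<Sum>i\<in>S0. \<Sum>j\<in>S0. if j = i then c s i * c t i * n i else 0)"
      using orth by (intro sum.cong) (auto simp: n_def)
    also have "\<dots> = (\<Sum>i\<in>S0. c s i * c t i * n i)" using fin0 by simp
    finally show ?thesis .
  qed
  define q where "q i = (\<Sum>s\<in>S. c s i * c s i * n i)" for i
  have "(\<Sum>s\<in>S. \<Sum>x\<in>X. v s x * v s x) = (\<Sum>s\<in>S. \<Sum>i\<in>S0. c s i * c s i * n i)"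
    using ip by simp
  also have "\<dots> = (\<Sum>i\<in>S0. q i)" unfolding q_def by (rule sum.swap)
  finally have "(\<Sum>s\<in>S. \<Sum>x\<in>X. v s x * v s x)\<^sup>2 = (\<Sum>i\<in>S0. q i)\<^sup>2" by simp
  also have "\<dots> \<le> of_nat (card S0) * (\<Sum>i\<in>S0. (q i)\<^sup>2)"
  proof -
    have "0 \<le> (\<Sum>i\<in>S0. \<Sum>j\<in>S0. (q i - q j)\<^sup>2)" by (intro sum_nonneg) auto
    also have "\<dots> = (\<Sum>i\<in>S0. \<Sum>j\<in>S0. (q i)\<^sup>2 + (q j)\<^sup>2 - 2 * (q i * q j))"
      by (simp add: power2_diff mult.assoc)
    also have "\<dots> = 2 * (of_nat (card S0) * (\<Sum>i\<in>S0. (q i)\<^sup>2)) - 2 * (\<Sum>i\<in>S0. q i)\<^sup>2"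
      by (simp add: sum_subtractf sum.distrib sum_distrib_left[symmetric] power2_eq_square sum_product)
    finally show ?thesis by simp
  qed
  also have "(\<Sum>i\<in>S0. (q i)\<^sup>2) \<le> (\<Sum>s\<in>S. \<Sum>t\<in>S. (\<Sum>x\<in>X. v s x * v t x)\<^sup>2)"
  proof -
    let ?g = "\<lambda>i j. n i * n j * (\<Sum>s\<in>S. c s i * c s j)\<^sup>2"
    have "q i = n i * (\<Sum>s\<in>S. c s i * c s i)" for i
      by (simp add: q_def sum_distrib_left mult.commute)
    then have "(\<Sum>i\<in>S0. (q i)\<^sup>2) = (\<Sum>i\<in>S0. ?g i i)"
      by (simp add: power_mult_distrib power2_eq_square[of "n _"])
    also have "\<dots> \<le> (\<Sum>i\<in>S0. \<Sum>j\<in>S0. ?g i j)"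
      using npos fin0 by (intro sum_mono member_le_sum) (auto intro!: mult_nonneg_nonneg simp: less_imp_le)
    also have "\<dots> = (\<Sum>i\<in>S0. \<Sum>j\<in>S0. \<Sum>s\<in>S. \<Sum>t\<in>S. (c s i * c t i * n i) * (c s j * c t j * n j))"
    proof -
      have "?g i j = (\<Sum>s\<in>S. \<Sum>t\<in>S. (c s i * c t i * n i) * (c s j * c t j * n j))" for i j
        by (simp add: power2_eq_square sum_product sum_distrib_left mult_ac)
      then show ?thesis by simp
    qed
    also have "\<dots> = (\<Sum>s\<in>S. \<Sum>t\<in>S. \<Sum>i\<in>S0. \<Sum>j\<in>S0. (c s i * c t i * n i) * (c s j * c t j * n j))"
    proof -
      let ?h = "\<lambda>i j s t. (c s i * c t i * n i) * (c s j * c t j * n j)"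
      have "(\<Sum>i\<in>S0. \<Sum>j\<in>S0. \<Sum>s\<in>S. \<Sum>t\<in>S. ?h i j s t) = (\<Sum>i\<in>S0. \<Sum>s\<in>S. \<Sum>j\<in>S0. \<Sum>t\<in>S. ?h i j s t)"
        by (rule sum.cong[OF refl], rule sum.swap)
      also have "\<dots> = (\<Sum>s\<in>S. \<Sum>i\<in>S0. \<Sum>j\<in>S0. \<Sum>t\<in>S. ?h i j s t)" by (rule sum.swap)
      also have "\<dots> = (\<Sum>s\<in>S. \<Sum>i\<in>S0. \<Sum>t\<in>S. \<Sum>j\<in>S0. ?h i j s t)"
        by (rule sum.cong[OF refl], rule sum.cong[OF refl], rule sum.swap)
      also have "\<dots> = (\<Sum>s\<in>S. \<Sum>t\<in>S. \<Sum>i\<in>S0. \<Sum>j\<in>S0. ?h i j s t)"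
        by (rule sum.cong[OF refl], rule sum.swap)
      finally show ?thesis .
    qed
    also have "\<dots> = (\<Sum>s\<in>S. \<Sum>t\<in>S. (\<Sum>x\<in>X. v s x * v t x)\<^sup>2)"
      using ip by (intro sum.cong refl) (simp add: power2_eq_square sum_product)
    finally show ?thesis .
  qed
  finally have "(\<Sum>s\<in>S. \<Sum>x\<in>X. v s x * v s x)\<^sup>2
     \<le> of_nat (card S0) * (\<Sum>s\<in>S. \<Sum>t\<in>S. (\<Sum>x\<in>X. v s x * v t x)\<^sup>2)"
    by (simp add: mult_left_mono)
  then show ?thesis using S0 ind by blast
qed

text \<open>Orbit counting in injective form. The type of a word \<open>p\<close> records how often each letter occurs; words of
  the same type are rearrangements \<open>p = p\<^sub>0 \<circ> g\<^sub>p\<close> of a fixed representative \<open>p\<^sub>0\<close>. The pair \<open>(\<tau>, p)\<close>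
  can be recovered from the type of \<open>p\<close> and the permutation \<open>g\<^sub>p \<circ> \<tau>\<close>.\<close>

lemma card_coincidences_le:
  assumes K: "finite K" and \<sigma>: "\<sigma> permutes {..<k}"
  shows "card {(\<tau>, p). \<tau> permutes {..<k} \<and> p \<in> {..<k} \<rightarrow>\<^sub>E K \<and> (\<forall>i<k. p (\<sigma> i) = p (\<tau> i))}
      \<le> fact k * (k + 1) ^ card K"
proof -
  let ?I = "{..<k}"
  let ?A = "{(\<tau>, p). \<tau> permutes {..<k} \<and> p \<in> {..<k} \<rightarrow>\<^sub>E K \<and> (\<forall>i<k. p (\<sigma> i) = p (\<tau> i))}"
  define ty where "ty p = (\<lambda>c\<in>K. card {i\<in>?I. p i = c})" for p :: "nat \<Rightarrow> 'a"
  define p0 where "p0 y = (SOME p. p \<in> ?I \<rightarrow>\<^sub>E K \<and> ty p = y)" for y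
  define g where "g p = (SOME g. g permutes ?I \<and> (\<forall>i<k. p i = p0 (ty p) (g i)))" for p
  have p0: "p0 (ty p) \<in> ?I \<rightarrow>\<^sub>E K \<and> ty (p0 (ty p)) = ty p" if "p \<in> ?I \<rightarrow>\<^sub>E K" for p
    unfolding p0_def by (rule someI[of _ p]) (use that in auto)
  have g: "g p permutes ?I \<and> (\<forall>i<k. p i = p0 (ty p) (g p i))" if p: "p \<in> ?I \<rightarrow>\<^sub>E K" for p
  proof -
    let ?p = "p0 (ty p)"
    have "image_mset ?p (mset_set ?I) = image_mset p (mset_set ?I)"
    proof (rule multiset_eqI)
      fix c
      show "count (image_mset ?p (mset_set ?I)) c = count (image_mset p (mset_set ?I)) c"
      proof (cases "c \<in> K")
        case True
        then have "ty ?p c = ty p c" using p0[OF p] by simp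
        then show ?thesis using True by (simp add: count_image_mset_eq_card_vimage ty_def)
      next
        case False
        then have "{i\<in>?I. ?p i = c} = {}" "{i\<in>?I. p i = c} = {}" using p0[OF p] p by auto
        then show ?thesis by (simp only: count_image_mset_eq_card_vimage[OF finite_lessThan])
      qed
    qed
    then obtain h where "h permutes ?I" "\<forall>x\<in>?I. p x = ?p (h x)"
      using image_mset_eq_implies_permutes[of ?I p ?p] by (metis finite_lessThan)
    then have "\<exists>h. h permutes ?I \<and> (\<forall>i<k. p i = ?p (h i))" by auto
    then show ?thesis unfolding g_def by (rule someI_ex)
  qed
  have \<sigma>i: "inv \<sigma> i < k" if "i < k" for i
    using permutes_in_image[OF permutes_inv[OF \<sigma>], of i] that by simp
  let ?f = "\<lambda>(\<tau>, p). (g p \<circ> \<tau>, ty p)"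
  have "inj_on ?f ?A"
  proof (intro inj_onI, clarify)
    fix \<tau> p \<tau>' p'
    assume t: "\<tau> permutes ?I" "\<tau>' permutes ?I" and p: "p \<in> ?I \<rightarrow>\<^sub>E K" "p' \<in> ?I \<rightarrow>\<^sub>E K"
      and e: "\<forall>i<k. p (\<sigma> i) = p (\<tau> i)" "\<forall>i<k. p' (\<sigma> i) = p' (\<tau>' i)"
      and eq: "g p \<circ> \<tau> = g p' \<circ> \<tau>'" "ty p = ty p'"
    \<comment> \<open>\<open>p = p\<^sub>0 \<circ> g\<^sub>p\<close>, so \<open>p \<circ> \<sigma> = p \<circ> \<tau>\<close> makes \<open>p\<close> a function of its type and of \<open>g\<^sub>p \<circ> \<tau>\<close>\<close>
    have r: "q i = p0 (ty q) ((g q \<circ> \<theta>) (inv \<sigma> i))"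
      if "\<theta> permutes ?I" "q \<in> ?I \<rightarrow>\<^sub>E K" "\<forall>i<k. q (\<sigma> i) = q (\<theta> i)" "i < k" for q \<theta> i
    proof -
      have "q i = q (\<sigma> (inv \<sigma> i))" using \<sigma> by (simp add: permutes_inverses)
      also have "\<dots> = q (\<theta> (inv \<sigma> i))" using that \<sigma>i by blast
      also have "\<dots> = p0 (ty q) (g q (\<theta> (inv \<sigma> i)))"
        using g[OF that(2)] permutes_in_image[OF that(1), of "inv \<sigma> i"] \<sigma>i[OF that(4)] by auto
      finally show ?thesis by simp
    qed
    have pp: "p = p'"
    proof (rule PiE_ext[OF p])
      fix i assume "i \<in> ?I"
      then show "p i = p' i" using r[OF t(1) p(1) e(1), of i] r[OF t(2) p(2) e(2), of i] eq by simp
    qed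
    moreover have "\<tau> = \<tau>'"
    proof
      fix x
      have "g p (\<tau> x) = g p (\<tau>' x)" using fun_cong[OF eq(1), of x] pp by simp
      then show "\<tau> x = \<tau>' x" using permutes_inj g[OF p(1)] by (metis injD)
    qed
    ultimately show "\<tau> = \<tau>' \<and> p = p'" by simp
  qed
  moreover have "?f ` ?A \<subseteq> {\<rho>. \<rho> permutes ?I} \<times> (K \<rightarrow>\<^sub>E {..k})"
  proof -
    have "card {i\<in>?I. p i = c} \<le> k" for p :: "nat \<Rightarrow> 'a" and c
      using card_mono[of ?I "{i\<in>?I. p i = c}"] by auto
    then show ?thesis using g by (auto simp: ty_def intro: permutes_compose)
  qed
  ultimately have "card ?A \<le> card ({\<rho>. \<rho> permutes ?I} \<times> (K \<rightarrow>\<^sub>E {..k}))"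
    using K by (intro card_inj_on_le) (auto intro!: finite_PiE simp: finite_permutations)
  also have "\<dots> = fact k * (k + 1) ^ card K"
    using K by (simp add: card_cartesian_product card_permutations[of ?I k] card_PiE)
  finally show ?thesis .
qed

text \<open>The coordinates are indexed by pairs of words, and \<open>\<sigma>\<close> gives the graph of \<open>t \<mapsto> t \<circ> \<sigma>\<close>. The inner product
  of the vectors of \<open>\<sigma>\<close> and \<open>\<tau>\<close> is the number of words \<open>t\<close> with \<open>t \<circ> \<sigma> = t \<circ> \<tau>\<close>; its square counts such words
  over pairs of letters, so the previous two lemmas apply.\<close>

lemma permutation_vectors_rank:
  fixes E :: "'b set"
  assumes E: "finite E"
  shows "\<exists>S0\<subseteq>{\<sigma>. \<sigma> permutes {..<k}}.
      card E ^ (2 * k) \<le> card S0 * (k + 1) ^ (card E)\<^sup>2 \<and>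
      (\<forall>c :: (nat \<Rightarrow> nat) \<Rightarrow> 'f::field_char_0.
         (\<forall>s\<in>{..<k} \<rightarrow>\<^sub>E E. \<forall>t\<in>{..<k} \<rightarrow>\<^sub>E E.
            (\<Sum>\<sigma>\<in>S0. c \<sigma> * (if \<forall>i<k. s i = t (\<sigma> i) then 1 else 0)) = 0) \<longrightarrow> (\<forall>\<sigma>\<in>S0. c \<sigma> = 0))"
proof -
  let ?I = "{..<k}" and ?S = "{\<sigma>. \<sigma> permutes {..<k}}"
  define P where "P = ?I \<rightarrow>\<^sub>E E"
  define v :: "(nat \<Rightarrow> nat) \<Rightarrow> (nat \<Rightarrow> 'b) \<times> (nat \<Rightarrow> 'b) \<Rightarrow> rat"
    where "v \<sigma> = (\<lambda>(s, t). if \<forall>i<k. s i = t (\<sigma> i) then 1 else 0)" for \<sigma>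
  define C where "C \<sigma> \<tau> = {t \<in> P. \<forall>i<k. t (\<sigma> i) = t (\<tau> i)}" for \<sigma> \<tau> :: "nat \<Rightarrow> nat"
  have finP: "finite P" using E by (simp add: P_def finite_PiE)
  have cardP: "card P = card E ^ k" using E by (simp add: P_def card_PiE)
  have finS: "finite ?S" by (rule finite_permutations) simp
  have cS: "card ?S = fact k" by (rule card_permutations) auto
  obtain S0 where S0: "S0 \<subseteq> ?S"
    and r: "(\<Sum>s\<in>?S. \<Sum>x\<in>P \<times> P. v s x * v s x)\<^sup>2
        \<le> of_nat (card S0) * (\<Sum>s\<in>?S. \<Sum>t\<in>?S. (\<Sum>x\<in>P \<times> P. v s x * v t x)\<^sup>2)"
    and ind: "\<forall>c :: (nat \<Rightarrow> nat) \<Rightarrow> 'f. (\<forall>x\<in>P \<times> P. (\<Sum>s\<in>S0. c s * of_rat (v s x)) = 0)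
         \<longrightarrow> (\<forall>s\<in>S0. c s = 0)"
    using gram_rank_bound[OF finS, of "P \<times> P" v] finP by blast
  have ip: "(\<Sum>x\<in>P \<times> P. v \<sigma> x * v \<tau> x) = of_nat (card (C \<sigma> \<tau>))" if \<sigma>: "\<sigma> \<in> ?S" for \<sigma> \<tau>
  proof -
    let ?D = "{x \<in> P \<times> P. (\<forall>i<k. fst x i = snd x (\<sigma> i)) \<and> (\<forall>i<k. fst x i = snd x (\<tau> i))}"
    have "(\<Sum>x\<in>P \<times> P. v \<sigma> x * v \<tau> x) = (\<Sum>x\<in>P \<times> P. if x \<in> ?D then 1 else 0)"
    proof (rule sum.cong[OF refl])
      fix x assume x: "x \<in> P \<times> P"
      have "(if A then 1 else 0) * (if B then 1 else 0) = (if A \<and> B then 1 else (0::rat))" for A B by simp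
      then show "v \<sigma> x * v \<tau> x = (if x \<in> ?D then 1 else 0)"
        using x by (simp only: v_def case_prod_unfold mem_Collect_eq simp_thms)
    qed
    also have "\<dots> = of_nat (card ?D)" using finP by (simp add: sum.If_cases Int_def conj_commute)
    also have "card ?D = card (C \<sigma> \<tau>)"
    proof (rule bij_betw_same_card)
      have b: "inj_on snd ?D"
      proof (rule inj_onI)
        fix x y assume xy: "x \<in> ?D" "y \<in> ?D" "snd x = snd y"
        then have "fst x \<in> ?I \<rightarrow>\<^sub>E E" "fst y \<in> ?I \<rightarrow>\<^sub>E E" and "\<And>i. i \<in> ?I \<Longrightarrow> fst x i = fst y i"
          unfolding P_def by (simp_all add: mem_Times_iff)
        then have "fst x = fst y" by (rule PiE_ext)
        with xy show "x = y" by (simp add: prod_eq_iff)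
      qed
      have "t \<in> snd ` ?D" if t: "t \<in> C \<sigma> \<tau>" for t
      proof -
        have "\<sigma> i < k" if "i < k" for i using permutes_in_image[of \<sigma> ?I i] \<sigma> that by auto
        then have "(\<lambda>i\<in>?I. t (\<sigma> i), t) \<in> ?D" using t by (auto simp: C_def P_def)
        then show ?thesis by force
      qed
      with b show "bij_betw snd ?D (C \<sigma> \<tau>)" unfolding bij_betw_def by (auto simp: C_def)
    qed
    finally show ?thesis .
  qed
  have sq: "(card (C \<sigma> \<tau>))\<^sup>2 \<le> card {p \<in> ?I \<rightarrow>\<^sub>E (E \<times> E). \<forall>i<k. p (\<sigma> i) = p (\<tau> i)}"
    if \<sigma>: "\<sigma> \<in> ?S" and \<tau>: "\<tau> \<in> ?S" for \<sigma> \<tau>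
  proof -
    let ?f = "\<lambda>(t, t'). \<lambda>i\<in>?I. (t i, t' i)"
    have "inj_on ?f (P \<times> P)"
    proof (intro inj_onI, clarify)
      fix a b a' b' assume *: "a \<in> P" "b \<in> P" "a' \<in> P" "b' \<in> P"
        "(\<lambda>i\<in>?I. (a i, b i)) = (\<lambda>i\<in>?I. (a' i, b' i))"
      have "a i = a' i \<and> b i = b' i" if "i \<in> ?I" for i
        using fun_cong[OF *(5), of i] that by simp
      then show "a = a' \<and> b = b'" using *(1-4) unfolding P_def by (metis PiE_ext)
    qed
    then have "inj_on ?f (C \<sigma> \<tau> \<times> C \<sigma> \<tau>)" by (rule inj_on_subset) (auto simp: C_def)
    moreover have "\<sigma> i < k" "\<tau> i < k" if "i < k" for i
      using permutes_in_image[of _ ?I i] \<sigma> \<tau> that by auto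
    then have "?f ` (C \<sigma> \<tau> \<times> C \<sigma> \<tau>) \<subseteq> {p \<in> ?I \<rightarrow>\<^sub>E (E \<times> E). \<forall>i<k. p (\<sigma> i) = p (\<tau> i)}"
      by (auto simp: C_def P_def)
    ultimately have "card (C \<sigma> \<tau> \<times> C \<sigma> \<tau>) \<le> card {p \<in> ?I \<rightarrow>\<^sub>E (E \<times> E). \<forall>i<k. p (\<sigma> i) = p (\<tau> i)}"
      using E by (intro card_inj_on_le) (auto intro!: finite_subset[OF _ finite_PiE[of ?I "\<lambda>_. E \<times> E"]])
    then show ?thesis by (simp add: card_cartesian_product power2_eq_square)
  qed
  have row: "(\<Sum>\<tau>\<in>?S. (card (C \<sigma> \<tau>))\<^sup>2) \<le> fact k * (k + 1) ^ (card E)\<^sup>2" if \<sigma>: "\<sigma> \<in> ?S" for \<sigma>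
  proof -
    let ?Q = "\<lambda>\<tau>. {p \<in> ?I \<rightarrow>\<^sub>E (E \<times> E). \<forall>i<k. p (\<sigma> i) = p (\<tau> i)}"
    have "(\<Sum>\<tau>\<in>?S. (card (C \<sigma> \<tau>))\<^sup>2) \<le> (\<Sum>\<tau>\<in>?S. card (?Q \<tau>))" by (intro sum_mono sq \<sigma>)
    also have "\<dots> = card (Sigma ?S ?Q)"
      using E finS by (intro card_SigmaI[symmetric]) (auto intro!: finite_subset[OF _ finite_PiE[of ?I "\<lambda>_. E \<times> E"]])
    also have "Sigma ?S ?Q = {(\<tau>, p). \<tau> permutes ?I \<and> p \<in> ?I \<rightarrow>\<^sub>E (E \<times> E) \<and> (\<forall>i<k. p (\<sigma> i) = p (\<tau> i))}"
      by auto
    also have "card \<dots> \<le> fact k * (k + 1) ^ card (E \<times> E)"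
      using E \<sigma> by (intro card_coincidences_le) auto
    also have "card (E \<times> E) = (card E)\<^sup>2" by (simp add: card_cartesian_product power2_eq_square)
    finally show ?thesis .
  qed
  have "C \<sigma> \<sigma> = P" for \<sigma> by (auto simp: C_def)
  then have "(\<Sum>s\<in>?S. \<Sum>x\<in>P \<times> P. v s x * v s x) = (\<Sum>s\<in>?S. of_nat (card E ^ k))"
    using ip cardP by (intro sum.cong) auto
  then have l: "(\<Sum>s\<in>?S. \<Sum>x\<in>P \<times> P. v s x * v s x) = of_nat (fact k * card E ^ k)"
    using cS by simp
  have "(\<Sum>s\<in>?S. \<Sum>t\<in>?S. (\<Sum>x\<in>P \<times> P. v s x * v t x)\<^sup>2) = of_nat (\<Sum>s\<in>?S. \<Sum>t\<in>?S. (card (C s t))\<^sup>2)"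
    using ip by simp
  also have "\<dots> \<le> of_nat (\<Sum>s\<in>?S. fact k * (k + 1) ^ (card E)\<^sup>2)"
    by (intro of_nat_mono sum_mono row)
  also have "\<dots> = of_nat ((fact k)\<^sup>2 * (k + 1) ^ (card E)\<^sup>2)"
    using cS by (simp add: power2_eq_square mult.assoc)
  finally have "(of_nat (fact k * card E ^ k))\<^sup>2
      \<le> of_nat (card S0) * (of_nat ((fact k)\<^sup>2 * (k + 1) ^ (card E)\<^sup>2) :: rat)"
    using r unfolding l by (meson mult_left_mono of_nat_0_le_iff order_trans)
  then have "(fact k * card E ^ k)\<^sup>2 \<le> card S0 * ((fact k)\<^sup>2 * (k + 1) ^ (card E)\<^sup>2)"
    by (simp only: of_nat_power[symmetric] of_nat_mult[symmetric] of_nat_le_iff)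
  then have "(fact k)\<^sup>2 * card E ^ (2 * k) \<le> (fact k)\<^sup>2 * (card S0 * (k + 1) ^ (card E)\<^sup>2)"
    by (simp add: power_mult_distrib power_mult[symmetric] mult_ac)
  then have "card E ^ (2 * k) \<le> card S0 * (k + 1) ^ (card E)\<^sup>2" by simp
  moreover have "\<forall>\<sigma>\<in>S0. c \<sigma> = 0"
    if c: "\<forall>s\<in>P. \<forall>t\<in>P. (\<Sum>\<sigma>\<in>S0. c \<sigma> * (if \<forall>i<k. s i = t (\<sigma> i) then 1 else 0)) = 0"
    for c :: "(nat \<Rightarrow> nat) \<Rightarrow> 'f"
  proof -
    have "of_rat (v \<sigma> (s, t)) = (if \<forall>i<k. s i = t (\<sigma> i) then 1 else (0::'f))" for \<sigma> s t
      by (simp add: v_def)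
    then have "\<forall>x\<in>P \<times> P. (\<Sum>s\<in>S0. c s * of_rat (v s x)) = 0" using c by (simp add: split_paired_all)
    then show ?thesis using ind by blast
  qed
  ultimately show ?thesis using S0 unfolding P_def by blast
qed

section \<open>Linear algebra\<close>

text \<open>Gaussian elimination; the index sets may be of any type, which suits families that are not
  known to be injective.\<close>

lemma more_unknowns_than_equations:
  fixes m :: "'t \<Rightarrow> 'k \<Rightarrow> 'f::field"
  assumes "finite K" "finite T" "card K < card T"
  shows "\<exists>c. (\<exists>t\<in>T. c t \<noteq> 0) \<and> (\<forall>k\<in>K. (\<Sum>t\<in>T. c t * m t k) = 0)"
  using assms
proof (induct K arbitrary: T m)
  case empty
  then obtain t where "t \<in> T" by fastforce
  then show ?case by (intro exI[of _ "\<lambda>_. 1"]) auto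
next
  case (insert k K)
  show ?case
  proof (cases "\<forall>t\<in>T. m t k = 0")
    case True
    have "card K < card T" using insert by simp
    then obtain c where "\<exists>t\<in>T. c t \<noteq> 0" "\<forall>k\<in>K. (\<Sum>t\<in>T. c t * m t k) = 0"
      using insert.hyps(3)[OF insert.prems(1)] by blast
    then show ?thesis using True by (intro exI[of _ c]) auto
  next
    case False
    then obtain t0 where t0: "t0 \<in> T" "m t0 k \<noteq> 0" by blast
    let ?T = "T - {t0}"
    have "finite ?T" "card K < card ?T" using insert t0 by auto
    then obtain c where c: "\<exists>t\<in>?T. c t \<noteq> 0"
      "\<And>j. j \<in> K \<Longrightarrow> (\<Sum>t\<in>?T. c t * (m t j - m t k / m t0 k * m t0 j)) = 0"
      using insert.hyps(3)[of ?T "\<lambda>t j. m t j - m t k / m t0 k * m t0 j"] by blast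
    \<comment> \<open>the coefficient of the pivot \<open>t0\<close> is forced by equation \<open>k\<close>\<close>
    define a where "a = - (\<Sum>t\<in>?T. c t * m t k) / m t0 k"
    have s: "(\<Sum>t\<in>T. (c(t0 := a)) t * m t j) = a * m t0 j + (\<Sum>t\<in>?T. c t * m t j)" for j
      using insert.prems(1) t0(1) by (simp add: sum.remove[of T t0])
    have "(\<Sum>t\<in>T. (c(t0 := a)) t * m t j) = 0" if j: "j \<in> insert k K" for j
    proof (cases "j = k")
      case True
      then show ?thesis unfolding s using t0 by (simp add: a_def)
    next
      case False
      have "0 = (\<Sum>t\<in>?T. c t * m t j - c t * m t k * (m t0 j / m t0 k))"
        using c(2)[of j] False j by (simp add: algebra_simps)
      also have "\<dots> = (\<Sum>t\<in>?T. c t * m t j) - (\<Sum>t\<in>?T. c t * m t k) * (m t0 j / m t0 k)"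
        by (simp only: sum_subtractf sum_distrib_right)
      finally show ?thesis unfolding s by (simp add: a_def)
    qed
    moreover have "\<exists>t\<in>T. (c(t0 := a)) t \<noteq> 0" using c(1) by auto
    ultimately show ?thesis by (intro exI[of _ "c(t0 := a)"]) blast
  qed
qed

context vector_space
begin

lemma linearI:
  assumes "\<And>x y. f (x + y) = f x + f y" "\<And>c x. f (scale c x) = scale c (f x)"
  shows "Vector_Spaces.linear scale scale f"
  using assms vector_space_axioms unfolding Vector_Spaces.linear_iff by blast

lemma linear_functionalI:
  assumes "\<And>x y. f (x + y) = f x + f y" "\<And>c x. f (scale c x) = c * f x"
  shows "Vector_Spaces.linear scale (*) f"
proof -
  have "vector_space ((*) :: 'a \<Rightarrow> 'a \<Rightarrow> 'a)" by unfold_locales (simp_all add: algebra_simps)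
  then show ?thesis using assms vector_space_axioms unfolding Vector_Spaces.linear_iff by blast
qed

text \<open>Extend a basis of \<open>W\<close> to a basis of \<open>V\<close> and keep the new vectors.\<close>

lemma quotient_basis_exists:
  assumes V: "subspace V" and W: "subspace W" and WV: "W \<subseteq> V"
  shows "\<exists>T. quotient_basis scale V W T"
proof -
  obtain C where C: "C \<subseteq> W" "independent C" "W \<subseteq> span C"
    by (rule maximal_independent_subset)
  then obtain D where D: "C \<subseteq> D" "D \<subseteq> V" "independent D" "V \<subseteq> span D"
    using WV by (metis maximal_independent_subset_extend order_trans)
  have sC: "span C = W" using C W by (metis span_minimal subset_antisym)
  have "\<exists>u\<in>span (D - C). v - u \<in> W" if "v \<in> V" for v
  proof -
    have "v \<in> span (C \<union> (D - C))" using D that by (auto simp: Un_absorb1)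
    then obtain x y where "x \<in> span C" "y \<in> span (D - C)" "v = x + y"
      unfolding span_Un by auto
    then show ?thesis using sC by (intro bexI[of _ y]) auto
  qed
  moreover have "c t = 0"
    if U: "finite U" "U \<subseteq> D - C" "(\<Sum>t\<in>U. scale (c t) t) \<in> W" and t: "t \<in> U" for U c t
  proof -
    let ?x = "\<Sum>t\<in>U. scale (c t) t"
    have UD: "u \<in> span D" if "u \<in> U" for u using that U by (auto intro: span_base)
    have "representation D ?x t = (\<Sum>u\<in>U. c u * representation D u t)"
      using D UD by (subst representation_sum) (auto intro: span_scale simp: representation_scale)
    also have "\<dots> = (\<Sum>u\<in>U. if u = t then c t else 0)"
      using D U by (intro sum.cong) (auto simp: representation_basis)
    also have "\<dots> = c t" using U t by simp
    finally have "representation D ?x t = c t" .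
    moreover have "representation D ?x = representation C ?x"
      using D U sC by (intro representation_extend) auto
    moreover have "representation C ?x t = 0"
      using representation_ne_zero[of C ?x t] U t by blast
    ultimately show "c t = 0" by simp
  qed
  ultimately have "quotient_basis scale V W (D - C)"
    unfolding quotient_basis_def using D by blast
  then show ?thesis ..
qed

text \<open>The finiteness statement guards against the default value \<open>0\<close> of \<^const>\<open>card\<close> in
  \<^const>\<open>quotient_dim\<close>.\<close>

lemma quotient_dim_le:
  assumes V: "subspace V" and W: "subspace W" and WV: "W \<subseteq> V"
    and bound: "\<And>U. finite U \<Longrightarrow> U \<subseteq> V \<Longrightarrow>
      \<forall>c. (\<Sum>t\<in>U. scale (c t) t) \<in> W \<longrightarrow> (\<forall>t\<in>U. c t = 0) \<Longrightarrow> card U \<le> N"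
  shows "quotient_dim scale V W \<le> N"
    and "finite (SOME T. quotient_basis scale V W T)"
proof -
  let ?T = "SOME T. quotient_basis scale V W T"
  have T: "quotient_basis scale V W ?T"
    using quotient_basis_exists[OF V W WV] by (rule someI_ex)
  have fin: "card U \<le> N" if "finite U" "U \<subseteq> ?T" for U
  proof (rule bound[OF that(1)])
    show "U \<subseteq> V" using T that unfolding quotient_basis_def by blast
    show "\<forall>c. (\<Sum>t\<in>U. scale (c t) t) \<in> W \<longrightarrow> (\<forall>t\<in>U. c t = 0)"
      using T that unfolding quotient_basis_def by blast
  qed
  show *: "finite ?T"
  proof (rule ccontr)
    assume "infinite ?T"
    then obtain U where "U \<subseteq> ?T" "finite U" "card U = Suc N"
      using infinite_arbitrarily_large by blast
    then show False using fin[of U] by simp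
  qed
  show "quotient_dim scale V W \<le> N" unfolding quotient_dim_def using fin[OF *] by simp
qed

lemma quotient_dim_ge:
  assumes V: "subspace V" and W: "subspace W" and WV: "W \<subseteq> V"
    and bound: "\<And>U. finite U \<Longrightarrow> U \<subseteq> V \<Longrightarrow>
      \<forall>c. (\<Sum>t\<in>U. scale (c t) t) \<in> W \<longrightarrow> (\<forall>t\<in>U. c t = 0) \<Longrightarrow> card U \<le> N"
    and G: "finite G" "\<And>g. g \<in> G \<Longrightarrow> v g \<in> V"
    and ind: "\<And>c. (\<Sum>g\<in>G. scale (c g) (v g)) \<in> W \<Longrightarrow> \<forall>g\<in>G. c g = 0"
  shows "card G \<le> quotient_dim scale V W"
proof (rule ccontr)
  let ?T = "SOME T. quotient_basis scale V W T"
  have fin: "finite ?T" by (rule quotient_dim_le(2)[OF V W WV bound])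
  have T: "quotient_basis scale V W ?T"
    using quotient_basis_exists[OF V W WV] by (rule someI_ex)
  have rep: "\<forall>v\<in>V. \<exists>u\<in>span ?T. v - u \<in> W" using T unfolding quotient_basis_def by (elim conjE)
  have "\<exists>m. v g - (\<Sum>t\<in>?T. scale (m t) t) \<in> W" if g: "g \<in> G" for g
  proof -
    obtain u where u: "u \<in> span ?T" "v g - u \<in> W" using rep G(2)[OF g] by blast
    then obtain m where "u = (\<Sum>t\<in>?T. scale (m t) t)" using span_finite[OF fin] by auto
    then show ?thesis using u by blast
  qed
  then obtain m where m: "\<And>g. g \<in> G \<Longrightarrow> v g - (\<Sum>t\<in>?T. scale (m g t) t) \<in> W" by metis
  assume "\<not> card G \<le> quotient_dim scale V W"
  then have "card ?T < card G" by (simp add: quotient_dim_def)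
  then obtain c where c: "\<exists>g\<in>G. c g \<noteq> 0" "\<forall>t\<in>?T. (\<Sum>g\<in>G. c g * m g t) = 0"
    using more_unknowns_than_equations[OF fin G(1), of m] by blast
  have "(\<Sum>g\<in>G. scale (c g) (\<Sum>t\<in>?T. scale (m g t) t)) = (\<Sum>t\<in>?T. scale (\<Sum>g\<in>G. c g * m g t) t)"
    by (simp add: scale_sum_right scale_sum_left) (rule sum.swap)
  also have "\<dots> = 0" using c by simp
  finally have "(\<Sum>g\<in>G. scale (c g) (v g)) = (\<Sum>g\<in>G. scale (c g) (v g - (\<Sum>t\<in>?T. scale (m g t) t)))"
    by (simp add: scale_right_diff_distrib sum_subtractf)
  also have "\<dots> \<in> W" using W m by (intro subspace_sum subspace_scale) auto
  finally show False using ind c(1) by blast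
qed

lemma sum_coordinates:
  assumes "finite E" "independent E" "span E = UNIV"
  shows "(\<Sum>b\<in>E. scale (representation E x b) b) = x"
  using assms by (intro sum_representation_eq) auto

end

context finite_dimensional_vector_space
begin

definition trace :: "('b \<Rightarrow> 'b) \<Rightarrow> 'a" where
  "trace \<phi> = (\<Sum>b\<in>Basis. representation Basis (\<phi> b) b)"

text \<open>Expanding the vectors of one basis in the other and exchanging the two sums turns one trace into the other.\<close>

lemma trace_eq_in_basis:
  assumes \<phi>: "Vector_Spaces.linear scale scale \<phi>"
    and E: "finite E" "independent E" "span E = UNIV"
  shows "(\<Sum>b\<in>E. representation E (\<phi> b) b) = trace \<phi>"
proof -
  interpret \<phi>: Vector_Spaces.linear scale scale \<phi> by fact
  note B = finite_Basis independent_Basis span_Basis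
  interpret cB: Vector_Spaces.linear scale "(*)" "\<lambda>x. representation Basis x b" for b
    by (rule linear_representation[OF B(2,3)])
  interpret cE: Vector_Spaces.linear scale "(*)" "\<lambda>x. representation E x b" for b
    by (rule linear_representation[OF E(2,3)])
  have "trace \<phi> = (\<Sum>b\<in>Basis. representation Basis (\<phi> (\<Sum>e\<in>E. scale (representation E b e) e)) b)"
    by (simp only: trace_def sum_coordinates[OF E])
  also have "\<dots> = (\<Sum>b\<in>Basis. \<Sum>e\<in>E. representation E b e * representation Basis (\<phi> e) b)"
    by (simp add: \<phi>.sum \<phi>.scale cB.sum cB.scale)
  also have "\<dots> = (\<Sum>e\<in>E. \<Sum>b\<in>Basis. representation E b e * representation Basis (\<phi> e) b)"
    by (rule sum.swap)
  also have "\<dots> = (\<Sum>e\<in>E. representation E (\<Sum>b\<in>Basis. scale (representation Basis (\<phi> e) b) b) e)"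
    by (simp add: cE.sum cE.scale mult.commute)
  also have "\<dots> = (\<Sum>e\<in>E. representation E (\<phi> e) e)"
    by (simp only: sum_coordinates[OF B])
  finally show ?thesis by simp
qed

text \<open>In a basis that extends a basis of the range, the diagonal entries are \<open>1\<close> on the range and \<open>0\<close> elsewhere.\<close>

lemma trace_idempotent:
  assumes \<phi>: "Vector_Spaces.linear scale scale \<phi>" and idem: "\<And>x. \<phi> (\<phi> x) = \<phi> x"
  shows "trace \<phi> = of_nat (dim (range \<phi>))"
proof -
  interpret \<phi>: Vector_Spaces.linear scale scale \<phi> by fact
  obtain C where C: "C \<subseteq> range \<phi>" "independent C" "range \<phi> \<subseteq> span C" "card C = dim (range \<phi>)"
    using basis_exists by metis
  obtain E where E: "C \<subseteq> E" "independent E" "span E = UNIV"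
    using maximal_independent_subset_extend[OF subset_UNIV C(2)] by (metis top.extremum_uniqueI)
  have fin: "finite E" using E finiteI_independent by blast
  have fix1: "\<phi> b = b" if "b \<in> C" for b using C that idem by auto
  have "representation E (\<phi> b) b = (if b \<in> C then 1 else 0)" if b: "b \<in> E" for b
  proof (cases "b \<in> C")
    case True
    then show ?thesis using E b by (simp add: fix1 representation_basis)
  next
    case False
    have "\<phi> b \<in> span C" using C by auto
    then have "representation E (\<phi> b) = representation C (\<phi> b)"
      using E by (intro representation_extend) auto
    then show ?thesis using representation_ne_zero[of C "\<phi> b" b] False by auto
  qed
  then have "(\<Sum>b\<in>E. representation E (\<phi> b) b) = (\<Sum>b\<in>E. if b \<in> C then 1 else 0)" by simp
  also have "\<dots> = of_nat (card C)" using fin E(1) by (simp add: sum.If_cases Int_absorb1)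
  finally show ?thesis using trace_eq_in_basis[OF \<phi> fin E(2,3)] C by simp
qed

end

text \<open>This is \<open>p(\<phi>) v\<close> by the Horner scheme.\<close>

definition (in vector_space) poly_act :: "('b \<Rightarrow> 'b) \<Rightarrow> 'b \<Rightarrow> 'a poly \<Rightarrow> 'b" where
  "poly_act \<phi> v p = fold_coeffs (\<lambda>c x. scale c v + \<phi> x) p 0"

context vector_space
begin

context
  fixes \<phi> :: "'b \<Rightarrow> 'b" and v :: 'b assumes \<phi>: "Vector_Spaces.linear scale scale \<phi>"
begin

interpretation \<phi>: Vector_Spaces.linear scale scale \<phi> by (rule \<phi>)

lemma poly_act_0: "poly_act \<phi> v 0 = 0"
  by (simp add: poly_act_def)

lemma poly_act_pCons: "poly_act \<phi> v (pCons c p) = scale c v + \<phi> (poly_act \<phi> v p)"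
  by (cases "c = 0 \<and> p = 0") (auto simp: poly_act_def \<phi>.zero)

lemma poly_act_add: "poly_act \<phi> v (p + q) = poly_act \<phi> v p + poly_act \<phi> v q"
  by (induct p q rule: poly_induct2)
    (simp_all add: poly_act_0 poly_act_pCons \<phi>.add scale_left_distrib algebra_simps)

lemma poly_act_smult: "poly_act \<phi> v (smult c p) = scale c (poly_act \<phi> v p)"
  by (induct p) (simp_all add: poly_act_0 poly_act_pCons \<phi>.scale scale_right_distrib)

lemma poly_act_monom: "poly_act \<phi> v (monom c i) = scale c ((\<phi> ^^ i) v)"
  by (induct i) (simp_all add: poly_act_0 poly_act_pCons monom_0 monom_Suc \<phi>.zero \<phi>.scale)

lemma poly_act_sum: "poly_act \<phi> v (sum f I) = (\<Sum>i\<in>I. poly_act \<phi> v (f i))"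
  by (induct I rule: infinite_finite_induct) (simp_all add: poly_act_0 poly_act_add)

lemma poly_act_linear_factor:
  "poly_act \<phi> v ([:- a, 1:] * q) = \<phi> (poly_act \<phi> v q) - scale a (poly_act \<phi> v q)"
proof -
  have "[:- a, 1:] * q = smult (- a) q + pCons 0 q" by simp
  then show ?thesis by (simp only: poly_act_add poly_act_pCons poly_act_smult) simp
qed

end

end

text \<open>Take a nonzero polynomial \<open>p\<close> of least degree with \<open>p(\<phi>) v = 0\<close> and split off a linear factor \<open>X - a\<close>: the
  cofactor applied to \<open>v\<close> is nonzero and is annihilated by \<open>\<phi> - a\<close>.\<close>

lemma eigenvector_exists:
  fixes scale :: "'f::alg_closed_field \<Rightarrow> 'v::ab_group_add \<Rightarrow> 'v" and v :: 'v
  assumes "finite_dimensional_vector_space scale E"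
    and \<phi>: "Vector_Spaces.linear scale scale \<phi>" and v: "v \<noteq> 0"
  shows "\<exists>a w. w \<noteq> 0 \<and> \<phi> w = scale a w"
proof -
  interpret finite_dimensional_vector_space scale E by fact
  interpret \<phi>: Vector_Spaces.linear scale scale \<phi> by fact
  note B = finite_Basis independent_Basis span_Basis
  let ?act = "poly_act \<phi> v"
  let ?I = "{..card E}"
  obtain c where c: "\<exists>i\<in>?I. c i \<noteq> 0"
      "\<forall>b\<in>E. (\<Sum>i\<in>?I. c i * representation E ((\<phi> ^^ i) v) b) = 0"
    using more_unknowns_than_equations[of E ?I "\<lambda>i b. representation E ((\<phi> ^^ i) v) b"]
      finite_Basis by (metis card_atMost finite_atMost lessI)
  let ?p = "\<Sum>i\<in>?I. monom (c i) i"
  interpret c: Vector_Spaces.linear scale "(*)" "\<lambda>x. representation E x b" for b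
    by (rule linear_representation[OF B(2,3)])
  have "?act ?p = (\<Sum>b\<in>E. scale (representation E (?act ?p) b) b)"
    by (simp only: sum_coordinates[OF B])
  also have "\<dots> = 0" using c(2) by (simp add: poly_act_sum[OF \<phi>] poly_act_monom[OF \<phi>] c.sum c.scale)
  finally have "?act ?p = 0" .
  moreover obtain i where "i \<in> ?I" "c i \<noteq> 0" using c by blast
  then have "coeff ?p i \<noteq> 0" by (simp add: coeff_sum)
  then have "?p \<noteq> 0" by auto
  ultimately obtain p where p: "p \<noteq> 0" "?act p = 0"
    and min: "\<And>q. q \<noteq> 0 \<and> ?act q = 0 \<Longrightarrow> degree p \<le> degree q"
    using ex_has_least_nat[of "\<lambda>q. q \<noteq> 0 \<and> ?act q = 0" ?p degree] by blast
  have "degree p > 0"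
  proof (rule ccontr)
    assume "\<not> degree p > 0"
    then obtain a where "p = [:a:]" by (metis degree_eq_zeroE gr0I)
    then show False using p v \<phi>.zero by (simp add: poly_act_pCons[OF \<phi>] poly_act_0[OF \<phi>])
  qed
  then obtain a where "poly p a = 0" using alg_closed_imp_poly_has_root by blast
  then obtain q where q: "p = [:- a, 1:] * q" by (metis poly_eq_0_iff_dvd dvdE)
  then have "q \<noteq> 0" using p by auto
  then have "degree p = Suc (degree q)" unfolding q by (subst degree_mult_eq) auto
  then have "?act q \<noteq> 0" using min[of q] \<open>q \<noteq> 0\<close> by auto
  moreover have "\<phi> (?act q) = scale a (?act q)"
    using p(2) unfolding q poly_act_linear_factor[OF \<phi>] by simp
  ultimately show ?thesis by blast
qed

section \<open>Nilpotent ideals, idempotents and the radical\<close>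

locale fd_algebra = assoc_algebra scale + finite_dimensional_vector_space scale Basis
  for scale :: "'f::field \<Rightarrow> 'a::ring \<Rightarrow> 'a" and Basis :: "'a set"
begin

text \<open>The iterated product ends in an arbitrary algebra element \<open>y\<close>, so that no unit is needed for the empty
  product. Up to a change of the exponent this is nilpotency in the usual sense.\<close>

definition nilpotent :: "'a set \<Rightarrow> bool" where
  "nilpotent N \<longleftrightarrow> (\<exists>p. \<forall>xs y. length xs = p \<and> set xs \<subseteq> N \<longrightarrow> foldr (*) xs y = 0)"

lemma left_idealD:
  assumes "left_ideal L"
  shows "subspace L" "x \<in> L \<Longrightarrow> a * x \<in> L"
  using assms unfolding left_ideal_def by auto

lemma linear_mult_left: "Vector_Spaces.linear scale scale (\<lambda>y. a * y)"
  by (rule linearI) (simp_all add: distrib_left scale_mult_right)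

lemma linear_mult_right: "Vector_Spaces.linear scale scale (\<lambda>y. y * a)"
  by (rule linearI) (simp_all add: distrib_right scale_mult_left)

lemma foldr_mult_zero: "foldr (*) xs (0::'a) = 0"
  by (induct xs) auto

lemma linear_foldr_mult: "Vector_Spaces.linear scale scale (foldr (*) xs)"
proof (rule linearI)
  show "foldr (*) xs (x + y) = foldr (*) xs x + foldr (*) xs y" for x y
    by (induct xs) (simp_all add: distrib_left)
  show "foldr (*) xs (scale c x) = scale c (foldr (*) xs x)" for c x
    by (induct xs) (simp_all add: scale_mult_right)
qed

lemma left_ideal_mult_right:
  assumes "left_ideal L"
  shows "left_ideal ((\<lambda>y. y * a) ` L)"
proof -
  interpret l: Vector_Spaces.linear scale scale "\<lambda>y. y * a" by (rule linear_mult_right)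
  have "subspace ((\<lambda>y. y * a) ` L)" using left_idealD(1)[OF assms] by (rule l.subspace_image)
  moreover have "b * x \<in> (\<lambda>y. y * a) ` L" if "x \<in> (\<lambda>y. y * a) ` L" for b x
    using that left_idealD(2)[OF assms] by (auto simp: mult.assoc[symmetric])
  ultimately show ?thesis unfolding left_ideal_def by blast
qed

lemma left_ideal_UNIV: "left_ideal UNIV"
  unfolding left_ideal_def by simp

lemma inj_on_if_surj_on_subspace:
  assumes \<phi>: "Vector_Spaces.linear scale scale \<phi>" and D: "subspace D" "\<phi> ` D = D"
  shows "inj_on \<phi> D"
proof -
  interpret \<phi>: Vector_Spaces.linear scale scale \<phi> by fact
  obtain C where C: "C \<subseteq> D" "independent C" "D \<subseteq> span C" "card C = dim D"
    using basis_exists by metis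
  have sC: "span C = D" using C D by (metis span_minimal subset_antisym)
  have finC: "finite C" using C finiteI_independent by blast
  have sp: "D \<subseteq> span (\<phi> ` C)" using \<phi>.span_image[of C] sC D(2) by simp
  have "dim D \<le> card (\<phi> ` C)" using sp finC by (intro dim_le_card) auto
  then have "card (\<phi> ` C) = card C" using C(4) card_image_le[OF finC, of \<phi>] by simp
  then have "inj_on \<phi> C" using finC by (simp add: eq_card_imp_inj_on)
  moreover have "independent (\<phi> ` C)"
    using card_eq_dim[of "\<phi> ` C" D] C D sp finC \<open>card (\<phi> ` C) = card C\<close> by auto
  ultimately have "inj_on \<phi> (span C)" using \<phi>.inj_on_span_independent_image by blast
  then show ?thesis using sC by simp
qed

text \<open>Consider left ideals \<open>L\<close> that are not annihilated by any power of \<open>N\<close>, and one of least dimension. Some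
  \<open>N x\<close> with \<open>x \<in> L\<close> is of the same kind, since otherwise a common power of \<open>N\<close> would kill a basis of \<open>L\<close>. By
  minimality \<open>N x = L\<close>, which contains \<open>x\<close>.\<close>

lemma fixed_vector_if_not_nilpotent:
  assumes N: "left_ideal N" "\<not> nilpotent N"
  shows "\<exists>a\<in>N. \<exists>x. x \<noteq> 0 \<and> a * x = x"
proof -
  define C where "C L \<longleftrightarrow> (\<forall>k. \<exists>xs. length xs = k \<and> set xs \<subseteq> N \<and> (\<exists>y\<in>L. foldr (*) xs y \<noteq> 0))" for L
  have "C UNIV" using N(2) unfolding C_def nilpotent_def by blast
  then obtain L where L: "left_ideal L" "C L"
    and min: "\<And>M. left_ideal M \<and> C M \<Longrightarrow> dim L \<le> dim M"
    using ex_has_least_nat[of "\<lambda>L. left_ideal L \<and> C L" UNIV dim] left_ideal_UNIV by blast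
  have "\<exists>x\<in>L. C ((\<lambda>n. n * x) ` N)"
  proof (rule ccontr)
    assume "\<not> ?thesis"
    then have "\<forall>x\<in>L. \<exists>k. \<forall>xs. length xs = k \<and> set xs \<subseteq> N \<longrightarrow> (\<forall>n\<in>N. foldr (*) xs (n * x) = 0)"
      unfolding C_def by blast
    then obtain k where k: "\<And>x xs n. x \<in> L \<Longrightarrow> length xs = k x \<Longrightarrow> set xs \<subseteq> N \<Longrightarrow> n \<in> N
        \<Longrightarrow> foldr (*) xs (n * x) = 0"
      by metis
    obtain D where D: "D \<subseteq> L" "independent D" "L \<subseteq> span D" using basis_exists by metis
    have finD: "finite D" using D finiteI_independent by blast
    let ?K = "\<Sum>x\<in>D. k x"
    obtain xs y where xs: "length xs = Suc ?K" "set xs \<subseteq> N" "y \<in> L" "foldr (*) xs y \<noteq> 0"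
      using L(2) unfolding C_def by blast
    interpret l: Vector_Spaces.linear scale scale "foldr (*) xs" by (rule linear_foldr_mult)
    have "foldr (*) xs b = 0" if b: "b \<in> D" for b
    proof -
      obtain ys n where ys: "xs = ys @ [n]" using xs(1) by (cases xs rule: rev_cases) auto
      let ?j = "length ys - k b"
      have le: "k b \<le> length ys" using xs(1) ys member_le_sum[OF b, of k] finD by simp
      have "foldr (*) (drop ?j ys) (n * b) = 0"
      proof (rule k)
        show "b \<in> L" using b D by auto
        show "length (drop ?j ys) = k b" using le by simp
        show "set (drop ?j ys) \<subseteq> N" using xs(2) ys set_drop_subset[of ?j ys] by auto
        show "n \<in> N" using xs(2) ys by simp
      qed
      then have "foldr (*) (take ?j ys @ drop ?j ys) (n * b) = 0"
        by (simp only: foldr_append foldr_mult_zero o_def)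
      then show ?thesis unfolding ys by simp
    qed
    then have "foldr (*) xs y = 0"
      using l.eq_0_on_span[of D y] D(3) xs(3) by blast
    then show False using xs by simp
  qed
  then obtain x where x: "x \<in> L" "C ((\<lambda>n. n * x) ` N)" by blast
  let ?M = "(\<lambda>n. n * x) ` N"
  have M: "left_ideal ?M" by (rule left_ideal_mult_right[OF N(1)])
  have "?M = L"
  proof (rule subspace_dim_equal)
    show "subspace ?M" "subspace L" using M L left_idealD by auto
    show "?M \<subseteq> L" using x L left_idealD by auto
    show "dim L \<le> dim ?M" using min M x by blast
  qed
  then obtain a where a: "a \<in> N" "x = a * x" using x(1) by blast
  have "x \<noteq> 0" using x(2) unfolding C_def by (auto simp: foldr_mult_zero)
  then show ?thesis using a by metis
qed

text \<open>An element \<open>a \<in> N\<close> with a nonzero fixed vector has nonzero powers. If \<open>b\<close> is a power of \<open>a\<close> for which \<open>A b\<close> has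
  least dimension, then right multiplication by \<open>c = b b\<close> is a bijection of \<open>A b\<close>, and the solution \<open>e\<close> of
  \<open>e c = c\<close> in \<open>A b\<close> is idempotent.\<close>

lemma idempotent_if_not_nilpotent:
  assumes N: "left_ideal N" "\<not> nilpotent N"
  shows "\<exists>e\<in>N. e \<noteq> 0 \<and> e * e = e"
proof -
  obtain a x where a: "a \<in> N" "x \<noteq> 0" "a * x = x"
    using fixed_vector_if_not_nilpotent[OF N] by blast
  \<comment> \<open>\<open>b j\<close> is the power \<open>a\<^sup>j\<^sup>+\<^sup>1\<close>\<close>
  define b where "b j = ((\<lambda>y. y * a) ^^ j) a" for j
  have b_Suc: "b (Suc j) = b j * a" for j by (simp add: b_def)
  have bb: "b j * b k = b (Suc (j + k))" for j k
    by (induct k) (simp_all add: b_Suc mult.assoc[symmetric], simp add: b_def)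
  have bx: "b j * x = x" for j
    by (induct j) (simp_all add: b_Suc mult.assoc a, simp add: b_def a)
  have bN: "b j \<in> N" for j
    by (cases j) (simp_all add: b_Suc a left_idealD[OF N(1)], simp add: b_def a)
  define R where "R j = range (\<lambda>y. y * b j)" for j
  obtain j where j: "\<And>k. dim (R j) \<le> dim (R k)"
    using ex_has_least_nat[of "\<lambda>_. True" 0 "\<lambda>j. dim (R j)"] by blast
  define c where "c = b j * b j"
  have R: "subspace (R k)" for k
    unfolding R_def using left_ideal_mult_right[OF left_ideal_UNIV] left_idealD(1) by blast
  have Rc: "R j = range (\<lambda>y. y * c)"
  proof -
    have "R (Suc (j + j)) = R j"
    proof (rule subspace_dim_equal[OF R R _ j])
      show "R (Suc (j + j)) \<subseteq> R j" unfolding R_def bb[symmetric] by (auto simp: mult.assoc[symmetric])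
    qed
    then show ?thesis unfolding R_def c_def bb by simp
  qed
  have surj: "(\<lambda>y. y * c) ` R j = R j"
  proof -
    have "(\<lambda>y. y * c) ` R j = range (\<lambda>y. y * (c * b j))" unfolding R_def c_def by (simp add: image_image mult.assoc)
    also have "\<dots> = (\<lambda>y. y * b j) ` R j" unfolding Rc by (simp add: image_image mult.assoc)
    also have "\<dots> = range (\<lambda>y. y * c)" unfolding R_def c_def by (simp add: image_image mult.assoc)
    finally show ?thesis using Rc by simp
  qed
  have inj: "inj_on (\<lambda>y. y * c) (R j)"
    by (rule inj_on_if_surj_on_subspace[OF linear_mult_right R surj])
  have "c \<in> R j" unfolding R_def c_def by blast
  then obtain e where e: "e \<in> R j" "e * c = c" using surj by force
  have "e * e \<in> R j" using left_idealD(2)[OF left_ideal_mult_right[OF left_ideal_UNIV]] e(1)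
    unfolding R_def by blast
  moreover have "e * e * c = e * c" using e by (simp add: mult.assoc)
  ultimately have "e * e = e" using inj e(1) by (auto dest: inj_onD)
  moreover have "e \<noteq> 0"
  proof
    assume "e = 0"
    then have "c = 0" using e by simp
    moreover have "c * x = x" by (simp add: c_def mult.assoc bx)
    ultimately show False using a by simp
  qed
  moreover have "e \<in> N" using e(1) left_idealD(2)[OF N(1) bN] unfolding R_def by blast
  ultimately show ?thesis by blast
qed

text \<open>Choose an idempotent \<open>e \<in> I\<close> whose left annihilator in \<open>I\<close> has least dimension. If this were nonzero it would
  contain an idempotent \<open>f \<noteq> 0\<close>, and \<open>e + f - e f\<close> would have a smaller left annihilator; so \<open>e\<close> is a right identity
  of \<open>I\<close>. The elements \<open>x\<close> of \<open>I\<close> with \<open>e x = 0\<close> form an ideal of square zero, so \<open>e\<close> is also a left identity.\<close>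

lemma ideal_identity:
  assumes nn: "\<And>N. left_ideal N \<Longrightarrow> nilpotent N \<Longrightarrow> N = {0}"
    and I: "two_sided_ideal I"
  shows "\<exists>e\<in>I. \<forall>x\<in>I. e * x = x \<and> x * e = x"
proof -
  have sI: "subspace I" and aI: "\<And>a x. x \<in> I \<Longrightarrow> a * x \<in> I" "\<And>a x. x \<in> I \<Longrightarrow> x * a \<in> I"
    using I unfolding two_sided_ideal_def by auto
  let ?N = "\<lambda>e. {x \<in> I. x * e = 0}"
  have N: "left_ideal (?N e)" for e
    unfolding left_ideal_def subspace_def using sI aI
    by (auto simp: distrib_right scale_mult_left[symmetric] mult.assoc subspace_0 subspace_add subspace_scale)
  have "0 \<in> I \<and> 0 * 0 = (0::'a)" using sI by (simp add: subspace_0)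
  then obtain e where e: "e \<in> I" "e * e = e"
    and min: "\<And>f. f \<in> I \<and> f * f = f \<Longrightarrow> dim (?N e) \<le> dim (?N f)"
    using ex_has_least_nat[of "\<lambda>e. e \<in> I \<and> e * e = e" 0 "\<lambda>e. dim (?N e)"] by blast
  have Ne: "?N e = {0}"
  proof (rule ccontr)
    assume "?N e \<noteq> {0}"
    then obtain f where f: "f \<in> I" "f * e = 0" "f \<noteq> 0" "f * f = f"
      using nn[OF N[of e]] idempotent_if_not_nilpotent[OF N[of e]] by blast
    let ?g = "e + f - e * f"
    have fz: "f * (e * z) = 0" for z using f(2) by (simp add: mult.assoc[symmetric])
    have ge: "?g * e = e" using e f by (simp add: algebra_simps)
    have fg: "f * ?g = f" using f fz by (simp add: algebra_simps)
    have eez: "e * (e * z) = e * z" for z using e by (simp add: mult.assoc[symmetric])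
    have gg: "?g * ?g = ?g" using e f fz eez by (simp add: algebra_simps)
    have gI: "?g \<in> I" using e f sI aI by (intro subspace_diff subspace_add) auto
    have sub: "?N ?g \<subseteq> ?N e"
    proof clarify
      fix x assume "x \<in> I" "x * ?g = 0"
      then have "x * (?g * e) = 0" by (simp add: mult.assoc[symmetric])
      then show "x * e = 0" using ge by simp
    qed
    have "?N ?g = ?N e"
      using sub min[of ?g] gg gI N left_idealD(1) by (intro subspace_dim_equal) auto
    moreover have "f \<in> ?N e" using f by simp
    ultimately have "f * ?g = 0" by blast
    then show False using fg f by simp
  qed
  have xe: "x * e = x" if x: "x \<in> I" for x
  proof -
    have "x - x * e \<in> ?N e" using x e sI aI by (auto simp: left_diff_distrib mult.assoc intro: subspace_diff)
    then show ?thesis using Ne by auto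
  qed
  let ?R = "{x \<in> I. e * x = 0}"
  have "left_ideal ?R"
  proof -
    have "e * (a * x) = 0" if "x \<in> I" "e * x = 0" for a x
    proof -
      have "e * (a * x) = (e * a * e) * x" using xe[OF aI(2)[OF e(1)], of a] by (simp add: mult.assoc)
      then show ?thesis using that by (simp add: mult.assoc)
    qed
    then show ?thesis unfolding left_ideal_def subspace_def using sI aI
      by (auto simp: distrib_left scale_mult_right[symmetric] subspace_0 subspace_add subspace_scale)
  qed
  moreover have "nilpotent ?R"
    unfolding nilpotent_def
  proof (intro exI allI impI)
    fix xs y assume xs: "length xs = 2 \<and> set xs \<subseteq> ?R"
    then obtain u v where uv: "xs = [u, v]" by (auto simp: numeral_2_eq_2 length_Suc_conv)
    have "u * v = u * e * v" using xe xs uv by simp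
    also have "\<dots> = 0" using xs uv by (simp add: mult.assoc)
    finally have "u * v * y = 0" by simp
    then show "foldr (*) xs y = 0" using uv by (simp add: mult.assoc)
  qed
  ultimately have R0: "?R = {0}" by (rule nn)
  have "e * x = x" if x: "x \<in> I" for x
  proof -
    have "x - e * x \<in> ?R"
      using x e sI aI by (auto simp: right_diff_distrib mult.assoc[symmetric] intro: subspace_diff)
    then show ?thesis using R0 by auto
  qed
  then show ?thesis using e xe by blast
qed

lemma left_ideal_jacobson_radical: "left_ideal jacobson_radical"
  unfolding left_ideal_def jacobson_radical_def
  by (auto simp: maximal_left_ideal_def left_ideal_def intro!: subspace_Inter)

text \<open>If \<open>N\<close> is not contained in the maximal left ideal \<open>L\<close>, then \<open>L\<close> has a modular unit in \<open>N + L\<close>, hence one in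
  \<open>N\<close>, say \<open>n\<close>. Then \<open>x - x n\<^sup>k \<in> L\<close> for all \<open>k\<close>, and nilpotency of \<open>n\<close> gives \<open>L = A\<close>.\<close>

lemma nilpotent_left_ideal_in_radical:
  assumes N: "left_ideal N" "nilpotent N"
  shows "N \<subseteq> jacobson_radical"
proof -
  obtain p where p: "\<And>xs y. length xs = p \<Longrightarrow> set xs \<subseteq> N \<Longrightarrow> foldr (*) xs y = 0"
    using N(2) unfolding nilpotent_def by blast
  have "N \<subseteq> L" if L: "maximal_left_ideal L" "modular_left_ideal L" for L
  proof (rule ccontr)
    assume nsub: "\<not> N \<subseteq> L"
    have lL: "left_ideal L" and pr: "L \<noteq> UNIV"
      and mx: "\<And>M. left_ideal M \<Longrightarrow> L \<subseteq> M \<Longrightarrow> M = L \<or> M = UNIV"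
      using L unfolding maximal_left_ideal_def by auto
    obtain e where e: "\<And>x. x - x * e \<in> L" using L unfolding modular_left_ideal_def by blast
    note sL = left_idealD[OF lL] and sN = left_idealD[OF N(1)]
    let ?M = "{n + l | n l. n \<in> N \<and> l \<in> L}"
    have "left_ideal ?M"
      unfolding left_ideal_def
    proof (intro conjI allI ballI)
      show "subspace ?M" using sL(1) sN(1) by (intro subspace_sums)
      show "a * x \<in> ?M" if "x \<in> ?M" for a x
        using that sL(2) sN(2) by (force simp: distrib_left)
    qed
    moreover have "L \<subseteq> ?M" using subspace_0[OF sN(1)] by force
    moreover have "N \<subseteq> ?M" using subspace_0[OF sL(1)] by force
    ultimately have "?M = UNIV" using mx nsub by blast
    then obtain n l where nl: "e = n + l" "n \<in> N" "l \<in> L" by blast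
    have step: "x - x * n \<in> L" for x
    proof -
      have eq: "x - x * n = (x - x * e) + x * l" by (simp add: nl(1) algebra_simps)
      show ?thesis unfolding eq using subspace_add[OF sL(1) e sL(2)[OF nl(3)]] .
    qed
    have pw: "x - x * foldr (*) (replicate k n) n \<in> L" for x k
    proof (induct k arbitrary: x)
      case 0
      then show ?case using step by simp
    next
      case (Suc k)
      have eq: "x - x * foldr (*) (replicate (Suc k) n) n
          = (x - x * n) + (x * n - x * n * foldr (*) (replicate k n) n)"
        by (simp add: mult.assoc)
      show ?case unfolding eq using subspace_add[OF sL(1) step Suc] .
    qed
    have "foldr (*) (replicate p n) n = 0" using nl(2) by (intro p) auto
    then have "x \<in> L" for x using pw[of x p] by simp
    then show False using pr by blast
  qed
  then show ?thesis unfolding jacobson_radical_def by blast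
qed

lemma nilpotent_left_ideal_zero:
  assumes "jacobson_radical = {0}" "left_ideal N" "nilpotent N"
  shows "N = {0}"
  using nilpotent_left_ideal_in_radical[OF assms(2,3)] assms(1) left_idealD(1)[OF assms(2)] subspace_0
  by blast

lemma identity_element_exists:
  assumes "jacobson_radical = {0}"
  obtains u :: 'a where "\<And>x. u * x = x" "\<And>x. x * u = x"
proof -
  have "two_sided_ideal UNIV" unfolding two_sided_ideal_def by simp
  from ideal_identity[OF nilpotent_left_ideal_zero[OF assms] this] show ?thesis
    using that by auto
qed

text \<open>Otherwise the radical contains an idempotent \<open>e \<noteq> 0\<close>. The modular left ideal of all \<open>x - x e\<close> does not contain
  \<open>e\<close> and lies in a maximal left ideal, which is modular with the same \<open>e\<close> and must contain \<open>e\<close>, a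
  contradiction.\<close>

lemma nilpotent_jacobson_radical: "nilpotent jacobson_radical"
proof (rule ccontr)
  assume "\<not> nilpotent jacobson_radical"
  then obtain e where e: "e \<in> jacobson_radical" "e \<noteq> 0" "e * e = e"
    using idempotent_if_not_nilpotent[OF left_ideal_jacobson_radical] by blast
  let ?L = "range (\<lambda>x. x - x * e)"
  let ?P = "\<lambda>M. left_ideal M \<and> ?L \<subseteq> M \<and> M \<noteq> UNIV"
  have "left_ideal ?L"
  proof -
    have "Vector_Spaces.linear scale scale (\<lambda>x. x - x * e)"
      by (intro linearI) (simp_all add: algebra_simps scale_mult_left scale_right_diff_distrib)
    then interpret l: Vector_Spaces.linear scale scale "\<lambda>x. x - x * e" .
    have "a * (x - x * e) = a * x - a * x * e" for a x by (simp add: algebra_simps)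
    then show ?thesis unfolding left_ideal_def using l.subspace_image[OF subspace_UNIV] by auto
  qed
  moreover have "e \<notin> ?L"
  proof
    assume "e \<in> ?L"
    then obtain x where x: "e = x - x * e" by blast
    have "e * e = x * e - x * (e * e)" using arg_cong[OF x, of "\<lambda>z. z * e"] by (simp add: algebra_simps)
    then show False using e by simp
  qed
  ultimately have "?P ?L" by blast
  from ex_has_least_nat[of ?P, OF this, of "\<lambda>M. dimension - dim M"]
  obtain M where "?P M \<and> (\<forall>M'. ?P M' \<longrightarrow> dimension - dim M \<le> dimension - dim M')"
    by (rule exE)
  then have M: "?P M" and mx': "\<And>M'. ?P M' \<Longrightarrow> dimension - dim M \<le> dimension - dim M'"
    by simp_all
  have mx: "dim M' \<le> dim M" if "?P M'" for M'
    using mx'[OF that] dim_subset_UNIV[of M] dim_subset_UNIV[of M'] by linarith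
  have "maximal_left_ideal M"
    unfolding maximal_left_ideal_def
  proof (intro conjI allI impI)
    show "left_ideal M" "M \<noteq> UNIV" using M by auto
    fix M' assume M': "left_ideal M' \<and> M \<subseteq> M'"
    show "M' = M \<or> M' = UNIV"
    proof (rule disjCI)
      assume "M' \<noteq> UNIV"
      then have "dim M' \<le> dim M" using M M' by (intro mx) blast
      then show "M' = M" using subspace_dim_equal[of M M'] M M' left_idealD(1) by auto
    qed
  qed
  moreover have "modular_left_ideal M" unfolding modular_left_ideal_def using M by blast
  ultimately have "e \<in> M" using e(1) unfolding jacobson_radical_def by blast
  then have "x \<in> M" for x
  proof -
    have "(x - x * e) + x * e \<in> M"
      using M \<open>e \<in> M\<close> left_idealD[of M] by (intro subspace_add) blast+
    then show ?thesis by simp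
  qed
  then show False using M by blast
qed

text \<open>Left multiplication by \<open>J\<close> raises the index \<open>k\<close>, and for a left ideal \<open>J\<close> left multiplication by any element
  of the algebra preserves it: an element in front can be absorbed into the first factor from \<open>J\<close>.\<close>

definition fold_products :: "'a set \<Rightarrow> nat \<Rightarrow> 'a set" where
  "fold_products J k = {foldr (*) xs y | xs y. length xs = k \<and> set xs \<subseteq> J}"

lemma fold_products_mult:
  assumes "z \<in> fold_products J k" "j \<in> J"
  shows "j * z \<in> fold_products J (Suc k)"
proof -
  obtain xs y where "z = foldr (*) xs y" "length xs = k" "set xs \<subseteq> J"
    using assms unfolding fold_products_def by blast
  then show ?thesis unfolding fold_products_def using assms(2)
    by (intro CollectI exI[of _ "j # xs"] exI[of _ y]) simp
qed

lemma fold_products_absorb: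
  assumes "z \<in> fold_products J k" "left_ideal J"
  shows "a * z \<in> fold_products J k"
proof -
  obtain xs y where z: "z = foldr (*) xs y" "length xs = k" "set xs \<subseteq> J"
    using assms unfolding fold_products_def by blast
  show ?thesis
  proof (cases xs)
    case Nil
    then show ?thesis using z unfolding fold_products_def
      by (intro CollectI exI[of _ "[]"] exI[of _ "a * y"]) simp
  next
    case (Cons x xs')
    then show ?thesis using z left_idealD[OF assms(2)] unfolding fold_products_def
      by (intro CollectI exI[of _ "(a * x) # xs'"] exI[of _ y]) (simp add: mult.assoc)
  qed
qed

text \<open>For \<open>a \<in> A\<close> the left ideal \<open>J a\<close> is nilpotent along with \<open>J\<close>, hence contained in \<open>J\<close>.\<close>

lemma two_sided_ideal_jacobson_radical: "two_sided_ideal jacobson_radical"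
proof -
  let ?J = "jacobson_radical"
  note J = left_ideal_jacobson_radical
  obtain p where p: "\<And>xs y. length xs = p \<Longrightarrow> set xs \<subseteq> ?J \<Longrightarrow> foldr (*) xs y = 0"
    using nilpotent_jacobson_radical unfolding nilpotent_def by blast
  have "x * a \<in> ?J" if "x \<in> ?J" for x a
  proof -
    let ?N = "(\<lambda>y. y * a) ` ?J"
    have "foldr (*) xs y \<in> fold_products ?J (length xs)" if "set xs \<subseteq> ?N" for xs y
      using that
    proof (induct xs)
      case Nil
      then show ?case by (auto simp: fold_products_def)
    next
      case (Cons n xs)
      then obtain j where "j \<in> ?J" "n = j * a" by auto
      moreover have "foldr (*) xs y \<in> fold_products ?J (length xs)" using Cons by simp
      ultimately show ?case
        using fold_products_mult[OF fold_products_absorb[OF _ J]] by (simp add: mult.assoc)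
    qed
    then have "foldr (*) xs y = 0" if "length xs = p" "set xs \<subseteq> ?N" for xs y
      using p that unfolding fold_products_def by fastforce
    then have "nilpotent ?N" unfolding nilpotent_def by blast
    then show ?thesis
      using nilpotent_left_ideal_in_radical[OF left_ideal_mult_right[OF J]] that by blast
  qed
  then show ?thesis using J unfolding two_sided_ideal_def left_ideal_def by blast
qed

text \<open>The factors from \<open>J\<close> need not be adjacent: the factors in between are absorbed.\<close>

lemma product_with_radical_entries_vanishes:
  shows "\<exists>p. \<forall>xs. p \<le> length (filter (\<lambda>x. x \<in> jacobson_radical) xs) \<longrightarrow> nonempty_prod xs = 0"
proof -
  let ?J = "jacobson_radical"
  obtain p where p: "\<And>xs y. length xs = p \<Longrightarrow> set xs \<subseteq> ?J \<Longrightarrow> foldr (*) xs y = 0"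
    using nilpotent_jacobson_radical unfolding nilpotent_def by blast
  have mem: "foldr (*) xs y \<in> fold_products ?J (length (filter (\<lambda>x. x \<in> ?J) xs))" for xs y
  proof (induct xs)
    case Nil
    then show ?case by (auto simp: fold_products_def)
  next
    case (Cons x xs)
    then show ?case
      using fold_products_mult fold_products_absorb[OF _ left_ideal_jacobson_radical] by simp
  qed
  have zero: "foldr (*) xs y = 0" if "length xs \<ge> p" "set xs \<subseteq> ?J" for xs y
  proof -
    have "foldr (*) (take (length xs - p) xs @ drop (length xs - p) xs) y = 0"
    proof -
      have "foldr (*) (drop (length xs - p) xs) y = 0"
        using that set_drop_subset[of "length xs - p" xs] by (intro p) auto
      then show ?thesis by (simp only: foldr_append o_def foldr_mult_zero)
    qed
    then show ?thesis by simp
  qed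
  have prod: "nonempty_prod (xs @ [x]) = foldr (*) xs x" for xs :: "'a list" and x
  proof (induct xs)
    case (Cons y ys)
    then show ?case by (cases ys) auto
  qed simp
  \<comment> \<open>one factor more than \<open>p\<close>, because the last factor takes the place of \<open>y\<close>\<close>
  have "nonempty_prod xs = 0" if "Suc p \<le> length (filter (\<lambda>x. x \<in> ?J) xs)" for xs
  proof (cases xs rule: rev_cases)
    case (snoc ys y)
    then have "p \<le> length (filter (\<lambda>x. x \<in> ?J) ys)" using that by (auto split: if_splits)
    then have "foldr (*) ys y = 0" using mem[of ys y] zero unfolding fold_products_def by fastforce
    then show ?thesis using snoc prod by simp
  qed simp
  then show ?thesis by blast
qed

lemma trace_mult_idempotent:
  assumes "e * e = e"
  shows "trace (\<lambda>x. e * x) = of_nat (dim (range (\<lambda>x. e * x)))"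
  by (rule trace_idempotent[OF linear_mult_left]) (simp add: assms mult.assoc[symmetric])

lemma linear_trace_mult: "Vector_Spaces.linear scale (*) (\<lambda>y. trace (\<lambda>x. y * x))"
proof -
  note B = independent_Basis span_Basis
  interpret c: Vector_Spaces.linear scale "(*)" "\<lambda>x. representation Basis x b" for b
    by (rule linear_representation[OF B])
  show ?thesis unfolding trace_def
    by (rule linear_functionalI)
      (simp_all add: distrib_right c.add sum.distrib scale_mult_left[symmetric] c.scale sum_distrib_left)
qed

end

text \<open>The radical of the trace form is a left ideal. An idempotent \<open>e \<noteq> 0\<close> in it would have \<open>tr (x \<mapsto> e x) = 0\<close>, while
  this trace is the rank of \<open>x \<mapsto> e x\<close>, nonzero in characteristic \<open>0\<close>. So the form is nondegenerate, and a
  dual basis is obtained by inverting the operator whose coordinates are the values of the form.\<close>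

lemma (in fd_algebra) trace_form_dual_basis:
  assumes nn: "\<And>N. left_ideal N \<Longrightarrow> nilpotent N \<Longrightarrow> N = {0}"
    and char: "\<And>n. n > 0 \<Longrightarrow> (of_nat n :: 'f) \<noteq> 0"
  shows "\<exists>d. \<forall>b\<in>Basis. \<forall>b'\<in>Basis. trace (\<lambda>x. b * d b' * x) = (if b = b' then 1 else 0)"
proof -
  note B = finite_Basis independent_Basis span_Basis
  interpret t: Vector_Spaces.linear scale "(*)" "\<lambda>y. trace (\<lambda>x. y * x)" by (rule linear_trace_mult)
  let ?Y = "{y. \<forall>b. trace (\<lambda>x. b * y * x) = 0}"
  have "left_ideal ?Y"
    unfolding left_ideal_def subspace_def
    by (auto simp: distrib_left t.add t.scale scale_mult_right[symmetric] mult.assoc[symmetric] t.zero)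
  moreover have "e = 0" if e: "e \<in> ?Y" "e * e = e" for e
  proof -
    have "trace (\<lambda>x. e * e * x) = 0" using e(1) by blast
    then have "of_nat (dim (range (\<lambda>x. e * x))) = (0::'f)"
      using e(2) trace_mult_idempotent[OF e(2)] by simp
    then have "dim (range (\<lambda>x. e * x)) = 0" using char by (metis gr0I)
    then have "e * e = 0" by (auto simp: dim_eq_0)
    then show "e = 0" using e by simp
  qed
  ultimately have Y: "?Y = {0}"
    using nn idempotent_if_not_nilpotent by blast
  define \<Psi> where "\<Psi> y = (\<Sum>b\<in>Basis. scale (trace (\<lambda>x. b * y * x)) b)" for y
  have lin: "Vector_Spaces.linear scale scale \<Psi>"
    unfolding \<Psi>_def
    by (rule linearI) (simp_all add: distrib_left t.add t.scale scale_mult_right[symmetric] sum.distrib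
        scale_left_distrib scale_sum_right)
  interpret \<Psi>: Vector_Spaces.linear scale scale \<Psi> by fact
  have "inj \<Psi>"
    unfolding \<Psi>.inj_iff_eq_0
  proof (intro allI impI)
    fix y assume "\<Psi> y = 0"
    then have 0: "trace (\<lambda>x. b * y * x) = 0" if "b \<in> Basis" for b
      using independentD[OF B(2,1) subset_refl, of "\<lambda>b. trace (\<lambda>x. b * y * x)" b] that
      unfolding \<Psi>_def by simp
    have "trace (\<lambda>x. a * y * x) = 0" for a
    proof -
      have "a * y = (\<Sum>b\<in>Basis. scale (representation Basis a b) b) * y"
        by (simp only: sum_coordinates[OF B])
      also have "\<dots> = (\<Sum>b\<in>Basis. scale (representation Basis a b) (b * y))"
        by (simp only: sum_distrib_right scale_mult_left)
      finally show ?thesis using 0 by (simp add: t.sum t.scale)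
    qed
    then show "y = 0" using Y by blast
  qed
  then have "surj \<Psi>" using linear_inj_imp_surj[OF lin] by blast
  then obtain d where d: "\<And>b. \<Psi> (d b) = b" by (metis surjD)
  have "trace (\<lambda>x. b * d b' * x) = (if b = b' then 1 else 0)" if b: "b \<in> Basis" "b' \<in> Basis" for b b'
  proof -
    interpret c: Vector_Spaces.linear scale "(*)" "\<lambda>x. representation Basis x b"
      by (rule linear_representation[OF B(2,3)])
    have "representation Basis (\<Psi> (d b')) b = (\<Sum>a\<in>Basis. trace (\<lambda>x. a * d b' * x) * representation Basis a b)"
      unfolding \<Psi>_def by (simp add: c.sum c.scale)
    also have "\<dots> = (\<Sum>a\<in>Basis. if a = b then trace (\<lambda>x. b * d b' * x) else 0)"
      using B by (intro sum.cong) (auto simp: representation_basis)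
    also have "\<dots> = trace (\<lambda>x. b * d b' * x)" using b B by simp
    finally show ?thesis using d[of b'] b B by (auto simp: representation_basis)
  qed
  then show ?thesis by blast
qed

section \<open>The antipode and annihilators\<close>

text \<open>Linear maps out of a tensor power are handled as linear maps on the free vector space that kill the
  multilinearity relations.\<close>

definition (in vector_space) linear_extension :: "('x \<Rightarrow> 'b) \<Rightarrow> ('x \<Rightarrow>\<^sub>0 'a) \<Rightarrow> 'b" where
  "linear_extension \<Phi> p = (\<Sum>k\<in>Poly_Mapping.keys p. scale (Poly_Mapping.lookup p k) (\<Phi> k))"

context vector_space
begin

lemma linear_extension_superset:
  assumes "finite K" "Poly_Mapping.keys p \<subseteq> K"
  shows "linear_extension \<Phi> p = (\<Sum>k\<in>K. scale (Poly_Mapping.lookup p k) (\<Phi> k))"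
  unfolding linear_extension_def using assms
  by (intro sum.mono_neutral_left) (auto simp: in_keys_iff)

lemma linear_extension_add:
  "linear_extension \<Phi> (p + q) = linear_extension \<Phi> p + linear_extension \<Phi> q"
proof -
  let ?K = "Poly_Mapping.keys p \<union> Poly_Mapping.keys q"
  have "Poly_Mapping.keys (p + q) \<subseteq> ?K" by (rule Poly_Mapping.keys_add)
  then show ?thesis
    by (simp add: linear_extension_superset[of ?K] lookup_add scale_left_distrib sum.distrib)
qed

lemma linear_extension_fscale:
  "linear_extension \<Phi> (fscale c p) = scale c (linear_extension \<Phi> p)"
proof -
  have "Poly_Mapping.keys (fscale c p) \<subseteq> Poly_Mapping.keys p" by (auto simp: in_keys_iff)
  then show ?thesis
    by (simp add: linear_extension_superset[of "Poly_Mapping.keys p"] scale_sum_right)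
qed

lemma linear_extension_single:
  "linear_extension \<Phi> (Poly_Mapping.single k c) = scale c (\<Phi> k)"
  by (subst linear_extension_superset[of "{k}"]) auto

lemma linear_extension_diff:
  "linear_extension \<Phi> (p - q) = linear_extension \<Phi> p - linear_extension \<Phi> q"
  using linear_extension_add[of \<Phi> "p - q" q] by (simp add: algebra_simps)

lemma linear_extension_formal_sum:
  "linear_extension \<Phi> (formal_sum ts) = (\<Sum>t\<leftarrow>ts. \<Phi> t)"
  unfolding formal_sum_def
  by (induct ts) (simp_all add: linear_extension_add linear_extension_single, simp add: linear_extension_def)

lemma subspace_linear_extension_kernel: "free_vs.subspace {p. linear_extension \<Phi> p = 0}"
  unfolding free_vs.subspace_def
  by (auto simp: linear_extension_add linear_extension_fscale) (simp add: linear_extension_def)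

end

lemma (in H_module_algebra) tensor3_eq_imp_sum_eq:
  assumes "tensor3_eq scaleH s t"
    and add: "\<And>x x' y z. \<phi> (x + x') y z = \<phi> x y z + \<phi> x' y z"
      "\<And>x y y' z. \<phi> x (y + y') z = \<phi> x y z + \<phi> x y' z"
      "\<And>x y z z'. \<phi> x y (z + z') = \<phi> x y z + \<phi> x y z'"
    and scale: "\<And>c x y z. \<phi> (scaleH c x) y z = scaleA c (\<phi> x y z)"
      "\<And>c x y z. \<phi> x (scaleH c y) z = scaleA c (\<phi> x y z)"
      "\<And>c x y z. \<phi> x y (scaleH c z) = scaleA c (\<phi> x y z)"
  shows "(\<Sum>(x, y, z)\<leftarrow>s. \<phi> x y z) = (\<Sum>(x, y, z)\<leftarrow>t. \<phi> x y z)"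
proof -
  let ?L = "A.linear_extension (\<lambda>(x, y, z). \<phi> x y z)"
  have "tensor3_relations scaleH \<subseteq> {p. ?L p = 0}"
    unfolding tensor3_relations_def Let_def
    by (rule free_vs.span_minimal[OF _ A.subspace_linear_extension_kernel])
      (auto simp: A.linear_extension_diff A.linear_extension_fscale A.linear_extension_single add scale)
  then have "?L (formal_sum s - formal_sum t) = 0"
    using assms(1) unfolding tensor3_eq_def by blast
  then show ?thesis by (simp add: A.linear_extension_diff A.linear_extension_formal_sum)
qed

context H_module_algebra
begin

lemma act_add_right: "act h (x + y) = act h x + act h y"
  using act_linear by (simp add: Vector_Spaces.linear_iff)

lemma act_scale_right: "act h (scaleA c x) = scaleA c (act h x)"
  using act_linear by (simp add: Vector_Spaces.linear_iff)

lemma act_add_left: "act (g + h) x = act g x + act h x"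
  using act_linear_left by (simp add: Vector_Spaces.linear_iff)

lemma act_scale_left: "act (scaleH c h) x = scaleA c (act h x)"
  using act_linear_left by (simp add: Vector_Spaces.linear_iff)

lemma act_zero_right: "act h 0 = 0"
  using act_scale_right[of h 0 0] by simp

lemma act_zero_left: "act 0 x = 0"
  using act_scale_left[of 0 0 x] by simp

lemma act_sum_list_left: "act (\<Sum>z\<leftarrow>zs. f z) x = (\<Sum>z\<leftarrow>zs. act (f z) x)"
  by (induct zs) (simp_all add: act_zero_left act_add_left)

lemma antipode_add: "antipode (g + h) = antipode g + antipode h"
  using H.antipode_linear by (simp add: Vector_Spaces.linear_iff)

lemma antipode_scale: "antipode (scaleH c h) = scaleH c (antipode h)"
  using H.antipode_linear by (simp add: Vector_Spaces.linear_iff)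

text \<open>The coproduct of \<open>h\<close> acts on \<open>x \<cdot> S(h\<^sub>(\<^sub>2\<^sub>)) a\<close>; coassociativity brings \<open>h\<^sub>(\<^sub>2\<^sub>) S(h\<^sub>(\<^sub>3\<^sub>))\<close> together, which collapses
  to the counit.\<close>

lemma act_mult_antipode:
  "act h x * a = (\<Sum>(u, v)\<leftarrow>comult h. act u (x * act (antipode v) a))"
proof -
  let ?\<phi> = "\<lambda>p q v. act p x * act (q * antipode v) a"
  have sum_concat: "(\<Sum>z\<leftarrow>concat (map f xs). g z) = (\<Sum>y\<leftarrow>xs. \<Sum>z\<leftarrow>f y. g z)"
    for f :: "'x \<Rightarrow> 'y list" and g :: "'y \<Rightarrow> 'a" and xs
    by (induct xs) simp_all
  have "(\<Sum>(u, v)\<leftarrow>comult h. act u (x * act (antipode v) a))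
      = (\<Sum>(u, v)\<leftarrow>comult h. \<Sum>(p, q)\<leftarrow>comult u. ?\<phi> p q v)"
    by (simp add: act_prod act_mult)
  also have "\<dots> = (\<Sum>(p, q, v)\<leftarrow>[(p, q, v). (u, v) \<leftarrow> comult h, (p, q) \<leftarrow> comult u]. ?\<phi> p q v)"
    by (simp add: sum_concat case_prod_unfold o_def)
  also have "\<dots> = (\<Sum>(p, q, v)\<leftarrow>[(p, q, v). (p, w) \<leftarrow> comult h, (q, v) \<leftarrow> comult w]. ?\<phi> p q v)"
    by (rule tensor3_eq_imp_sum_eq[OF H.coassoc])
      (simp_all add: act_add_left act_scale_left antipode_add antipode_scale distrib_left distrib_right
        H.scale_mult_left[symmetric] H.scale_mult_right[symmetric]
        A.scale_mult_left[symmetric] A.scale_mult_right[symmetric])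
  also have "\<dots> = (\<Sum>(p, w)\<leftarrow>comult h. \<Sum>(q, v)\<leftarrow>comult w. ?\<phi> p q v)"
    by (simp add: sum_concat case_prod_unfold o_def)
  also have "\<dots> = (\<Sum>(p, w)\<leftarrow>comult h. act p x * act (\<Sum>(q, v)\<leftarrow>comult w. q * antipode v) a)"
    by (simp add: act_sum_list_left sum_list_const_mult case_prod_unfold)
  also have "\<dots> = (\<Sum>(p, w)\<leftarrow>comult h. act (scaleH (counit w) p) x * a)"
    by (simp add: H.antipode_right[unfolded case_prod_unfold] act_scale_left act_one A.scale_mult_left[symmetric]
        A.scale_mult_right[symmetric] case_prod_unfold)
  also have "\<dots> = act (\<Sum>(p, w)\<leftarrow>comult h. scaleH (counit w) p) x * a"
    by (simp add: act_sum_list_left sum_list_mult_const case_prod_unfold)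
  finally show ?thesis by (simp add: H.counit_right)
qed

text \<open>In \<open>(h x) a = h\<^sub>(\<^sub>1\<^sub>) (x (S(h\<^sub>(\<^sub>2\<^sub>)) a))\<close> the element \<open>S(h\<^sub>(\<^sub>2\<^sub>)) a\<close> stays in the invariant set \<open>I\<close>.\<close>

lemma H_invariant_left_annihilator:
  assumes "H_invariant act I"
  shows "H_invariant act {x. \<forall>a\<in>I. x * a = 0}"
  unfolding H_invariant_def
proof (intro allI ballI CollectI)
  fix h x a assume x: "x \<in> {x. \<forall>a\<in>I. x * a = 0}" and a: "a \<in> I"
  have "x * act (antipode v) a = 0" for v
    using x a assms unfolding H_invariant_def by blast
  then show "act h x * a = 0" by (simp add: act_mult_antipode act_zero_right case_prod_unfold)
qed

end

section \<open>Multilinear \<open>H\<close>-polynomial functions\<close>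

lemma nonempty_prod_Cons: "xs \<noteq> [] \<Longrightarrow> nonempty_prod (x # xs) = x * nonempty_prod xs"
  by (cases xs) auto

lemma nonempty_prod_append:
  "xs \<noteq> [] \<Longrightarrow> ys \<noteq> [] \<Longrightarrow> nonempty_prod (xs @ ys) = nonempty_prod xs * nonempty_prod ys"
  by (induct xs rule: nonempty_prod.induct) (auto simp: nonempty_prod_Cons mult.assoc)

text \<open>A product over distinct indices is linear in each of its entries separately.\<close>

lemma (in assoc_algebra) nonempty_prod_slot_linear:
  assumes "distinct p" "i \<in> set p"
  shows "nonempty_prod (map (t(i := scale c x + y)) p)
    = scale c (nonempty_prod (map (t(i := x)) p)) + nonempty_prod (map (t(i := y)) p)"
  using assms
proof (induct p)
  case (Cons k p)
  show ?case
  proof (cases "p = []")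
    case True
    then show ?thesis using Cons by simp
  next
    case False
    show ?thesis
    proof (cases "k = i")
      case True
      have m: "map (t(i := z)) p = map t p" for z using Cons True by auto
      show ?thesis using True False
        by (simp only: list.map fun_upd_same nonempty_prod_Cons map_is_Nil_conv not_False_eq_True m
            distrib_right scale_mult_left)
    next
      case ki: False
      then have "nonempty_prod (map (t(i := scale c x + y)) p)
          = scale c (nonempty_prod (map (t(i := x)) p)) + nonempty_prod (map (t(i := y)) p)"
        by (intro Cons.hyps) (use Cons.prems in auto)
      then show ?thesis using False
        by (simp only: list.map fun_upd_other[OF ki] nonempty_prod_Cons map_is_Nil_conv
            not_False_eq_True distrib_left scale_mult_right)
    qed
  qed
qed simp

lemma nonempty_prod_zero: "0 \<in> set xs \<Longrightarrow> nonempty_prod xs = 0"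
  by (induct xs rule: nonempty_prod.induct) auto

context H_module_algebra
begin

text \<open>Functions given by multilinear \<open>H\<close>-polynomials in the variables with index in \<open>I\<close>. The elements \<open>h i\<close> are not
  restricted to a basis of \<open>H\<close>, so scalars need no rule of their own, and arbitrary index sets allow variables to
  be added and substituted without renumbering.\<close>

inductive H_fun :: "nat set \<Rightarrow> ((nat \<Rightarrow> 'a) \<Rightarrow> 'a) \<Rightarrow> bool" for I where
  mono: "distinct p \<Longrightarrow> p \<noteq> [] \<Longrightarrow> set p = I \<Longrightarrow>
    H_fun I (\<lambda>a. nonempty_prod (map (\<lambda>i. act (h i) (a i)) p))"
| zero: "finite I \<Longrightarrow> I \<noteq> {} \<Longrightarrow> H_fun I (\<lambda>a. 0)"
| add: "H_fun I f \<Longrightarrow> H_fun I g \<Longrightarrow> H_fun I (\<lambda>a. f a + g a)"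

lemma H_fun_nonempty: "H_fun I f \<Longrightarrow> finite I \<and> I \<noteq> {}"
  by (induct rule: H_fun.induct) auto

lemma H_fun_var: "H_fun {i} (\<lambda>a. act h (a i))"
  using H_fun.mono[of "[i]" "{i}" "\<lambda>_. h"] by simp

lemma H_fun_id: "H_fun {i} (\<lambda>a. a i)"
  using H_fun_var[of i 1] by (simp add: act_one)

lemma H_fun_mult:
  assumes "H_fun I f" "H_fun J g" "I \<inter> J = {}"
  shows "H_fun (I \<union> J) (\<lambda>a. f a * g a)"
  using assms(1,3)
proof (induct rule: H_fun.induct)
  case (mono p h)
  note p = this
  from assms(2) show ?case
  proof (induct rule: H_fun.induct)
    case (mono q k)
    define l where "l i = (if i \<in> set p then h i else k i)" for i
    have meq: "map (\<lambda>i. act (h i) (a i)) p = map (\<lambda>i. act (l i) (a i)) p"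
      "map (\<lambda>i. act (k i) (a i)) q = map (\<lambda>i. act (l i) (a i)) q" for a
      using p mono by (auto simp: l_def)
    have "(\<lambda>a. nonempty_prod (map (\<lambda>i. act (h i) (a i)) p) * nonempty_prod (map (\<lambda>i. act (k i) (a i)) q))
       = (\<lambda>a. nonempty_prod (map (\<lambda>i. act (l i) (a i)) (p @ q)))"
      unfolding meq using p mono by (simp add: nonempty_prod_append)
    moreover have "H_fun (I \<union> J) (\<lambda>a. nonempty_prod (map (\<lambda>i. act (l i) (a i)) (p @ q)))"
      using p mono by (intro H_fun.mono) auto
    ultimately show ?case by simp
  next
    case zero
    then show ?case using p H_fun.zero[of "I \<union> J"] by auto
  next
    case (add f g)
    then show ?case using H_fun.add[OF add(2,4)] by (simp add: distrib_left)
  qed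
next
  case zero
  then show ?case using H_fun.zero[of "I \<union> J"] H_fun_nonempty[OF assms(2)] by auto
next
  case (add f' g')
  then show ?case using H_fun.add[of "I \<union> J", OF add(2,4)] by (simp add: distrib_right)
qed

lemma H_fun_sum:
  assumes "finite I" "I \<noteq> {}" "\<And>x. x \<in> S \<Longrightarrow> H_fun I (f x)"
  shows "H_fun I (\<lambda>a. \<Sum>x\<in>S. f x a)"
  using assms(3)
  by (induct S rule: infinite_finite_induct) (simp_all add: H_fun.zero assms H_fun.add)

lemma H_fun_sum_list:
  assumes "finite I" "I \<noteq> {}" "\<And>x. x \<in> set xs \<Longrightarrow> H_fun I (f x)"
  shows "H_fun I (\<lambda>a. \<Sum>x\<leftarrow>xs. f x a)"
  using assms(3)
  by (induct xs) (simp_all add: H_fun.zero assms H_fun.add)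

text \<open>The coproduct distributes the action of \<open>g\<close> over the factors of a monomial.\<close>

lemma H_fun_act:
  assumes "H_fun I f"
  shows "H_fun I (\<lambda>a. act g (f a))"
  using assms
proof (induct rule: H_fun.induct)
  case (mono p h)
  have "H_fun (set p) (\<lambda>a. act g (nonempty_prod (map (\<lambda>i. act (h i) (a i)) p)))"
    if "distinct p" "p \<noteq> []" for p g
    using that
  proof (induct p arbitrary: g)
    case (Cons i p)
    show ?case
    proof (cases "p = []")
      case True
      then show ?thesis using H_fun_var[of i "g * h i"] by (simp add: act_mult)
    next
      case False
      let ?r = "\<lambda>a. nonempty_prod (map (\<lambda>i. act (h i) (a i)) p)"
      have "H_fun ({i} \<union> set p) (\<lambda>a. \<Sum>x\<leftarrow>comult g. act (fst x * h i) (a i) * act (snd x) (?r a))"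
        using Cons False by (intro H_fun_sum_list H_fun_mult H_fun_var) auto
      then show ?thesis using False by (simp add: nonempty_prod_Cons act_prod act_mult case_prod_unfold)
    qed
  qed simp
  then show ?case using mono by blast
next
  case zero
  then show ?case using H_fun.zero by (simp add: act_zero_right)
next
  case (add f f')
  then show ?case using H_fun.add by (simp add: act_add_right)
qed

lemma H_fun_scale:
  assumes "H_fun I f"
  shows "H_fun I (\<lambda>a. scaleA c (f a))"
  using H_fun_act[OF assms, of "scaleH c 1"] by (simp add: act_scale_left act_one)

text \<open>Substituting a function of fresh variables (or of the replaced variable itself) keeps multilinearity; it uses
  that \<open>h\<close> applied to such a function is again such a function.\<close>

lemma H_fun_subst:
  assumes "H_fun I f" "i \<in> I" "H_fun J g" "J \<inter> (I - {i}) = {}"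
  shows "H_fun (I - {i} \<union> J) (\<lambda>a. f (a(i := g a)))"
  using assms(1,2,4)
proof (induct rule: H_fun.induct)
  case (mono p h)
  have fin: "finite J" "J \<noteq> {}" using H_fun_nonempty[OF assms(3)] by auto
  have "H_fun (set p - {i} \<union> (if i \<in> set p then J else {}))
      (\<lambda>a. nonempty_prod (map (\<lambda>k. act (h k) ((a(i := g a)) k)) p))"
    if "distinct p" "p \<noteq> []" "J \<inter> (set p - {i}) = {}" for p
    using that
  proof (induct p)
    case (Cons k p)
    have k: "H_fun (if k = i then J else {k}) (\<lambda>a. act (h k) ((a(i := g a)) k))"
      using H_fun_act[OF assms(3)] H_fun_var by simp
    show ?case
    proof (cases "p = []")
      case True
      then show ?thesis using k by (cases "k = i") auto
    next
      case False
      have IH: "H_fun (set p - {i} \<union> (if i \<in> set p then J else {}))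
          (\<lambda>a. nonempty_prod (map (\<lambda>k. act (h k) ((a(i := g a)) k)) p))"
        by (rule Cons.hyps) (use Cons.prems False in auto)
      have "H_fun ((if k = i then J else {k}) \<union> (set p - {i} \<union> (if i \<in> set p then J else {})))
          (\<lambda>a. act (h k) ((a(i := g a)) k) * nonempty_prod (map (\<lambda>k. act (h k) ((a(i := g a)) k)) p))"
        by (rule H_fun_mult[OF k IH]) (use Cons in auto)
      moreover have "(if k = i then J else {k}) \<union> (set p - {i} \<union> (if i \<in> set p then J else {}))
          = set (k # p) - {i} \<union> (if i \<in> set (k # p) then J else {})"
        using Cons by auto
      ultimately show ?thesis using False by (simp only: list.map nonempty_prod_Cons map_is_Nil_conv not_False_eq_True)
    qed
  qed simp
  from this[of p] show ?case using mono by simp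
next
  case zero
  then show ?case using H_fun_nonempty[OF assms(3)] by (intro H_fun.zero) auto
next
  case (add f f')
  then show ?case by (intro H_fun.add) auto
qed

lemma H_fun_prod:
  assumes "p \<noteq> []" "distinct p" "\<And>i. i \<in> set p \<Longrightarrow> H_fun (S i) (g i)"
    "\<And>i j. i \<in> set p \<Longrightarrow> j \<in> set p \<Longrightarrow> i \<noteq> j \<Longrightarrow> S i \<inter> S j = {}"
  shows "H_fun (\<Union>i\<in>set p. S i) (\<lambda>a. nonempty_prod (map (\<lambda>i. g i a) p))"
  using assms
proof (induct p)
  case (Cons i p)
  show ?case
  proof (cases "p = []")
    case True
    then show ?thesis using Cons by simp
  next
    case False
    have "H_fun (S i \<union> (\<Union>i\<in>set p. S i)) (\<lambda>a. g i a * nonempty_prod (map (\<lambda>i. g i a) p))"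
      using Cons False by (intro H_fun_mult Cons) auto
    then show ?thesis using False by (simp add: nonempty_prod_Cons)
  qed
qed simp

lemma H_fun_rename:
  assumes "H_fun I f" "inj_on \<pi> I"
  shows "H_fun (\<pi> ` I) (\<lambda>a. f (\<lambda>i. a (\<pi> i)))"
  using assms
proof (induct rule: H_fun.induct)
  case (mono p h)
  define k where "k j = h (inv_into I \<pi> j)" for j
  have "map (\<lambda>i. act (h i) (a (\<pi> i))) p = map (\<lambda>j. act (k j) (a j)) (map \<pi> p)" for a
    using mono by (auto simp: k_def)
  moreover have "H_fun (\<pi> ` I) (\<lambda>a. nonempty_prod (map (\<lambda>j. act (k j) (a j)) (map \<pi> p)))"
    using mono by (intro H_fun.mono) (auto simp: distinct_map)
  ultimately show ?case by (simp only:)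
next
  case zero
  then show ?case by (intro H_fun.zero) auto
next
  case (add f f')
  then show ?case by (intro H_fun.add) auto
qed

lemma H_fun_local:
  assumes "H_fun I f" "\<And>i. i \<in> I \<Longrightarrow> a i = b i"
  shows "f a = f b"
  using assms
proof (induct rule: H_fun.induct)
  case (mono p h)
  then show ?case by (intro arg_cong[of _ _ nonempty_prod] map_cong) auto
qed auto

lemma H_fun_slot_linear:
  assumes "H_fun I f" "i \<in> I"
  shows "f (a(i := scaleA c x + y)) = scaleA c (f (a(i := x))) + f (a(i := y))"
  using assms
proof (induct rule: H_fun.induct)
  case (mono p h)
  have m: "map (\<lambda>k. act (h k) ((a(i := z)) k)) p = map ((\<lambda>k. act (h k) (a k))(i := act (h i) z)) p" for z
    by auto
  show ?case
    using A.nonempty_prod_slot_linear[of p i "\<lambda>k. act (h k) (a k)" c "act (h i) x" "act (h i) y"] mono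
    unfolding m by (simp only: act_add_right act_scale_right)
qed (simp_all add: A.scale_right_distrib algebra_simps)

lemma H_fun_slot_add:
  assumes "H_fun I f" "i \<in> I"
  shows "f (a(i := x + y)) = f (a(i := x)) + f (a(i := y))"
  using H_fun_slot_linear[OF assms, of a 1 x y] by simp

lemma H_fun_slot_zero:
  assumes "H_fun I f" "i \<in> I"
  shows "f (a(i := 0)) = 0"
  using H_fun_slot_add[OF assms, of a 0 0] by simp

lemma H_fun_slot_sum:
  assumes "H_fun I f" "i \<in> I"
  shows "f (a(i := \<Sum>s\<in>S. scaleA (c s) (x s))) = (\<Sum>s\<in>S. scaleA (c s) (f (a(i := x s))))"
  by (induct S rule: infinite_finite_induct)
    (simp_all add: H_fun_slot_zero[OF assms] H_fun_slot_linear[OF assms] del: fun_upd_apply)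

lemma H_fun_zero_if_zero_on_basis:
  assumes E: "finite E" "A.independent E" "A.span E = UNIV"
    and f: "H_fun I f" and 0: "\<And>t. t \<in> I \<rightarrow>\<^sub>E E \<Longrightarrow> f t = 0"
  shows "f a = 0"
proof -
  have "f a = 0" if "J \<subseteq> I" "\<forall>i\<in>I - J. a i \<in> E" for J a
  proof -
    have "finite J" using that H_fun_nonempty[OF f] finite_subset by blast
    then show ?thesis using that
    proof (induct J arbitrary: a)
      case empty
      have "f a = f (restrict a I)" by (rule H_fun_local[OF f]) simp
      then show ?case using empty 0[of "restrict a I"] by simp
    next
      case (insert j J)
      have z: "f (a(j := e)) = 0" if "e \<in> E" for e
        using insert that by (intro insert.hyps) auto
      have "f a = f (a(j := \<Sum>e\<in>E. scaleA (A.representation E (a j) e) e))"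
        by (simp add: A.sum_coordinates[OF E])
      also have "\<dots> = (\<Sum>e\<in>E. scaleA (A.representation E (a j) e) (f (a(j := e))))"
        using insert by (intro H_fun_slot_sum[OF f]) auto
      also have "\<dots> = 0" using z by simp
      finally show ?case .
    qed
  qed
  from this[of I a] show ?thesis by simp
qed

end

section \<open>Codimensions as dimensions of spaces of functions\<close>

lemma keys_sum_single: "f = (\<Sum>w\<in>Poly_Mapping.keys f. Poly_Mapping.single w (Poly_Mapping.lookup f w))"
proof (rule poly_mapping_eqI)
  fix w
  have "Poly_Mapping.lookup (\<Sum>w\<in>Poly_Mapping.keys f. Poly_Mapping.single w (Poly_Mapping.lookup f w)) w
      = (\<Sum>v\<in>Poly_Mapping.keys f. if v = w then Poly_Mapping.lookup f w else 0)"
    by (simp only: lookup_sum, rule sum.cong) (auto simp: lookup_single when_def)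
  also have "\<dots> = Poly_Mapping.lookup f w" by (simp add: in_keys_iff)
  finally show "Poly_Mapping.lookup f w
      = Poly_Mapping.lookup (\<Sum>w\<in>Poly_Mapping.keys f. Poly_Mapping.single w (Poly_Mapping.lookup f w)) w" ..
qed

lemma letters_plus: "letters (u + v) = letters u @ letters v"
  by (simp add: plus_word_def)

lemma H_polys_mult:
  assumes "f \<in> H_polys B" "g \<in> H_polys B"
  shows "f * g \<in> H_polys B"
  unfolding H_polys_def
proof (intro CollectI ballI)
  fix w assume "w \<in> Poly_Mapping.keys (f * g)"
  then obtain u v where "w = u + v" "u \<in> Poly_Mapping.keys f" "v \<in> Poly_Mapping.keys g"
    using keys_mult[of f g] by auto
  then show "letters w \<noteq> [] \<and> snd ` set (letters w) \<subseteq> B"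
    using assms unfolding H_polys_def by (auto simp: letters_plus)
qed

lemma subspace_H_polys: "free_vs.subspace (H_polys B)"
  unfolding free_vs.subspace_def
proof (intro conjI ballI allI)
  show "0 \<in> H_polys B" by (simp add: H_polys_def)
  show "x + y \<in> H_polys B" if "x \<in> H_polys B" "y \<in> H_polys B" for x y
    using that Poly_Mapping.keys_add[of x y] unfolding H_polys_def by blast
  show "fscale c x \<in> H_polys B" if "x \<in> H_polys B" for c x
  proof -
    have "Poly_Mapping.keys (fscale c x) \<subseteq> Poly_Mapping.keys x" by (auto simp: in_keys_iff)
    then show ?thesis using that unfolding H_polys_def by blast
  qed
qed

context H_module_algebra
begin

abbreviation "ev \<equiv> H_eval scaleA act"

abbreviation "codim \<equiv> H_codim scaleH scaleA act"

lemma H_eval_fscale: "ev a (fscale c f) = scaleA c (ev a f)"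
proof -
  have "Poly_Mapping.keys (fscale c f) \<subseteq> Poly_Mapping.keys f" by (auto simp: in_keys_iff)
  then show ?thesis
    by (simp add: H_eval_superset[of "Poly_Mapping.keys f"] A.scale_sum_right)
qed

lemma H_eval_mult:
  assumes "f \<in> H_polys B" "g \<in> H_polys B"
  shows "ev a (f * g) = ev a f * ev a g"
proof -
  let ?v = "ev a" and ?K = "Poly_Mapping.keys" and ?l = "Poly_Mapping.lookup"
  let ?s = "\<lambda>f w. Poly_Mapping.single w (?l f w)"
  have ev_mult: "?v (?s f u * ?s g v) = ?v (?s f u) * ?v (?s g v)" if "u \<in> ?K f" "v \<in> ?K g" for u v
  proof -
    have "letters u \<noteq> []" "letters v \<noteq> []" using assms that unfolding H_polys_def by auto
    then show ?thesis
      by (simp add: mult_single H_eval_single letters_plus nonempty_prod_append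
          A.scale_mult_left[symmetric] A.scale_mult_right[symmetric])
  qed
  have "f * g = (\<Sum>u\<in>?K f. ?s f u) * (\<Sum>v\<in>?K g. ?s g v)"
    using keys_sum_single[of f] keys_sum_single[of g] by simp
  then have "?v (f * g) = (\<Sum>u\<in>?K f. \<Sum>v\<in>?K g. ?v (?s f u * ?s g v))"
    by (simp only: sum_product H_eval_sum)
  also have "\<dots> = (\<Sum>u\<in>?K f. \<Sum>v\<in>?K g. ?v (?s f u) * ?v (?s g v))"
    using ev_mult by simp
  also have "\<dots> = ?v (\<Sum>u\<in>?K f. ?s f u) * ?v (\<Sum>v\<in>?K g. ?s g v)"
    by (simp only: sum_product H_eval_sum)
  also have "\<dots> = ?v f * ?v g"
    using keys_sum_single[of f] keys_sum_single[of g] by simp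
  finally show ?thesis .
qed

lemma H_var_in_H_polys: "H_var scaleH B i h \<in> H_polys B"
proof -
  have "Poly_Mapping.single (Word [(i, b)]) c \<in> H_polys B" if "b \<in> B" for b and c :: 'f
    using that by (cases "c = 0") (simp_all add: H_polys_def)
  then show ?thesis unfolding H_var_def
    by (intro free_vs.subspace_sum[OF subspace_H_polys]) (auto dest: H.representation_ne_zero)
qed

context
  fixes B :: "'h set"
  assumes B: "H.independent B" "H.span B = UNIV"
begin

lemma prod_H_var:
  assumes "ks \<noteq> []"
  shows "prod_list (map (\<lambda>k. H_var scaleH B (\<sigma> k) (h k)) ks) \<in> H_polys B"
    and "ev a (prod_list (map (\<lambda>k. H_var scaleH B (\<sigma> k) (h k)) ks))
      = nonempty_prod (map (\<lambda>k. act (h k) (a (\<sigma> k))) ks)"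
proof -
  let ?f = "\<lambda>ks. prod_list (map (\<lambda>k. H_var scaleH B (\<sigma> k) (h k)) ks)"
  have "?f ks \<in> H_polys B \<and> ev a (?f ks)
      = nonempty_prod (map (\<lambda>k. act (h k) (a (\<sigma> k))) ks)"
    using assms
  proof (induct ks)
    case (Cons k ks)
    show ?case
    proof (cases "ks = []")
      case True
      then show ?thesis by (simp add: H_var_in_H_polys H_eval_H_var[OF B])
    next
      case False
      then show ?thesis using Cons
        by (simp add: H_polys_mult H_var_in_H_polys H_eval_mult[of _ B] H_eval_H_var[OF B] nonempty_prod_Cons)
    qed
  qed simp
  then show "?f ks \<in> H_polys B" "ev a (?f ks)
      = nonempty_prod (map (\<lambda>k. act (h k) (a (\<sigma> k))) ks)" by auto
qed

lemma H_multilinear_subset_H_polys: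
  assumes "n \<ge> 1"
  shows "H_multilinear scaleH B n \<subseteq> H_polys B"
  unfolding H_multilinear_def
  by (rule free_vs.span_minimal[OF _ subspace_H_polys])
    (use assms in \<open>auto intro!: prod_H_var(1) simp del: upt_Suc\<close>)

lemma H_fun_H_eval:
  assumes "n \<ge> 1" "f \<in> H_multilinear scaleH B n"
  shows "H_fun {1..n} (\<lambda>a. ev a f)"
  using assms(2) unfolding H_multilinear_def
proof (induct rule: free_vs.span_induct)
  case base
  show ?case unfolding free_vs.subspace_def
  proof (intro conjI ballI allI CollectI)
    show "H_fun {1..n} (\<lambda>a. ev a 0)"
      using assms(1) H_fun.zero[of "{1..n}"] by (simp add: H_eval_def)
  qed (simp_all add: H_eval_add H_eval_fscale H_fun.add H_fun_scale)
next
  case (step f)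
  then obtain \<sigma> h where f: "f = prod_list (map (\<lambda>k. H_var scaleH B (\<sigma> k) (h k)) [1..<Suc n])"
    and \<sigma>: "\<sigma> permutes {1..n}" by blast
  have "H_fun {1..n} (\<lambda>a. nonempty_prod (map (\<lambda>i. act (h (inv \<sigma> i)) (a i)) (map \<sigma> [1..<Suc n])))"
  proof (rule H_fun.mono)
    show "distinct (map \<sigma> [1..<Suc n])"
      using inj_on_subset[OF permutes_inj[OF \<sigma>] subset_UNIV] by (simp add: distinct_map del: upt_Suc)
    show "map \<sigma> [1..<Suc n] \<noteq> []" using assms(1) by simp
    have "set (map \<sigma> [1..<Suc n]) = \<sigma> ` {1..n}" by (auto simp del: upt_Suc)
    then show "set (map \<sigma> [1..<Suc n]) = {1..n}" using permutes_image[OF \<sigma>] by simp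
  qed
  moreover have "ev a f
      = nonempty_prod (map (\<lambda>i. act (h (inv \<sigma> i)) (a i)) (map \<sigma> [1..<Suc n]))" for a
  proof -
    have "[1..<Suc n] \<noteq> []" using assms(1) by simp
    then show ?thesis unfolding f by (subst prod_H_var(2))
        (simp_all add: o_def permutes_inverses[OF \<sigma>] del: upt_Suc)
  qed
  ultimately show ?case by simp
qed

lemma H_eval_surj_H_fun:
  assumes "n \<ge> 1" "H_fun {1..n} f"
  shows "\<exists>p\<in>H_multilinear scaleH B n. \<forall>a. ev a p = f a"
  using assms(2)
proof (induct rule: H_fun.induct)
  case (mono p h)
  have len: "length p = n" using distinct_card[of p] mono by simp
  define \<sigma> where "\<sigma> k = (if k \<in> {1..n} then p ! (k - 1) else k)" for k
  have pm: "map \<sigma> [1..<Suc n] = p"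
    using len by (intro nth_equalityI) (auto simp: \<sigma>_def simp del: upt_Suc)
  have "\<sigma> permutes {1..n}"
  proof (rule bij_imp_permutes)
    have "bij_betw (\<lambda>k. p ! k) {..<n} {1..n}"
      using bij_betw_nth[of p "{..<n}" "{1..n}"] mono len by simp
    moreover have "bij_betw (\<lambda>k. k - 1) {1..n} {..<n}"
      by (rule bij_betw_byWitness[where f' = Suc]) auto
    ultimately have "bij_betw ((\<lambda>k. p ! k) \<circ> (\<lambda>k. k - 1)) {1..n} {1..n}"
      by (rule bij_betw_trans[rotated])
    then show "bij_betw \<sigma> {1..n} {1..n}"
      by (rule bij_betw_cong[THEN iffD1, rotated]) (simp add: \<sigma>_def)
    show "\<sigma> x = x" if "x \<notin> {1..n}" for x using that by (simp only: \<sigma>_def if_False)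
  qed
  then have "prod_list (map (\<lambda>k. H_var scaleH B (\<sigma> k) (h (\<sigma> k))) [1..<Suc n]) \<in> H_multilinear scaleH B n"
    unfolding H_multilinear_def
    by (intro free_vs.span_base CollectI exI[of _ \<sigma>] exI[of _ "\<lambda>k. h (\<sigma> k)"]) blast
  moreover have "ev a (prod_list (map (\<lambda>k. H_var scaleH B (\<sigma> k) (h (\<sigma> k))) [1..<Suc n]))
      = nonempty_prod (map (\<lambda>i. act (h i) (a i)) p)" for a
  proof -
    have "[1..<Suc n] \<noteq> []" using assms(1) by simp
    then have "ev a (prod_list (map (\<lambda>k. H_var scaleH B (\<sigma> k) (h (\<sigma> k))) [1..<Suc n]))
        = nonempty_prod (map (\<lambda>i. act (h i) (a i)) (map \<sigma> [1..<Suc n]))"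
      by (subst prod_H_var(2)) (simp_all add: o_def del: upt_Suc)
    then show ?thesis unfolding pm .
  qed
  ultimately show ?case by blast
next
  case zero
  have "0 \<in> H_multilinear scaleH B n" unfolding H_multilinear_def by (rule free_vs.span_zero)
  then show ?case by (intro bexI[of _ 0]) (simp_all add: H_eval_def)
next
  case (add f g)
  then obtain p q where "p \<in> H_multilinear scaleH B n" "\<forall>a. ev a p = f a"
    "q \<in> H_multilinear scaleH B n" "\<forall>a. ev a q = g a" by blast
  then show ?case
    by (intro bexI[of _ "p + q"]) (auto simp: H_eval_add H_multilinear_def intro: free_vs.span_add)
qed

lemma multilinear_identities:
  assumes "n \<ge> 1"
  shows "H_multilinear scaleH B n \<inter> H_identities scaleA act B
    = {f \<in> H_multilinear scaleH B n. \<forall>a. ev a f = 0}"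
  using H_multilinear_subset_H_polys[OF assms] unfolding H_identities_def by blast

text \<open>If all functions vanish on basis tuples outside \<open>X\<close>, then a function has \<open>card X * card E\<close> coordinates. This gives
  the upper bound, and it makes the quotient finite dimensional, without which the lower bound
  could fail for the default value of the dimension.\<close>

lemma H_codim_bounds:
  assumes n: "n \<ge> 1" and E: "finite E" "A.independent E" "A.span E = UNIV"
    and X: "finite X" "\<And>f t. H_fun {1..n} f \<Longrightarrow> t \<in> {1..n} \<rightarrow>\<^sub>E E \<Longrightarrow> t \<notin> X \<Longrightarrow> f t = 0"
  shows "codim B n \<le> card X * card E"
    and "finite G \<Longrightarrow> (\<And>g. g \<in> G \<Longrightarrow> H_fun {1..n} (F g)) \<Longrightarrow>
      (\<And>c. (\<And>a. (\<Sum>g\<in>G. scaleA (c g) (F g a)) = 0) \<Longrightarrow> \<forall>g\<in>G. c g = 0) \<Longrightarrow>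
      card G \<le> codim B n"
proof -
  let ?V = "H_multilinear scaleH B n"
  let ?W = "?V \<inter> H_identities scaleA act B"
  note W = multilinear_identities[OF n]
  have sV: "free_vs.subspace ?V" unfolding H_multilinear_def by (rule free_vs.subspace_span)
  have sW: "free_vs.subspace ?W"
    unfolding W using sV unfolding free_vs.subspace_def
    by (auto simp: H_eval_add H_eval_fscale) (simp add: H_eval_def)
  have bound: "card U \<le> card X * card E"
    if U: "finite U" "U \<subseteq> ?V" and ind: "\<forall>c. (\<Sum>u\<in>U. fscale (c u) u) \<in> ?W \<longrightarrow> (\<forall>u\<in>U. c u = 0)" for U
  proof (rule ccontr)
    assume "\<not> card U \<le> card X * card E"
    then have lt: "card (X \<times> E) < card U" by (simp add: card_cartesian_product)
    define m where "m u k = A.representation E (ev (fst k) u) (snd k)" for u k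
    have "finite (X \<times> E)" using X(1) E(1) by simp
    from more_unknowns_than_equations[OF this U(1) lt, of m]
    obtain c where c: "\<exists>u\<in>U. c u \<noteq> 0" and c0: "\<forall>k\<in>X \<times> E. (\<Sum>u\<in>U. c u * m u k) = 0"
      by blast
    let ?f = "\<Sum>u\<in>U. fscale (c u) u"
    have fV: "?f \<in> ?V" using U sV by (intro free_vs.subspace_sum free_vs.subspace_scale) auto
    have hf: "H_fun {1..n} (\<lambda>a. ev a ?f)" by (rule H_fun_H_eval[OF n fV])
    have "ev t ?f = 0" if t: "t \<in> {1..n} \<rightarrow>\<^sub>E E" for t
    proof (cases "t \<in> X")
      case True
      interpret c: Vector_Spaces.linear scaleA "(*)" "\<lambda>x. A.representation E x b" for b
        by (rule A.linear_representation[OF E(2,3)])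
      have "A.representation E (ev t ?f) e = 0" if e: "e \<in> E" for e
        using c0[rule_format, of "(t, e)"] True e by (simp add: m_def H_eval_sum H_eval_fscale c.sum c.scale)
      then have "(\<Sum>e\<in>E. scaleA (A.representation E (ev t ?f) e) e) = 0" by simp
      then show ?thesis by (simp only: A.sum_coordinates[OF E])
    qed (rule X(2)[OF hf t])
    then have "ev a ?f = 0" for a
      by (rule H_fun_zero_if_zero_on_basis[OF E hf])
    then have "?f \<in> ?W" unfolding W using fV by blast
    then show False using ind c by blast
  qed
  show "codim B n \<le> card X * card E"
    unfolding H_codim_def by (rule free_vs.quotient_dim_le(1)[OF sV sW Int_lower1 bound])
  show "card G \<le> codim B n"
    if G: "finite G" "\<And>g. g \<in> G \<Longrightarrow> H_fun {1..n} (F g)"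
      and ind: "\<And>c. (\<And>a. (\<Sum>g\<in>G. scaleA (c g) (F g a)) = 0) \<Longrightarrow> \<forall>g\<in>G. c g = 0"
  proof -
    have "\<forall>g\<in>G. \<exists>p. p \<in> ?V \<and> (\<forall>a. ev a p = F g a)"
      using H_eval_surj_H_fun[OF n G(2)] by blast
    then obtain v where v: "\<And>g. g \<in> G \<Longrightarrow> v g \<in> ?V" "\<And>g a. g \<in> G \<Longrightarrow> ev a (v g) = F g a"
      by (metis (no_types))
    have "\<forall>g\<in>G. c g = 0" if w: "(\<Sum>g\<in>G. fscale (c g) (v g)) \<in> ?W" for c
    proof (rule ind)
      fix a
      have "ev a (\<Sum>g\<in>G. fscale (c g) (v g)) = 0" using w unfolding W by blast
      then show "(\<Sum>g\<in>G. scaleA (c g) (F g a)) = 0"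
        using v(2) by (simp add: H_eval_sum H_eval_fscale)
    qed
    then show ?thesis unfolding H_codim_def
      using free_vs.quotient_dim_ge[OF sV sW Int_lower1 bound G(1), of v] v(1) by blast
  qed
qed

text \<open>The variables may be indexed by any set of size \<open>n\<close>, since renaming them turns one function space into the
  other.\<close>

lemma H_codim_ge:
  assumes n: "n \<ge> 1" and E: "finite E" "A.independent E" "A.span E = UNIV"
    and I: "card I = n" and G: "finite G" "\<And>g. g \<in> G \<Longrightarrow> H_fun I (F g)"
    and ind: "\<And>c. (\<And>a. (\<Sum>g\<in>G. scaleA (c g) (F g a)) = 0) \<Longrightarrow> \<forall>g\<in>G. c g = 0"
  shows "card G \<le> codim B n"
proof -
  have "finite I" using I n by (metis card.infinite not_one_le_zero)
  then obtain \<pi> where \<pi>: "bij_betw \<pi> I {1..n}"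
    using I by (metis card_atLeastAtMost diff_Suc_1 finite_atLeastAtMost finite_same_card_bij)
  have fin: "finite ({1..n} \<rightarrow>\<^sub>E E)" using E by (simp add: finite_PiE)
  show ?thesis
  proof (rule H_codim_bounds(2)[OF n E fin _ G(1), where F = "\<lambda>g a. F g (\<lambda>i. a (\<pi> i))"])
    show "f t = 0" if "H_fun {1..n} f" "t \<in> {1..n} \<rightarrow>\<^sub>E E" "t \<notin> {1..n} \<rightarrow>\<^sub>E E"
      for f :: "(nat \<Rightarrow> 'a) \<Rightarrow> 'a" and t
      using that by blast
    show "H_fun {1..n} (\<lambda>a. F g (\<lambda>i. a (\<pi> i)))" if "g \<in> G" for g
      using H_fun_rename[OF G(2)[OF that], of \<pi>] \<pi> by (simp add: bij_betw_def)
    show "\<forall>g\<in>G. c g = 0" if 0: "\<And>a. (\<Sum>g\<in>G. scaleA (c g) (F g (\<lambda>i. a (\<pi> i)))) = 0" for c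
    proof (rule ind)
      fix a
      have "F g a = F g (\<lambda>i. a (inv_into I \<pi> (\<pi> i)))" if "g \<in> G" for g
        using \<pi> by (intro H_fun_local[OF G(2)[OF that]]) (simp add: bij_betw_def)
      then show "(\<Sum>g\<in>G. scaleA (c g) (F g a)) = 0"
        using 0[of "\<lambda>j. a (inv_into I \<pi> j)"] by simp
    qed
  qed
qed

end

end

section \<open>Density\<close>

locale fd_H_module_algebra =
  H_module_algebra scaleH comult counit antipode scaleA act + A: fd_algebra scaleA E
  for scaleH :: "'f::{alg_closed_field, field_char_0} \<Rightarrow> 'h::ring_1 \<Rightarrow> 'h"
    and comult counit antipode
    and scaleA :: "'f \<Rightarrow> 'a::ring \<Rightarrow> 'a" and act and E

locale unital_H_simple_algebra =
  fd_H_module_algebra scaleH comult counit antipode scaleA act E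
  for scaleH :: "'f::{alg_closed_field, field_char_0} \<Rightarrow> 'h::ring_1 \<Rightarrow> 'h"
    and comult counit antipode
    and scaleA :: "'f \<Rightarrow> 'a::ring \<Rightarrow> 'a" and act and E +
  fixes u :: 'a
  assumes unit: "u * x = x" "x * u = x" and unit_nonzero: "u \<noteq> 0"
    and simple: "A.two_sided_ideal I \<Longrightarrow> H_invariant act I \<Longrightarrow> I = {0} \<or> I = UNIV"
begin

text \<open>The operators \<open>x \<mapsto> \<Sum> c (h x) b\<close>. They form the algebra generated by the multiplications of \<open>A\<close> and the action of
  \<open>H\<close>; the normal form matters because each summand uses a fixed number of algebra elements, which
  become variables of an \<open>H\<close>-polynomial.\<close>

inductive bimult :: "('a \<Rightarrow> 'a) \<Rightarrow> bool" where
  base: "bimult (\<lambda>x. c * act h x * b)"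
| zero: "bimult (\<lambda>x. 0)"
| add: "bimult f \<Longrightarrow> bimult g \<Longrightarrow> bimult (\<lambda>x. f x + g x)"

lemma bimult_id: "bimult (\<lambda>x. x)"
  using bimult.base[of u 1 u] by (simp add: act_one unit)

lemma bimult_mult_left: "bimult f \<Longrightarrow> bimult (\<lambda>x. a * f x)"
proof (induct rule: bimult.induct)
  case (base c h b)
  show ?case using bimult.base[of "a * c" h b] by (simp add: mult.assoc)
qed (simp_all add: bimult.zero bimult.add distrib_left)

lemma bimult_mult_right: "bimult f \<Longrightarrow> bimult (\<lambda>x. f x * a)"
proof (induct rule: bimult.induct)
  case (base c h b)
  show ?case using bimult.base[of c h "b * a"] by (simp add: mult.assoc)
qed (simp_all add: bimult.zero bimult.add distrib_right)

lemma bimult_scale: "bimult f \<Longrightarrow> bimult (\<lambda>x. scaleA c (f x))"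
  using bimult_mult_left[of f "scaleA c u"] by (simp add: A.scale_mult_left[symmetric] unit)

lemma bimult_sum_list: "(\<And>z. z \<in> set zs \<Longrightarrow> bimult (f z)) \<Longrightarrow> bimult (\<lambda>x. \<Sum>z\<leftarrow>zs. f z x)"
  by (induct zs) (simp_all add: bimult.zero bimult.add)

lemma bimult_sum: "(\<And>z. z \<in> Z \<Longrightarrow> bimult (f z)) \<Longrightarrow> bimult (\<lambda>x. \<Sum>z\<in>Z. f z x)"
  by (induct Z rule: infinite_finite_induct) (simp_all add: bimult.zero bimult.add)

lemma bimult_diff: "bimult f \<Longrightarrow> bimult g \<Longrightarrow> bimult (\<lambda>x. f x - g x)"
  using bimult.add[of f "\<lambda>x. scaleA (- 1) (g x)"] bimult_scale[of g "- 1"] by simp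

lemma bimult_act: "bimult f \<Longrightarrow> bimult (\<lambda>x. act g (f x))"
proof (induct rule: bimult.induct)
  case (base c h b)
  have "bimult (\<lambda>x. \<Sum>p\<leftarrow>comult g. (\<Sum>r\<leftarrow>comult (fst p). act (fst r) c * act (snd r * h) x * act (snd p) b))"
    by (intro bimult_sum_list bimult.base)
  then show ?case by (simp add: act_prod act_mult case_prod_unfold sum_list_mult_const)
qed (simp_all add: bimult.zero bimult.add act_zero_right act_add_right)

text \<open>Schur's lemma: an eigenspace is an \<open>H\<close>-invariant ideal.\<close>

lemma commuting_operator_is_scalar:
  assumes lin: "Vector_Spaces.linear scaleA scaleA \<phi>"
    and com: "\<And>a x. \<phi> (a * x) = a * \<phi> x" "\<And>a x. \<phi> (x * a) = \<phi> x * a" "\<And>h x. \<phi> (act h x) = act h (\<phi> x)"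
  shows "\<exists>c. \<forall>x. \<phi> x = scaleA c x"
proof -
  interpret \<phi>: Vector_Spaces.linear scaleA scaleA \<phi> by fact
  obtain c w where w: "w \<noteq> 0" "\<phi> w = scaleA c w"
    using eigenvector_exists[OF A.finite_dimensional_vector_space_axioms lin unit_nonzero] by blast
  let ?I = "{x. \<phi> x = scaleA c x}"
  have "A.two_sided_ideal ?I"
    unfolding A.two_sided_ideal_def A.subspace_def
  proof (intro conjI ballI allI)
    fix a x assume "x \<in> ?I"
    then have x: "\<phi> x = scaleA c x" by simp
    show "a * x \<in> ?I" using com(1)[of a x] x by (simp add: A.scale_mult_right)
    show "x * a \<in> ?I" using com(2)[of x a] x by (simp add: A.scale_mult_left)
  qed (auto simp: \<phi>.zero \<phi>.add \<phi>.scale A.scale_right_distrib mult.commute)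
  moreover have "H_invariant act ?I"
    unfolding H_invariant_def by (simp add: com act_scale_right)
  ultimately have "?I = UNIV" using simple[of ?I] w by blast
  then show ?thesis by blast
qed

definition op_values :: "'a set \<Rightarrow> 'a \<Rightarrow> 'a set" where
  "op_values Z y = {f y | f. bimult f \<and> (\<forall>z\<in>Z. f z = 0)}"

text \<open>The values at \<open>y\<close> of the operators that kill \<open>Z\<close> form an \<open>H\<close>-invariant ideal.\<close>

lemma op_values_trivial: "op_values Z y = {0} \<or> op_values Z y = UNIV"
proof (rule simple)
  show "A.two_sided_ideal (op_values Z y)"
    unfolding A.two_sided_ideal_def A.subspace_def
  proof (intro conjI ballI allI)
    show "0 \<in> op_values Z y" unfolding op_values_def using bimult.zero by force
    fix v w assume "v \<in> op_values Z y" "w \<in> op_values Z y"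
    then obtain f g where f: "v = f y" "bimult f" "\<forall>z\<in>Z. f z = 0"
      and g: "w = g y" "bimult g" "\<forall>z\<in>Z. g z = 0" unfolding op_values_def by blast
    show "v + w \<in> op_values Z y" unfolding op_values_def
      using f g bimult.add by (intro CollectI exI[of _ "\<lambda>x. f x + g x"]) auto
  next
    fix v assume "v \<in> op_values Z y"
    then obtain f where f: "v = f y" "bimult f" "\<forall>z\<in>Z. f z = 0" unfolding op_values_def by blast
    show "scaleA c v \<in> op_values Z y" for c unfolding op_values_def
      using f bimult_scale by (intro CollectI exI[of _ "\<lambda>x. scaleA c (f x)"]) auto
    show "a * v \<in> op_values Z y" for a unfolding op_values_def
      using f bimult_mult_left by (intro CollectI exI[of _ "\<lambda>x. a * f x"]) auto
    show "v * a \<in> op_values Z y" for a unfolding op_values_def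
      using f bimult_mult_right by (intro CollectI exI[of _ "\<lambda>x. f x * a"]) auto
  qed
  show "H_invariant act (op_values Z y)"
    unfolding H_invariant_def
  proof (intro allI ballI)
    fix h v assume "v \<in> op_values Z y"
    then obtain f where f: "v = f y" "bimult f" "\<forall>z\<in>Z. f z = 0" unfolding op_values_def by blast
    show "act h v \<in> op_values Z y" unfolding op_values_def
      using f bimult_act by (intro CollectI exI[of _ "\<lambda>x. act h (f x)"]) (auto simp: act_zero_right)
  qed
qed

text \<open>Jacobson's density theorem. Suppose that all operators killing \<open>Z = X - {y}\<close> also kill \<open>y\<close>. By induction, for
  \<open>z \<in> Z\<close> the operators \<open>f\<close> killing \<open>Z - {z}\<close> take all values at \<open>z\<close>, and \<open>f z \<mapsto> f y\<close> is a well-defined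
  operator on \<open>A\<close> that commutes with multiplications and with \<open>H\<close>, hence a scalar \<open>c z\<close>. Decomposing the identity
  operator accordingly gives \<open>y = \<Sum> c z \<cdot> z\<close>, contrary to independence.\<close>

lemma density:
  assumes "finite X" "A.independent X" "y \<in> X"
  shows "op_values (X - {y}) y = UNIV"
  using assms
proof (induct "card X" arbitrary: X y rule: less_induct)
  case less
  let ?Z = "X - {y}"
  have fZ: "finite ?Z" and iZ: "A.independent ?Z"
    using less.prems A.independent_mono[of X ?Z] by auto
  have IH: "op_values (?Z - {z}) z = UNIV" if "z \<in> ?Z" for z
    using less.hyps[OF _ fZ iZ that] less.prems card_Diff1_less[of X y] by blast
  show ?case
  proof (rule ccontr)
    assume "op_values ?Z y \<noteq> UNIV"
    then have "op_values ?Z y = {0}" using op_values_trivial by blast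
    then have kill: "f y = 0" if "bimult f" "\<And>z. z \<in> ?Z \<Longrightarrow> f z = 0" for f
      using that unfolding op_values_def by blast
    have "\<exists>c. \<forall>f. bimult f \<and> (\<forall>x\<in>?Z - {z}. f x = 0) \<longrightarrow> f y = scaleA c (f z)" if z: "z \<in> ?Z" for z
    proof -
      let ?K = "\<lambda>f. bimult f \<and> (\<forall>x\<in>?Z - {z}. f x = 0)"
      define g where "g a = (SOME f. ?K f \<and> f z = a)" for a
      have g: "?K (g a) \<and> g a z = a" for a
      proof -
        have "a \<in> op_values (?Z - {z}) z" using IH[OF z] by simp
        then have "\<exists>f. ?K f \<and> f z = a" unfolding op_values_def by blast
        then show ?thesis unfolding g_def by (rule someI_ex)
      qed
      define \<phi> where "\<phi> a = g a y" for a
      \<comment> \<open>operators killing \<open>Z - {z}\<close> that agree at \<open>z\<close> agree at \<open>y\<close>\<close>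
      have \<phi>: "\<phi> a = f y" if f: "?K f" "f z = a" for f a
      proof -
        have "g a y - f y = 0"
        proof (rule kill[of "\<lambda>x. g a x - f x"])
          show "bimult (\<lambda>x. g a x - f x)" using f g by (intro bimult_diff) auto
          show "g a x - f x = 0" if "x \<in> ?Z" for x using that f g[of a] by (cases "x = z") auto
        qed
        then show ?thesis by (simp add: \<phi>_def)
      qed
      have "\<exists>c. \<forall>a. \<phi> a = scaleA c a"
      proof (rule commuting_operator_is_scalar)
        show "Vector_Spaces.linear scaleA scaleA \<phi>"
        proof (rule A.linearI)
          show "\<phi> (a + b) = \<phi> a + \<phi> b" for a b
            unfolding \<phi>_def[of a] \<phi>_def[of b]
            by (rule \<phi>[of "\<lambda>x. g a x + g b x"]) (use g[of a] g[of b] in \<open>auto intro: bimult.add\<close>)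
          show "\<phi> (scaleA c a) = scaleA c (\<phi> a)" for c a
            unfolding \<phi>_def[of a]
            by (rule \<phi>[of "\<lambda>x. scaleA c (g a x)"]) (use g[of a] in \<open>auto intro: bimult_scale\<close>)
        qed
        show "\<phi> (b * a) = b * \<phi> a" for a b
          unfolding \<phi>_def[of a]
          by (rule \<phi>[of "\<lambda>x. b * g a x"]) (use g[of a] in \<open>auto intro: bimult_mult_left\<close>)
        show "\<phi> (a * b) = \<phi> a * b" for a b
          unfolding \<phi>_def[of a]
          by (rule \<phi>[of "\<lambda>x. g a x * b"]) (use g[of a] in \<open>auto intro: bimult_mult_right\<close>)
        show "\<phi> (act h a) = act h (\<phi> a)" for h a
          unfolding \<phi>_def[of a]
          by (rule \<phi>[of "\<lambda>x. act h (g a x)"])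
            (use g[of a] in \<open>auto intro: bimult_act simp: act_zero_right\<close>)
      qed
      then obtain c where c: "\<And>a. \<phi> a = scaleA c a" by blast
      then show ?thesis using \<phi> by (metis (no_types, lifting))
    qed
    then obtain c where c: "\<And>z f. z \<in> ?Z \<Longrightarrow> bimult f \<Longrightarrow> (\<forall>x\<in>?Z - {z}. f x = 0) \<Longrightarrow> f y = scaleA (c z) (f z)"
      by metis
    have "\<exists>f. bimult f \<and> (\<forall>x\<in>?Z - {z}. f x = 0) \<and> f z = z" if z: "z \<in> ?Z" for z
    proof -
      have "z \<in> op_values (?Z - {z}) z" using IH[OF z] by simp
      then show ?thesis unfolding op_values_def by auto
    qed
    then obtain f where f: "\<And>z. z \<in> ?Z \<Longrightarrow> bimult (f z)" "\<And>z x. z \<in> ?Z \<Longrightarrow> x \<in> ?Z - {z} \<Longrightarrow> f z x = 0"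
      "\<And>z. z \<in> ?Z \<Longrightarrow> f z z = z" by metis
    have "y - (\<Sum>z\<in>?Z. f z y) = 0"
    proof (rule kill[of "\<lambda>x. x - (\<Sum>z\<in>?Z. f z x)"])
      show "bimult (\<lambda>x. x - (\<Sum>z\<in>?Z. f z x))" using f by (intro bimult_diff bimult_id bimult_sum) auto
      fix x assume x: "x \<in> ?Z"
      have "(\<Sum>z\<in>?Z. f z x) = (\<Sum>z\<in>?Z. if z = x then x else 0)"
        using f x by (intro sum.cong) auto
      also have "\<dots> = x" using x fZ by simp
      finally show "x - (\<Sum>z\<in>?Z. f z x) = 0" by simp
    qed
    moreover have "f z y = scaleA (c z) z" if "z \<in> ?Z" for z
      using c[OF that f(1)[OF that]] f(2,3) that by simp
    ultimately have "y = (\<Sum>z\<in>?Z. scaleA (c z) z)" by simp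
    then have "y \<in> A.span ?Z" by (metis (no_types, lifting) A.span_base A.span_scale A.span_sum)
    then show False using less.prems unfolding A.dependent_def by blast
  qed
qed

section \<open>Alternating \<open>H\<close>-polynomials\<close>

abbreviation "dim_A \<equiv> card E"

text \<open>Expanded like a determinant: the \<open>i\<close>-th operator is applied to the permuted \<open>i\<close>-th vector.\<close>

definition alternator :: "(nat \<Rightarrow> 'a \<Rightarrow> 'a) \<Rightarrow> (nat \<Rightarrow> 'a) \<Rightarrow> 'a" where
  "alternator \<psi> x = (\<Sum>\<pi> | \<pi> permutes {..<dim_A}.
     scaleA (of_int (sign \<pi>)) (nonempty_prod (map (\<lambda>i. \<psi> i (x (\<pi> i))) [0..<dim_A])))"

lemma dim_A_pos: "dim_A > 0"
proof (rule ccontr)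
  assume "\<not> dim_A > 0"
  then have "E = {}" using A.finite_Basis by simp
  then have "u \<in> A.span {}" using A.span_Basis by simp
  then show False using unit_nonzero by simp
qed

lemma alternator_slot_add:
  assumes "j < dim_A"
  shows "alternator (\<psi>(j := \<lambda>x. f x + g x)) x = alternator (\<psi>(j := f)) x + alternator (\<psi>(j := g)) x"
proof -
  have "nonempty_prod (map (\<lambda>i. (\<psi>(j := \<lambda>x. f x + g x)) i (x (\<pi> i))) [0..<dim_A])
      = nonempty_prod (map (\<lambda>i. (\<psi>(j := f)) i (x (\<pi> i))) [0..<dim_A])
        + nonempty_prod (map (\<lambda>i. (\<psi>(j := g)) i (x (\<pi> i))) [0..<dim_A])" for \<pi>
  proof -
    have m: "map (\<lambda>i. (\<psi>(j := F)) i (x (\<pi> i))) [0..<dim_A]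
        = map ((\<lambda>i. \<psi> i (x (\<pi> i)))(j := F (x (\<pi> j)))) [0..<dim_A]" for F by auto
    show ?thesis
      using A.nonempty_prod_slot_linear[of "[0..<dim_A]" j "\<lambda>i. \<psi> i (x (\<pi> i))" 1 "f (x (\<pi> j))" "g (x (\<pi> j))"]
        assms unfolding m by (simp del: fun_upd_apply)
  qed
  then show ?thesis unfolding alternator_def by (simp only: A.scale_right_distrib sum.distrib)
qed

lemma alternator_slot_zero:
  assumes "j < dim_A"
  shows "alternator (\<psi>(j := \<lambda>x. 0)) x = 0"
  using alternator_slot_add[OF assms, of \<psi> "\<lambda>x. 0" "\<lambda>x. 0" x] by simp

text \<open>Multilinear expansion: if every choice of summands gave zero, so would the operators themselves.\<close>

lemma alternator_elementary:
  assumes "alternator \<psi> x \<noteq> 0" "\<And>i. i < dim_A \<Longrightarrow> bimult (\<psi> i)"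
  shows "\<exists>c h b. alternator (\<lambda>i x. c i * act (h i) x * b i) x \<noteq> 0"
proof -
  let ?el = "\<lambda>f. \<exists>c h b. f = (\<lambda>x. c * act h x * b)"
  have "\<exists>\<psi>. alternator \<psi> x \<noteq> 0 \<and> (\<forall>i<dim_A. bimult (\<psi> i)) \<and> (\<forall>i<j. ?el (\<psi> i))" if "j \<le> dim_A" for j
    using that
  proof (induct j)
    case 0
    then show ?case using assms by blast
  next
    case (Suc j)
    then obtain \<psi> where \<psi>: "alternator \<psi> x \<noteq> 0" "\<forall>i<dim_A. bimult (\<psi> i)" "\<forall>i<j. ?el (\<psi> i)"
      by auto
    have j: "j < dim_A" using Suc by simp
    have "\<exists>f'. ?el f' \<and> alternator (\<psi>(j := f')) x \<noteq> 0" if "bimult f" "alternator (\<psi>(j := f)) x \<noteq> 0" for f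
      using that
    proof (induct rule: bimult.induct)
      case (base c h b)
      then show ?case by blast
    next
      case zero
      then show ?case using alternator_slot_zero[OF j] by (simp del: fun_upd_apply)
    next
      case (add f g)
      then have "alternator (\<psi>(j := f)) x \<noteq> 0 \<or> alternator (\<psi>(j := g)) x \<noteq> 0"
        using alternator_slot_add[OF j, of \<psi> f g x] by (auto simp del: fun_upd_apply)
      then show ?case using add by blast
    qed
    from this[of "\<psi> j"] \<psi> j obtain f' where f': "?el f'" "alternator (\<psi>(j := f')) x \<noteq> 0" by auto
    have "bimult f'" using f'(1) bimult.base by auto
    then have "\<forall>i<dim_A. bimult ((\<psi>(j := f')) i)" using \<psi>(2) by simp
    moreover have "\<forall>i<Suc j. ?el ((\<psi>(j := f')) i)" using \<psi>(3) f'(1) by (simp add: less_Suc_eq)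
    ultimately show ?case using f'(2) by blast
  qed
  from this[of dim_A] obtain \<psi> where \<psi>: "alternator \<psi> x \<noteq> 0" "\<forall>i<dim_A. ?el (\<psi> i)" by auto
  then obtain c h b where el: "\<And>i. i < dim_A \<Longrightarrow> \<psi> i = (\<lambda>x. c i * act (h i) x * b i)" by metis
  have "map (\<lambda>i. \<psi> i (x (\<pi> i))) [0..<dim_A] = map (\<lambda>i. c i * act (h i) (x (\<pi> i)) * b i) [0..<dim_A]" for \<pi>
    using el by (intro map_cong) auto
  then have "alternator \<psi> x = alternator (\<lambda>i x. c i * act (h i) x * b i) x"
    unfolding alternator_def by (simp only:)
  then show ?thesis using \<psi>(1) by metis
qed

lemma alternator_swap:
  assumes ij: "i < dim_A" "j < dim_A" "i \<noteq> j"
  shows "alternator \<psi> (\<lambda>k. x (Transposition.transpose i j k)) = - alternator \<psi> x"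
proof -
  let ?\<tau> = "Transposition.transpose i j"
  let ?P = "{\<pi>. \<pi> permutes {..<dim_A}}"
  let ?t = "\<lambda>\<pi>. nonempty_prod (map (\<lambda>i. \<psi> i (x (\<pi> i))) [0..<dim_A])"
  have \<tau>: "?\<tau> permutes {..<dim_A}" using ij by (intro permutes_swap_id) auto
  have sg: "sign (?\<tau> \<circ> \<pi>) = - sign \<pi>" if "\<pi> \<in> ?P" for \<pi>
    using that ij by (subst sign_compose)
      (auto simp: sign_swap_id permutation_swap_id intro: permutation_permutes[THEN iffD2])
  have inv: "?\<tau> \<circ> (?\<tau> \<circ> \<pi>) = \<pi>" for \<pi> :: "nat \<Rightarrow> nat" by (simp add: fun_eq_iff)
  have "alternator \<psi> x = (\<Sum>\<pi>\<in>?P. scaleA (of_int (sign (?\<tau> \<circ> \<pi>))) (?t (?\<tau> \<circ> \<pi>)))"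
    unfolding alternator_def
    by (rule sum.reindex_bij_witness[of _ "\<lambda>\<pi>. ?\<tau> \<circ> \<pi>" "\<lambda>\<pi>. ?\<tau> \<circ> \<pi>"])
      (auto simp: inv intro: permutes_compose \<tau>)
  also have "\<dots> = - (\<Sum>\<pi>\<in>?P. scaleA (of_int (sign \<pi>)) (?t (?\<tau> \<circ> \<pi>)))"
    unfolding sum_negf[symmetric] using sg by (intro sum.cong) auto
  also have "(\<Sum>\<pi>\<in>?P. scaleA (of_int (sign \<pi>)) (?t (?\<tau> \<circ> \<pi>))) = alternator \<psi> (\<lambda>k. x (?\<tau> k))"
    unfolding alternator_def by simp
  finally show ?thesis by simp
qed

text \<open>By density, take \<open>\<psi>\<^sub>i\<close> with value \<open>u\<close> at \<open>e\<^sub>i\<close> and \<open>0\<close> at the other basis vectors. Only the identity permutation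
  contributes, with value \<open>u\<close>.\<close>

lemma alternator_nonzero:
  assumes e: "bij_betw e {..<dim_A} E"
  shows "\<exists>c h b. alternator (\<lambda>i x. c i * act (h i) x * b i) e \<noteq> 0"
proof -
  have "\<exists>f. bimult f \<and> (\<forall>j<dim_A. j \<noteq> i \<longrightarrow> f (e j) = 0) \<and> f (e i) = u" if i: "i < dim_A" for i
  proof -
    have ei: "e i \<in> E" using e i bij_betwE by fastforce
    have "u \<in> op_values (E - {e i}) (e i)"
      using density[OF A.finite_Basis A.independent_Basis ei] by simp
    then obtain f where f: "u = f (e i)" "bimult f" "\<forall>z\<in>E - {e i}. f z = 0" unfolding op_values_def by blast
    have "e j \<in> E - {e i}" if "j < dim_A" "j \<noteq> i" for j
      using e i that unfolding bij_betw_def by (auto dest: inj_onD)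
    then show ?thesis using f by auto
  qed
  then obtain \<psi> where \<psi>: "\<And>i. i < dim_A \<Longrightarrow> bimult (\<psi> i)"
    "\<And>i j. i < dim_A \<Longrightarrow> j < dim_A \<Longrightarrow> j \<noteq> i \<Longrightarrow> \<psi> i (e j) = 0" "\<And>i. i < dim_A \<Longrightarrow> \<psi> i (e i) = u"
    by metis
  have other: "nonempty_prod (map (\<lambda>i. \<psi> i (e (\<pi> i))) [0..<dim_A]) = 0"
    if \<pi>: "\<pi> permutes {..<dim_A}" "\<pi> \<noteq> id" for \<pi>
  proof -
    obtain i where i: "\<pi> i \<noteq> i" using \<pi>(2) by (metis eq_id_iff)
    then have "i < dim_A" "\<pi> i < dim_A"
      using \<pi>(1) permutes_in_image[OF \<pi>(1), of i] by (auto simp: permutes_def)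
    then have "0 \<in> set (map (\<lambda>i. \<psi> i (e (\<pi> i))) [0..<dim_A])" using \<psi>(2)[of i "\<pi> i"] i by force
    then show ?thesis by (rule nonempty_prod_zero)
  qed
  have "nonempty_prod (replicate (Suc n) u) = u" for n
    by (induct n) (simp_all add: unit)
  then have "nonempty_prod (replicate dim_A u) = u" using dim_A_pos gr0_implies_Suc by metis
  moreover have "map (\<lambda>i. \<psi> i (e i)) [0..<dim_A] = replicate dim_A u"
    using \<psi>(3) by (intro nth_equalityI) auto
  ultimately have one: "nonempty_prod (map (\<lambda>i. \<psi> i (e (id i))) [0..<dim_A]) = u" by simp
  have "alternator \<psi> e = (\<Sum>\<pi> | \<pi> permutes {..<dim_A}. if \<pi> = id then u else 0)"
    unfolding alternator_def using other one by (intro sum.cong) (auto simp: sign_id)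
  also have "\<dots> = u" by (simp add: finite_permutations permutes_id)
  finally have "alternator \<psi> e \<noteq> 0" using unit_nonzero by simp
  then show ?thesis using alternator_elementary \<psi>(1) by blast
qed

end

section \<open>Absorbing traces and the lower bound\<close>

context fd_H_module_algebra
begin

text \<open>Alternating in the variables with index below \<open>dim A\<close>; \<open>f\<close> may depend on further variables.\<close>

definition alternating :: "((nat \<Rightarrow> 'a) \<Rightarrow> 'a) \<Rightarrow> bool" where
  "alternating f \<longleftrightarrow> (\<forall>i<card E. \<forall>j<card E. \<forall>a. i \<noteq> j \<longrightarrow>
     f (\<lambda>k. a (Transposition.transpose i j k)) = - f a)"

lemma alternatingD:
  assumes "alternating f" "i < card E" "j < card E" "i \<noteq> j"
  shows "f (\<lambda>k. a (Transposition.transpose i j k)) = - f a"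
  using assms unfolding alternating_def by blast

lemma alternating_eq_zero:
  assumes "alternating f" "i < card E" "j < card E" "i \<noteq> j" "a i = a j"
  shows "f a = 0"
proof -
  have "(\<lambda>k. a (Transposition.transpose i j k)) = a"
    using assms(5) by (auto simp: fun_eq_iff Transposition.transpose_def)
  then have "f a = - f a" using assms unfolding alternating_def by metis
  then have "f a + f a = 0" by (simp add: eq_neg_iff_add_eq_0)
  then have "scaleA 2 (f a) = 0"
    by (metis A.scale_left_distrib A.scale_one one_add_one)
  then show ?thesis by simp
qed

text \<open>If \<open>a\<^sub>i\<close> is a combination of the other \<open>a\<^sub>j\<close>, then \<open>f a\<close> vanishes, and so must the sum: after expanding \<open>a\<^sub>i\<close>, the term
  with \<open>\<phi>\<close> at \<open>k \<noteq> i\<close> differs by a swap from the \<open>k\<close>-th part of the term with \<open>\<phi>\<close> at \<open>i\<close>.\<close>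

lemma alternating_trace_dependent:
  assumes f: "H_fun I f" "{..<card E} \<subseteq> I" "alternating f"
    and \<phi>: "Vector_Spaces.linear scaleA scaleA \<phi>"
    and i: "i < card E" and dep: "a i = (\<Sum>j\<in>{..<card E} - {i}. scaleA (c j) (a j))"
  shows "f a = 0" "(\<Sum>k<card E. f (a(k := \<phi> (a k)))) = 0"
proof -
  interpret \<phi>: Vector_Spaces.linear scaleA scaleA \<phi> by fact
  let ?d = "card E"
  let ?X = "{..<?d} - {i}"
  have sub: "f (b(i := \<Sum>j\<in>?X. scaleA (c j) (x j))) = (\<Sum>j\<in>?X. scaleA (c j) (f (b(i := x j))))" for b x
    using f(2) i by (intro H_fun_slot_sum[OF f(1)]) auto
  have "f a = f (a(i := \<Sum>j\<in>?X. scaleA (c j) (a j)))" using dep by (metis fun_upd_triv)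
  also have "\<dots> = (\<Sum>j\<in>?X. scaleA (c j) (f (a(i := a j))))" by (rule sub)
  also have "\<dots> = 0"
  proof (rule sum.neutral, intro ballI)
    fix j assume j: "j \<in> ?X"
    have "f (a(i := a j)) = 0"
      by (rule alternating_eq_zero[OF f(3) i, of j]) (use j in auto)
    then show "scaleA (c j) (f (a(i := a j))) = 0" by simp
  qed
  finally show "f a = 0" .
  have "f (a(k := \<phi> (a k))) = - scaleA (c k) (f (a(i := \<phi> (a k))))" if k: "k \<in> ?X" for k
  proof -
    let ?b = "a(k := \<phi> (a k))"
    have bi: "?b i = a i" using k by auto
    have "f ?b = f (?b(i := \<Sum>j\<in>?X. scaleA (c j) (a j)))" using dep bi by (metis fun_upd_triv)
    also have "\<dots> = (\<Sum>j\<in>?X. scaleA (c j) (f (?b(i := a j))))" by (rule sub)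
    also have "\<dots> = (\<Sum>j\<in>?X. if j = k then scaleA (c k) (f (?b(i := a k))) else 0)"
    proof (rule sum.cong[OF refl])
      fix j assume j: "j \<in> ?X"
      have "f (?b(i := a j)) = 0" if "j \<noteq> k"
        by (rule alternating_eq_zero[OF f(3) i, of j]) (use j that in auto)
      then show "scaleA (c j) (f (?b(i := a j))) = (if j = k then scaleA (c k) (f (?b(i := a k))) else 0)"
        by simp
    qed
    also have "\<dots> = scaleA (c k) (f (?b(i := a k)))" using k by simp
    also have "f (?b(i := a k)) = - f (a(i := \<phi> (a k)))"
    proof -
      have eq: "?b(i := a k) = (\<lambda>l. (a(i := \<phi> (a k))) (Transposition.transpose i k l))"
        using k by (auto simp: fun_eq_iff Transposition.transpose_def)
      show ?thesis unfolding eq using i k by (intro alternatingD[OF f(3)]) auto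
    qed
    finally show ?thesis by (simp del: fun_upd_apply)
  qed
  then have "(\<Sum>k\<in>?X. f (a(k := \<phi> (a k)))) = - (\<Sum>k\<in>?X. scaleA (c k) (f (a(i := \<phi> (a k)))))"
    by (simp add: sum_negf)
  also have "\<dots> = - f (a(i := \<Sum>k\<in>?X. scaleA (c k) (\<phi> (a k))))" by (simp only: sub)
  also have "(\<Sum>k\<in>?X. scaleA (c k) (\<phi> (a k))) = \<phi> (a i)"
    by (subst dep) (simp add: \<phi>.sum \<phi>.scale)
  finally show "(\<Sum>k<?d. f (a(k := \<phi> (a k)))) = 0"
    using i by (simp add: sum.remove[of "{..<?d}" i] del: fun_upd_apply)
qed

lemma family_dependent_or_basis:
  obtains (basis) "inj_on a {..<card E}" "A.independent (a ` {..<card E})" "A.span (a ` {..<card E}) = UNIV"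
  | (dependent) i c where "i < card E" "a i = (\<Sum>j\<in>{..<card E} - {i}. scaleA (c j) (a j))"
proof (cases "\<exists>c. (\<exists>i<card E. c i \<noteq> 0) \<and> (\<Sum>i<card E. scaleA (c i) (a i)) = 0")
  case True
  then obtain c i where i: "i < card E" "c i \<noteq> 0" and s: "(\<Sum>i<card E. scaleA (c i) (a i)) = 0" by blast
  let ?X = "{..<card E} - {i}"
  have "scaleA (c i) (a i) = - (\<Sum>j\<in>?X. scaleA (c j) (a j))"
    using s i by (simp add: sum.remove[of "{..<card E}" i] eq_neg_iff_add_eq_0)
  then have "scaleA (1 / c i) (scaleA (c i) (a i)) = scaleA (1 / c i) (- (\<Sum>j\<in>?X. scaleA (c j) (a j)))"
    by simp
  then have "a i = (\<Sum>j\<in>?X. scaleA (- c j / c i) (a j))"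
    using i(2) by (simp add: A.scale_sum_right sum_negf[symmetric] divide_inverse mult.commute)
  then show ?thesis using dependent[of i "\<lambda>j. - c j / c i"] i by blast
next
  case False
  then have nd: "\<And>c i. (\<Sum>i<card E. scaleA (c i) (a i)) = 0 \<Longrightarrow> i < card E \<Longrightarrow> c i = 0" by blast
  have inj: "inj_on a {..<card E}"
  proof (rule inj_onI, rule ccontr)
    fix i j assume ij: "i \<in> {..<card E}" "j \<in> {..<card E}" "a i = a j" "i \<noteq> j"
    let ?c = "(\<lambda>_. 0)(i := 1, j := - 1)"
    have "(\<Sum>k<card E. scaleA (?c k) (a k)) = (\<Sum>k\<in>{i, j}. scaleA (?c k) (a k))"
      using ij by (intro sum.mono_neutral_right) auto
    also have "\<dots> = 0" using ij by simp
    finally show False using nd[of ?c i] ij by simp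
  qed
  have ind: "A.independent (a ` {..<card E})"
  proof (rule A.independent_if_scalars_zero)
    fix g x assume g: "(\<Sum>x\<in>a ` {..<card E}. scaleA (g x) x) = 0" "x \<in> a ` {..<card E}"
    have "(\<Sum>i<card E. scaleA (g (a i)) (a i)) = 0"
      using g(1) by (simp add: sum.reindex[OF inj])
    then show "g x = 0" using nd[of "\<lambda>i. g (a i)"] g(2) by auto
  qed simp
  have "card (a ` {..<card E}) = A.dim UNIV" using inj by (simp add: card_image)
  then have "UNIV \<subseteq> A.span (a ` {..<card E})"
    using A.card_eq_dim[of "a ` {..<card E}" UNIV] ind by simp
  then show ?thesis using basis inj ind by blast
qed

text \<open>If the \<open>a\<^sub>k\<close> form a basis, then in the expansion of \<open>\<phi> a\<^sub>k\<close> only the multiple of \<open>a\<^sub>k\<close> itself survives, because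
  \<open>f\<close> vanishes on equal arguments; these coefficients add up to the trace.\<close>

lemma alternating_absorbs_trace:
  assumes f: "H_fun I f" "{..<card E} \<subseteq> I" "alternating f"
    and \<phi>: "Vector_Spaces.linear scaleA scaleA \<phi>"
  shows "(\<Sum>k<card E. f (a(k := \<phi> (a k)))) = scaleA (A.trace \<phi>) (f a)"
proof (cases rule: family_dependent_or_basis[of a])
  case (dependent i c)
  then show ?thesis using alternating_trace_dependent[OF f \<phi>, of i a c] by simp
next
  case basis
  let ?D = "{..<card E}"
  let ?r = "A.representation (a ` ?D)"
  have "f (a(k := \<phi> (a k))) = scaleA (?r (\<phi> (a k)) (a k)) (f a)" if k: "k \<in> ?D" for k
  proof -
    have "(\<Sum>j\<in>?D. scaleA (?r (\<phi> (a k)) (a j)) (a j)) = (\<Sum>b\<in>a ` ?D. scaleA (?r (\<phi> (a k)) b) b)"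
      by (simp add: sum.reindex[OF basis(1)])
    also have "\<dots> = \<phi> (a k)" using basis by (intro A.sum_coordinates) auto
    finally have "f (a(k := \<phi> (a k))) = f (a(k := \<Sum>j\<in>?D. scaleA (?r (\<phi> (a k)) (a j)) (a j)))" by simp
    also have "\<dots> = (\<Sum>j\<in>?D. scaleA (?r (\<phi> (a k)) (a j)) (f (a(k := a j))))"
      using f(2) k by (intro H_fun_slot_sum[OF f(1)]) auto
    also have "\<dots> = (\<Sum>j\<in>?D. if j = k then scaleA (?r (\<phi> (a k)) (a k)) (f a) else 0)"
    proof (rule sum.cong[OF refl])
      fix j assume j: "j \<in> ?D"
      have "f (a(k := a j)) = 0" if "j \<noteq> k"
        by (rule alternating_eq_zero[OF f(3), of k j]) (use j k that in auto)
      then show "scaleA (?r (\<phi> (a k)) (a j)) (f (a(k := a j)))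
          = (if j = k then scaleA (?r (\<phi> (a k)) (a k)) (f a) else 0)" by simp
    qed
    also have "\<dots> = scaleA (?r (\<phi> (a k)) (a k)) (f a)" using k by simp
    finally show ?thesis .
  qed
  then have "(\<Sum>k\<in>?D. f (a(k := \<phi> (a k)))) = scaleA (\<Sum>k\<in>?D. ?r (\<phi> (a k)) (a k)) (f a)"
    by (simp add: A.scale_sum_left del: fun_upd_apply)
  also have "(\<Sum>k\<in>?D. ?r (\<phi> (a k)) (a k)) = (\<Sum>b\<in>a ` ?D. ?r (\<phi> b) b)"
    by (simp add: sum.reindex[OF basis(1)])
  also have "\<dots> = A.trace \<phi>" using basis by (intro A.trace_eq_in_basis[OF \<phi>]) auto
  finally show ?thesis .
qed

definition trace_form :: "'a \<Rightarrow> 'a \<Rightarrow> 'f" where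
  "trace_form v w = A.trace (\<lambda>x. v * w * x)"

text \<open>Each factor is produced by substituting \<open>y y' x\<^sub>i\<close> for \<open>x\<^sub>i\<close> and summing over the alternating variables. The indices
  \<open>s + i\<close> and \<open>s + k + j\<close> are those of \<open>y\<^sub>i\<close> and \<open>y'\<^sub>j\<close>.\<close>

lemma H_fun_trace_products:
  assumes f: "H_fun {..<s} f" "card E \<le> s" "alternating f"
    and \<sigma>: "\<sigma> permutes {..<k}" and m: "m \<le> k"
  shows "H_fun ({..<s} \<union> (\<lambda>i. s + i) ` {..<m} \<union> (\<lambda>i. s + k + \<sigma> i) ` {..<m})
     (\<lambda>a. scaleA (\<Prod>i<m. trace_form (a (s + i)) (a (s + k + \<sigma> i))) (f a))"
  using m
proof (induct m)
  case 0
  then show ?case using f(1) by simp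
next
  case (Suc m)
  let ?I = "\<lambda>m. {..<s} \<union> (\<lambda>i. s + i) ` {..<m} \<union> (\<lambda>i. s + k + \<sigma> i) ` {..<m}"
  let ?F = "\<lambda>m a. scaleA (\<Prod>i<m. trace_form (a (s + i)) (a (s + k + \<sigma> i))) (f a)"
  let ?y = "s + m" and ?y' = "s + k + \<sigma> m"
  have mk: "m < k" using Suc by simp
  have \<sigma>i: "\<sigma> i = \<sigma> j \<longleftrightarrow> i = j" for i j using permutes_inj[OF \<sigma>] by (auto dest: injD)
  have IH: "H_fun (?I m) (?F m)" using Suc by simp
  have disj: "?y \<notin> ?I m" "?y' \<notin> ?I m" "?y \<noteq> ?y'" using mk \<sigma>i by auto
  have "H_fun (?I (Suc m)) (\<lambda>a. ?F m (a(i := a ?y * a ?y' * a i)))" if i: "i < card E" for i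
  proof -
    have "H_fun ({?y} \<union> {?y'} \<union> {i}) (\<lambda>a. a ?y * a ?y' * a i)"
      using disj i f(2) by (intro H_fun_mult H_fun_id) auto
    moreover have "({?y} \<union> {?y'} \<union> {i}) \<inter> (?I m - {i}) = {}" using disj by auto
    moreover have "i \<in> ?I m" using i f(2) by simp
    ultimately have "H_fun (?I m - {i} \<union> ({?y} \<union> {?y'} \<union> {i})) (\<lambda>a. ?F m (a(i := a ?y * a ?y' * a i)))"
      using H_fun_subst[OF IH, of i "{?y} \<union> {?y'} \<union> {i}" "\<lambda>a. a ?y * a ?y' * a i"] by blast
    moreover have "?I m - {i} \<union> ({?y} \<union> {?y'} \<union> {i}) = ?I (Suc m)"
      using i f(2) by (auto simp: lessThan_Suc)
    ultimately show ?thesis by simp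
  qed
  then have "H_fun (?I (Suc m)) (\<lambda>a. \<Sum>i<card E. ?F m (a(i := a ?y * a ?y' * a i)))"
    using H_fun_nonempty[OF IH] by (intro H_fun_sum) auto
  moreover have "(\<Sum>i<card E. ?F m (a(i := a ?y * a ?y' * a i))) = ?F (Suc m) a" for a
  proof -
    have e: "?F m (a(i := x)) = scaleA (\<Prod>i<m. trace_form (a (s + i)) (a (s + k + \<sigma> i))) (f (a(i := x)))"
      if "i < card E" for i x
    proof -
      have "(a(i := x)) (s + j) = a (s + j)" "(a(i := x)) (s + k + \<sigma> j) = a (s + k + \<sigma> j)" for j
        using that f(2) by auto
      then show ?thesis by (simp only:)
    qed
    have "(\<Sum>i<card E. ?F m (a(i := a ?y * a ?y' * a i)))
        = (\<Sum>i<card E. scaleA (\<Prod>i<m. trace_form (a (s + i)) (a (s + k + \<sigma> i))) (f (a(i := a ?y * a ?y' * a i))))"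
      by (rule sum.cong[OF refl]) (simp only: e lessThan_iff)
    also have "\<dots> = scaleA (\<Prod>i<m. trace_form (a (s + i)) (a (s + k + \<sigma> i))) (\<Sum>i<card E. f (a(i := a ?y * a ?y' * a i)))"
      by (simp only: A.scale_sum_right)
    also have "(\<Sum>i<card E. f (a(i := a ?y * a ?y' * a i))) = scaleA (trace_form (a ?y) (a ?y')) (f a)"
      unfolding trace_form_def
      by (rule alternating_absorbs_trace[OF f(1) _ f(3) A.linear_mult_left]) (use f(2) in auto)
    finally show ?thesis by (simp del: fun_upd_apply)
  qed
  ultimately show ?case by simp
qed

text \<open>Evaluating the \<open>y\<^sub>i\<close> at basis vectors and the \<open>y'\<^sub>j\<close> at dual basis vectors turns the trace products into the vectors
  of \<open>permutation_vectors_rank\<close>, times the nonzero value of \<open>f\<close>.\<close>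

lemma H_codim_lower_bound:
  assumes B: "H.independent B" "H.span B = UNIV"
    and nn: "\<And>N. A.left_ideal N \<Longrightarrow> A.nilpotent N \<Longrightarrow> N = {0}"
    and f: "H_fun {..<s} f" "card E \<le> s" "alternating f" "f a0 \<noteq> 0"
  shows "card E ^ (2 * k) \<le> codim B (s + 2 * k) * (k + 1) ^ (card E)\<^sup>2"
proof -
  obtain d where d: "\<And>b b'. b \<in> E \<Longrightarrow> b' \<in> E \<Longrightarrow> trace_form b (d b') = (if b = b' then 1 else 0)"
    using A.trace_form_dual_basis[OF nn] unfolding trace_form_def by auto
  obtain S0 where S0: "S0 \<subseteq> {\<sigma>. \<sigma> permutes {..<k}}"
    and r: "card E ^ (2 * k) \<le> card S0 * (k + 1) ^ (card E)\<^sup>2"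
    and ind: "\<And>c :: (nat \<Rightarrow> nat) \<Rightarrow> 'f. (\<forall>v\<in>{..<k} \<rightarrow>\<^sub>E E. \<forall>t\<in>{..<k} \<rightarrow>\<^sub>E E.
            (\<Sum>\<sigma>\<in>S0. c \<sigma> * (if \<forall>i<k. v i = t (\<sigma> i) then 1 else 0)) = 0) \<Longrightarrow> \<forall>\<sigma>\<in>S0. c \<sigma> = 0"
    using permutation_vectors_rank[OF A.finite_Basis, of k, where ?'f = 'f] by blast
  have "finite S0" using S0 finite_subset finite_permutations[of "{..<k}"] by auto
  let ?F = "\<lambda>\<sigma> a. scaleA (\<Prod>i<k. trace_form (a (s + i)) (a (s + k + \<sigma> i))) (f a)"
  have "s \<ge> 1" using H_fun_nonempty[OF f(1)] by auto
  have hf: "H_fun {..<s + 2 * k} (?F \<sigma>)" if "\<sigma> \<in> S0" for \<sigma>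
  proof -
    have \<sigma>: "\<sigma> permutes {..<k}" using that S0 by blast
    have "(\<lambda>i. s + k + \<sigma> i) ` {..<k} = (\<lambda>j. s + k + j) ` {..<k}"
      using permutes_image[OF \<sigma>] by (metis image_image)
    moreover have "{..<s} \<union> (\<lambda>i. s + i) ` {..<k} \<union> (\<lambda>j. s + k + j) ` {..<k} = {..<s + 2 * k}"
    proof (intro equalityI subsetI)
      fix j assume "j \<in> {..<s + 2 * k}"
      then consider "j < s" | "j = s + (j - s)" "j - s < k" | "j = s + k + (j - (s + k))" "j - (s + k) < k"
        by force
      then show "j \<in> {..<s} \<union> (\<lambda>i. s + i) ` {..<k} \<union> (\<lambda>j. s + k + j) ` {..<k}" by cases auto
    qed auto
    ultimately show ?thesis using H_fun_trace_products[OF f(1-3) \<sigma> order_refl] by simp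
  qed
  have "card S0 \<le> codim B (s + 2 * k)"
  proof (rule H_codim_ge[OF B _ A.finite_Basis A.independent_Basis A.span_Basis _ \<open>finite S0\<close> hf])
    show "s + 2 * k \<ge> 1" using \<open>s \<ge> 1\<close> by simp
    show "card {..<s + 2 * k} = s + 2 * k" by simp
    fix c assume z: "\<And>a. (\<Sum>\<sigma>\<in>S0. scaleA (c \<sigma>) (?F \<sigma> a)) = 0"
    show "\<forall>\<sigma>\<in>S0. c \<sigma> = 0"
    proof (rule ind, intro ballI)
      fix v t assume v: "v \<in> {..<k} \<rightarrow>\<^sub>E E" and t: "t \<in> {..<k} \<rightarrow>\<^sub>E E"
      let ?a = "\<lambda>j. if j < s then a0 j else if j < s + k then v (j - s) else d (t (j - (s + k)))"
      have fa: "f ?a = f a0" by (rule H_fun_local[OF f(1)]) simp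
      have pr: "(\<Prod>i<k. trace_form (?a (s + i)) (?a (s + k + \<sigma> i)))
          = (if \<forall>i<k. v i = t (\<sigma> i) then 1 else 0)" if "\<sigma> \<in> S0" for \<sigma>
      proof -
        have \<sigma>: "\<sigma> permutes {..<k}" using that S0 by blast
        have "trace_form (?a (s + i)) (?a (s + k + \<sigma> i)) = (if v i = t (\<sigma> i) then 1 else 0)" if "i < k" for i
        proof -
          have "v i \<in> E" "t (\<sigma> i) \<in> E"
            using v t permutes_in_image[OF \<sigma>, of i] that by (auto intro: PiE_mem)
          moreover have "?a (s + i) = v i" "?a (s + k + \<sigma> i) = d (t (\<sigma> i))" using that by simp_all
          ultimately show ?thesis using d by (simp only:)
        qed
        then have "(\<Prod>i<k. trace_form (?a (s + i)) (?a (s + k + \<sigma> i)))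
            = (\<Prod>i<k. if v i = t (\<sigma> i) then 1 else 0)" by (intro prod.cong) auto
        also have "\<dots> = (if \<forall>i<k. v i = t (\<sigma> i) then 1 else 0)" by (auto intro: prod_zero)
        finally show ?thesis .
      qed
      have "0 = (\<Sum>\<sigma>\<in>S0. scaleA (c \<sigma>) (?F \<sigma> ?a))" by (rule z[symmetric])
      also have "\<dots> = (\<Sum>\<sigma>\<in>S0. scaleA (c \<sigma> * (if \<forall>i<k. v i = t (\<sigma> i) then 1 else 0)) (f a0))"
        by (intro sum.cong refl) (simp only: pr fa A.scale_scale)
      also have "\<dots> = scaleA (\<Sum>\<sigma>\<in>S0. c \<sigma> * (if \<forall>i<k. v i = t (\<sigma> i) then 1 else 0)) (f a0)"
        by (simp only: A.scale_sum_left)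
      finally have "(\<Sum>\<sigma>\<in>S0. c \<sigma> * (if \<forall>i<k. v i = t (\<sigma> i) then 1 else 0)) = 0 \<or> f a0 = 0"
        by (simp only: A.scale_eq_0_iff eq_commute[of 0])
      with f(4) show "(\<Sum>\<sigma>\<in>S0. c \<sigma> * (if \<forall>i<k. v i = t (\<sigma> i) then 1 else 0)) = 0"
        by (simp only: simp_thms)
    qed
  qed
  then show ?thesis by (rule order_trans[OF r mult_le_mono1])
qed

end

context unital_H_simple_algebra
begin

text \<open>The coefficients of the elementary operators become the variables with indices \<open>dim A, \<dots>, 3 dim A - 1\<close>.\<close>

definition alternating_poly :: "(nat \<Rightarrow> 'h) \<Rightarrow> (nat \<Rightarrow> 'a) \<Rightarrow> 'a" where
  "alternating_poly h a = alternator (\<lambda>i x. a (dim_A + i) * act (h i) x * a (2 * dim_A + i)) a"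

lemma H_fun_alternating_poly: "H_fun {..<3 * dim_A} (alternating_poly h)"
proof -
  let ?d = dim_A
  have "0 \<in> {..<3 * ?d}" using dim_A_pos by simp
  then have ne: "{..<3 * ?d} \<noteq> {}" by blast
  have "H_fun {..<3 * ?d} (\<lambda>a. nonempty_prod
      (map (\<lambda>i. a (?d + i) * act (h i) (a (\<pi> i)) * a (2 * ?d + i)) [0..<?d]))"
    if \<pi>: "\<pi> permutes {..<?d}" for \<pi>
  proof -
    have \<pi>i: "\<pi> i = \<pi> j \<longleftrightarrow> i = j" for i j using permutes_inj[OF \<pi>] by (auto dest: injD)
    have \<pi>d: "\<pi> i < ?d \<longleftrightarrow> i < ?d" for i using permutes_in_image[OF \<pi>, of i] by simp
    let ?S = "\<lambda>i. {?d + i} \<union> {\<pi> i} \<union> {2 * ?d + i}"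
    have "H_fun (\<Union>i\<in>set [0..<?d]. ?S i) (\<lambda>a. nonempty_prod
      (map (\<lambda>i. a (?d + i) * act (h i) (a (\<pi> i)) * a (2 * ?d + i)) [0..<?d]))"
    proof (rule H_fun_prod)
      show "[0..<?d] \<noteq> []" "distinct [0..<?d]" using dim_A_pos by auto
      show "H_fun (?S i) (\<lambda>a. a (?d + i) * act (h i) (a (\<pi> i)) * a (2 * ?d + i))" if "i \<in> set [0..<?d]" for i
        using that \<pi>d[of i] by (intro H_fun_mult H_fun_id H_fun_var) auto
      show "?S i \<inter> ?S j = {}" if "i \<in> set [0..<?d]" "j \<in> set [0..<?d]" "i \<noteq> j" for i j
        using that \<pi>d[of i] \<pi>d[of j] \<pi>i[of i j] by auto
    qed
    moreover have "(\<Union>i\<in>set [0..<?d]. ?S i) = {..<3 * ?d}"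
    proof (intro equalityI subsetI)
      fix j assume "j \<in> {..<3 * ?d}"
      then consider "j < ?d" | "j = ?d + (j - ?d)" "j - ?d < ?d" | "j = 2 * ?d + (j - 2 * ?d)" "j - 2 * ?d < ?d"
        by force
      then show "j \<in> (\<Union>i\<in>set [0..<?d]. ?S i)"
      proof cases
        case 1
        then have "inv \<pi> j < ?d" "\<pi> (inv \<pi> j) = j"
          using permutes_in_image[OF permutes_inv[OF \<pi>], of j] permutes_inverses[OF \<pi>] by auto
        then show ?thesis by (intro UN_I[of "inv \<pi> j"]) auto
      next
        case 2
        then show ?thesis by (intro UN_I[of "j - ?d"]) auto
      next
        case 3
        then show ?thesis by (intro UN_I[of "j - 2 * ?d"]) auto
      qed
    next
      fix j assume "j \<in> (\<Union>i\<in>set [0..<?d]. ?S i)"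
      then obtain i where "i < ?d" "j \<in> ?S i" by auto
      then show "j \<in> {..<3 * ?d}" using \<pi>d[of i] by auto
    qed
    ultimately show ?thesis by simp
  qed
  then show ?thesis unfolding alternating_poly_def[abs_def] alternator_def
    using ne by (intro H_fun_sum H_fun_scale) auto
qed

lemma alternating_alternating_poly: "alternating (alternating_poly h)"
  unfolding alternating_def
proof (intro allI impI)
  fix i j a assume ij: "i < dim_A" "j < dim_A" "i \<noteq> j"
  have "Transposition.transpose i j (dim_A + k) = dim_A + k"
    "Transposition.transpose i j (2 * dim_A + k) = 2 * dim_A + k" for k
    using ij by (simp_all add: Transposition.transpose_def)
  then show "alternating_poly h (\<lambda>k. a (Transposition.transpose i j k)) = - alternating_poly h a"
    unfolding alternating_poly_def by (simp add: alternator_swap[OF ij])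
qed

lemma alternating_poly_nonzero: "\<exists>h a. alternating_poly h a \<noteq> 0"
proof -
  obtain e where e: "bij_betw e {..<dim_A} E"
    using ex_bij_betw_nat_finite[OF A.finite_Basis] by (auto simp: atLeast0LessThan)
  obtain c h b where nz: "alternator (\<lambda>i x. c i * act (h i) x * b i) e \<noteq> 0"
    using alternator_nonzero[OF e] by blast
  let ?a = "\<lambda>j. if j < dim_A then e j else if j < 2 * dim_A then c (j - dim_A) else b (j - 2 * dim_A)"
  have m: "map (\<lambda>i. ?a (dim_A + i) * act (h i) (?a (\<pi> i)) * ?a (2 * dim_A + i)) [0..<dim_A]
      = map (\<lambda>i. c i * act (h i) (e (\<pi> i)) * b i) [0..<dim_A]" if "\<pi> permutes {..<dim_A}" for \<pi>
    using permutes_in_image[OF that] by (intro map_cong) auto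
  have "alternating_poly h ?a = alternator (\<lambda>i x. c i * act (h i) x * b i) e"
    unfolding alternating_poly_def alternator_def
    by (rule sum.cong[OF refl]) (simp only: m mem_Collect_eq)
  then show ?thesis using nz by metis
qed

text \<open>The pairs \<open>y, y'\<close> contribute an even number of variables; for the other parity the alternating polynomial is
  multiplied by one more variable, evaluated at the unit.\<close>

lemma H_simple_codim_lower_bound:
  assumes B: "H.independent B" "H.span B = UNIV"
    and nn: "\<And>N. A.left_ideal N \<Longrightarrow> A.nilpotent N \<Longrightarrow> N = {0}"
    and n: "n \<ge> 3 * dim_A + 1"
  shows "dim_A ^ n \<le> codim B n * (n + 1) ^ dim_A\<^sup>2 * dim_A ^ (3 * dim_A + 1)"
proof -
  let ?d = dim_A
  obtain h a where nz: "alternating_poly h a \<noteq> 0" using alternating_poly_nonzero by blast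
  let ?f = "alternating_poly h"
  note f = H_fun_alternating_poly[of h] alternating_alternating_poly[of h]
  have "\<exists>s f a. n = s + 2 * ((n - 3 * ?d) div 2) \<and> s \<le> 3 * ?d + 1 \<and> H_fun {..<s} f \<and> ?d \<le> s \<and> alternating f \<and> f a \<noteq> 0"
  proof (cases "even (n - 3 * ?d)")
    case True
    then show ?thesis using n f nz by (intro exI[of _ "3 * ?d"] exI[of _ ?f] exI[of _ a]) auto
  next
    case False
    let ?g = "\<lambda>a. ?f a * a (3 * ?d)"
    have "H_fun {..<Suc (3 * ?d)} ?g"
      using H_fun_mult[OF f(1) H_fun_id, of "3 * ?d"] by (simp add: lessThan_Suc Un_commute)
    moreover have "alternating ?g"
      unfolding alternating_def
    proof (intro allI impI)
      fix i j b assume ij: "i < ?d" "j < ?d" "i \<noteq> j"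
      have "?f (\<lambda>k. b (Transposition.transpose i j k)) = - ?f b"
        using f(2) ij unfolding alternating_def by blast
      moreover have "Transposition.transpose i j (3 * ?d) = 3 * ?d"
        using ij by (simp add: Transposition.transpose_def)
      ultimately show "?f (\<lambda>k. b (Transposition.transpose i j k)) * b (Transposition.transpose i j (3 * ?d))
          = - (?f b * b (3 * ?d))" by simp
    qed
    moreover have "?g (a(3 * ?d := u)) \<noteq> 0"
    proof -
      have "?f (a(3 * ?d := u)) = ?f a" by (rule H_fun_local[OF f(1)]) simp
      then show ?thesis using nz by (simp add: unit)
    qed
    moreover have "n = Suc (3 * ?d) + 2 * ((n - 3 * ?d) div 2)" using n False by presburger
    ultimately show ?thesis
      by (intro exI[of _ "Suc (3 * ?d)"] exI[of _ ?g] exI[of _ "a(3 * ?d := u)"]) auto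
  qed
  then obtain s f a where s: "n = s + 2 * ((n - 3 * ?d) div 2)" "s \<le> 3 * ?d + 1"
    and f: "H_fun {..<s} f" "?d \<le> s" "alternating f" "f a \<noteq> 0" by blast
  let ?k = "(n - 3 * ?d) div 2"
  let ?c = "codim B n"
  have "?d ^ (2 * ?k) \<le> ?c * (?k + 1) ^ ?d\<^sup>2"
    using H_codim_lower_bound[OF B nn f, of ?k] s(1) by simp
  also have "\<dots> \<le> ?c * (n + 1) ^ ?d\<^sup>2" by (intro mult_le_mono2 power_mono) auto
  finally have k: "?d ^ (2 * ?k) \<le> ?c * (n + 1) ^ ?d\<^sup>2" .
  have "?d ^ n = ?d ^ (2 * ?k) * ?d ^ s" using s(1) by (metis add.commute power_add)
  also have "\<dots> \<le> (?c * (n + 1) ^ ?d\<^sup>2) * ?d ^ (3 * ?d + 1)"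
    using k s(2) dim_A_pos by (intro mult_le_mono power_increasing) auto
  finally show ?thesis .
qed

end

section \<open>Limits of roots\<close>

lemma root_limit_excluded:
  fixes c :: "nat \<Rightarrow> real"
  assumes "C > 0" "q > 0" "q < d" "\<And>n. n \<ge> 1 \<Longrightarrow> c n \<le> C * q ^ n"
  shows "\<not> (\<lambda>n. root n (c n)) \<longlonglongrightarrow> d"
proof
  assume lim: "(\<lambda>n. root n (c n)) \<longlonglongrightarrow> d"
  have "(\<lambda>n. root n C * q) \<longlonglongrightarrow> 1 * q"
    by (intro tendsto_intros LIMSEQ_root_const assms)
  moreover have "\<exists>N. \<forall>n\<ge>N. root n (c n) \<le> root n C * q"
  proof (intro exI[of _ 1] allI impI)
    fix n :: nat assume n: "n \<ge> 1"
    have "root n (c n) \<le> root n (C * q ^ n)" using n assms by (intro real_root_le_mono) auto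
    also have "\<dots> = root n C * q" using n assms by (simp add: real_root_mult real_root_power_cancel)
    finally show "root n (c n) \<le> root n C * q" .
  qed
  ultimately have "d \<le> 1 * q" by (intro LIMSEQ_le[OF lim])
  then show False using assms by simp
qed

lemma root_limit_sandwich:
  fixes c :: "nat \<Rightarrow> nat"
  assumes d: "d \<ge> 1" and up: "\<And>n. n \<ge> 1 \<Longrightarrow> c n \<le> d ^ n * d"
    and low: "\<And>n. n \<ge> N \<Longrightarrow> d ^ n \<le> c n * (n + 1) ^ m * K"
  shows "(\<lambda>n. root n (real (c n))) \<longlonglongrightarrow> real d"
proof (rule tendsto_sandwich)
  have "d ^ N > 0" using d by simp
  then have "K > 0" using low[of N] by (cases K) auto
  let ?K = "real K * 2 ^ m"
  have K: "?K > 0" using \<open>K > 0\<close> by simp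
  have "(\<lambda>n. real d / (root n ?K * root n n ^ m)) \<longlonglongrightarrow> real d / (1 * 1 ^ m)"
    by (intro tendsto_intros LIMSEQ_root_const LIMSEQ_root K) auto
  then show "(\<lambda>n. real d / (root n ?K * root n n ^ m)) \<longlonglongrightarrow> real d" by simp
  have "(\<lambda>n. root n (real d) * real d) \<longlonglongrightarrow> 1 * real d"
    by (intro tendsto_intros LIMSEQ_root_const) (use d in auto)
  then show "(\<lambda>n. root n (real d) * real d) \<longlonglongrightarrow> real d" by simp
  show "\<forall>\<^sub>F n in sequentially. root n (real (c n)) \<le> root n (real d) * real d"
    using eventually_ge_at_top[of 1]
  proof eventually_elim
    case (elim n)
    have "real (c n) \<le> real (d ^ n * d)" using up[OF elim] by (simp only: of_nat_le_iff)
    then have "root n (real (c n)) \<le> root n (real d ^ n * real d)" using elim by (intro real_root_le_mono) auto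
    also have "\<dots> = root n (real d) * real d" using elim by (simp add: real_root_mult real_root_power_cancel)
    finally show ?case .
  qed
  show "\<forall>\<^sub>F n in sequentially. real d / (root n ?K * root n n ^ m) \<le> root n (real (c n))"
    using eventually_ge_at_top[of "max 1 N"]
  proof eventually_elim
    case (elim n)
    then have n: "n \<ge> 1" "n \<ge> N" by auto
    have "d ^ n \<le> c n * (n + 1) ^ m * K" by (rule low[OF n(2)])
    also have "\<dots> \<le> c n * (2 * n) ^ m * K" using n by (intro mult_le_mono power_mono) auto
    finally have "real (d ^ n) \<le> real (c n * (2 * n) ^ m * K)" by (simp only: of_nat_le_iff)
    then have le: "real d ^ n \<le> real (c n) * (?K * real n ^ m)"
      by (simp add: power_mult_distrib mult_ac)
    have "?K * real n ^ m > 0" using K n by simp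
    then have "root n (real d ^ n / (?K * real n ^ m)) \<le> root n (real (c n))"
      using n le by (intro real_root_le_mono) (simp_all add: pos_divide_le_eq)
    moreover have "root n (real d ^ n / (?K * real n ^ m)) = real d / (root n ?K * root n n ^ m)"
      using n by (simp only: real_root_divide real_root_mult real_root_power_cancel real_root_power
          of_nat_0_le_iff)
    ultimately show ?case by simp
  qed
qed

section \<open>Upper bounds for codimensions\<close>

context fd_H_module_algebra
begin

lemma H_codim_le_power:
  assumes B: "H.independent B" "H.span B = UNIV" and n: "n \<ge> 1"
  shows "codim B n \<le> card E ^ n * card E"
proof -
  have "finite ({1..n} \<rightarrow>\<^sub>E E)" by (simp add: finite_PiE A.finite_Basis)
  then have "codim B n \<le> card ({1..n} \<rightarrow>\<^sub>E E) * card E"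
    by (intro H_codim_bounds(1)[OF B n A.finite_Basis A.independent_Basis A.span_Basis]) auto
  then show ?thesis by (simp add: card_PiE A.finite_Basis)
qed

lemma two_sided_idealD:
  assumes "A.two_sided_ideal I"
  shows "A.subspace I" "x \<in> I \<Longrightarrow> a * x \<in> I" "x \<in> I \<Longrightarrow> x * a \<in> I"
  using assms unfolding A.two_sided_ideal_def by auto

lemma nonempty_prod_in_ideal:
  assumes I: "A.two_sided_ideal I" and "\<exists>x\<in>set xs. x \<in> I"
  shows "nonempty_prod xs \<in> I"
  using assms(2)
proof (induct xs)
  case (Cons x xs)
  show ?case
  proof (cases "xs = []")
    case False
    then show ?thesis using Cons two_sided_idealD[OF I] by (auto simp: nonempty_prod_Cons)
  qed (use Cons in simp)
qed simp

text \<open>The number of basis tuples with fewer than \<open>p\<close> entries in \<open>J\<close> is estimated by weights: give each basis vector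
  in \<open>J\<close> the weight \<open>1/2\<close> and the others \<open>1\<close>. Then these tuples have weight at least \<open>2\<close> to the power \<open>- p\<close>, and
  all tuples together have weight \<open>(d - dim J / 2)\<^sup>n\<close>. The base \<open>d - 1/2\<close> is positive even for \<open>d = 1\<close>.\<close>

lemma H_codim_bound_radical:
  assumes B: "H.independent B" "H.span B = UNIV"
    and J: "H_invariant act A.jacobson_radical" "A.jacobson_radical \<noteq> {0}"
  shows "\<exists>C>0. \<forall>n\<ge>1. real (codim B n) \<le> C * (real (card E) - 1 / 2) ^ n"
proof -
  let ?J = "A.jacobson_radical"
  obtain p where p: "\<And>xs. p \<le> length (filter (\<lambda>x. x \<in> ?J) xs) \<Longrightarrow> nonempty_prod xs = 0"
    using A.product_with_radical_entries_vanishes by blast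
  obtain C where C: "C \<subseteq> ?J" "A.independent C" "?J \<subseteq> A.span C"
    using A.basis_exists by metis
  obtain D where D: "C \<subseteq> D" "A.independent D" "A.span D = UNIV"
    using A.maximal_independent_subset_extend[OF subset_UNIV C(2)] by (metis top.extremum_uniqueI)
  have fin: "finite D" "finite C" using D C A.finiteI_independent by blast+
  have cD: "card D = card E" using A.dim_eq_card_independent[OF D(2)] D(3) A.dim_UNIV A.dim_span by metis
  have "C \<noteq> {}"
  proof
    assume "C = {}"
    then have "?J \<subseteq> {0}" using C by simp
    then show False using J(2) A.left_idealD(1)[OF A.left_ideal_jacobson_radical] A.subspace_0 by blast
  qed
  then have cC: "card C \<ge> 1" using fin by (simp add: Suc_leI card_gt_0_iff)
  define w :: "'a \<Rightarrow> real" where "w b = (if b \<in> C then 1 / 2 else 1)" for b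
  have sw: "(\<Sum>b\<in>D. w b) \<le> real (card E) - 1 / 2"
  proof -
    have "(\<Sum>b\<in>D. w b) = (\<Sum>b\<in>D. 1 - (if b \<in> C then 1 / 2 else 0))"
      by (intro sum.cong) (auto simp: w_def)
    also have "\<dots> = real (card D) - (\<Sum>b\<in>D. if b \<in> C then 1 / 2 else 0)" by (simp add: sum_subtractf)
    also have "(\<Sum>b\<in>D. if b \<in> C then 1 / 2 else 0) = real (card C) / 2"
      using fin D(1) by (simp add: sum.If_cases Int_absorb1)
    finally show ?thesis using cC cD by simp
  qed
  have bound: "real (codim B n) \<le> (2 ^ p * real (card E)) * (real (card E) - 1 / 2) ^ n"
    if n: "n \<ge> 1" for n
  proof -
    define X where "X = {t \<in> {1..n} \<rightarrow>\<^sub>E D. card {i \<in> {1..n}. t i \<in> C} < p}"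
    have finP: "finite ({1..n} \<rightarrow>\<^sub>E D)" using fin by (simp add: finite_PiE)
    have "f t = 0" if f: "H_fun {1..n} f" and t: "t \<in> {1..n} \<rightarrow>\<^sub>E D" "t \<notin> X" for f t
      using f
    proof (induct rule: H_fun.induct)
      case (mono q h)
      have "p \<le> card {i \<in> {1..n}. t i \<in> C}" using t by (auto simp: X_def)
      also have "\<dots> = card (set (filter (\<lambda>i. t i \<in> C) q))" using mono by (simp add: Collect_conj_eq)
      also have "\<dots> \<le> card (set (filter (\<lambda>i. act (h i) (t i) \<in> ?J) q))"
        using C(1) J(1) unfolding H_invariant_def by (intro card_mono) auto
      also have "\<dots> = length (filter (\<lambda>x. x \<in> ?J) (map (\<lambda>i. act (h i) (t i)) q))"
        using mono by (subst distinct_card) (simp_all add: filter_map o_def)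
      finally show ?case by (rule p)
    qed auto
    then have "codim B n \<le> card X * card D"
      using finP by (intro H_codim_bounds(1)[OF B n fin(1) D(2,3)]) (auto simp: X_def)
    then have le: "real (codim B n) \<le> real (card X) * real (card E)"
      unfolding cD by (metis of_nat_le_iff of_nat_mult)
    have wpos: "(\<Prod>i\<in>{1..n}. w (t i)) \<ge> 0" for t by (intro prod_nonneg) (auto simp: w_def)
    have wt: "1 \<le> 2 ^ p * (\<Prod>i\<in>{1..n}. w (t i))" if "t \<in> X" for t
    proof -
      let ?k = "card {i \<in> {1..n}. t i \<in> C}"
      have "(\<Prod>i\<in>{1..n}. w (t i)) = (1 / 2) ^ ?k"
        unfolding w_def by (simp add: prod.If_cases Int_def)
      moreover have "(1 / 2) ^ ?k \<ge> (1 / 2 :: real) ^ p"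
        using that by (intro power_decreasing) (auto simp: X_def)
      ultimately have "2 ^ p * (\<Prod>i\<in>{1..n}. w (t i)) \<ge> 2 ^ p * (1 / 2 :: real) ^ p"
        by (intro mult_left_mono) auto
      then show ?thesis by (simp add: power_mult_distrib[symmetric])
    qed
    have "real (card X) = (\<Sum>t\<in>X. 1)" by simp
    also have "\<dots> \<le> (\<Sum>t\<in>X. 2 ^ p * (\<Prod>i\<in>{1..n}. w (t i)))" by (intro sum_mono wt)
    also have "\<dots> \<le> (\<Sum>t\<in>{1..n} \<rightarrow>\<^sub>E D. 2 ^ p * (\<Prod>i\<in>{1..n}. w (t i)))"
      using finP wpos by (intro sum_mono2) (auto simp: X_def)
    also have "\<dots> = 2 ^ p * (\<Prod>i\<in>{1..n}. \<Sum>b\<in>D. w b)"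
      using fin by (subst prod_sum_PiE) (auto simp: sum_distrib_left)
    also have "\<dots> = 2 ^ p * (\<Sum>b\<in>D. w b) ^ n" by simp
    also have "\<dots> \<le> 2 ^ p * (real (card E) - 1 / 2) ^ n"
      using sw by (intro mult_left_mono power_mono sum_nonneg) (auto simp: w_def)
    finally have "real (card X) \<le> 2 ^ p * (real (card E) - 1 / 2) ^ n" .
    then have "real (card X) * real (card E) \<le> 2 ^ p * (real (card E) - 1 / 2) ^ n * real (card E)"
      by (intro mult_right_mono) auto
    then show ?thesis using le by (simp add: mult_ac)
  qed
  have "card E > 0" using cC cD fin D(1) card_mono[of D C] by linarith
  then show ?thesis using bound by (intro exI[of _ "2 ^ p * real (card E)"]) simp
qed

text \<open>A product with one factor in \<open>I\<close> and another in \<open>K\<close> lies in \<open>I \<inter> K = 0\<close>, so only tuples from a single summand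
  count, and both summands have dimension at most \<open>d - 1\<close>.\<close>

lemma H_codim_bound_direct_sum:
  assumes B: "H.independent B" "H.span B = UNIV"
    and I: "A.two_sided_ideal I" "H_invariant act I" "I \<noteq> UNIV"
    and K: "A.two_sided_ideal K" "H_invariant act K" "K \<noteq> UNIV"
    and IK: "I \<inter> K = {0}" "\<And>x. \<exists>y\<in>I. \<exists>z\<in>K. x = y + z"
  shows "\<exists>C>0. \<forall>n\<ge>1. real (codim B n) \<le> C * (real (card E) - 1 / 2) ^ n"
proof -
  note sI = two_sided_idealD(1)[OF I(1)] and sK = two_sided_idealD(1)[OF K(1)]
  obtain C where C: "C \<subseteq> I" "A.independent C" "I \<subseteq> A.span C" "card C = A.dim I"
    using A.basis_exists by metis
  obtain D where D: "D \<subseteq> K" "A.independent D" "K \<subseteq> A.span D" "card D = A.dim K"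
    using A.basis_exists by metis
  have fin: "finite C" "finite D"
    using A.finiteI_independent[OF C(2)] A.finiteI_independent[OF D(2)] by simp_all
  have C0: "0 \<notin> C" using C(2) A.dependent_zero by metis
  have IK0: "x = 0" if "x \<in> I" "x \<in> K" for x
  proof -
    have "x \<in> I \<inter> K" using that by simp
    then show ?thesis unfolding IK(1) by simp
  qed
  have CD: "C \<inter> D = {}"
  proof (rule equals0I)
    fix x assume "x \<in> C \<inter> D"
    then have "x \<in> C" "x \<in> I" "x \<in> K" using C(1) D(1) by auto
    then show False using IK0 C0 by metis
  qed
  have ind: "A.independent (C \<union> D)"
  proof (rule A.independent_if_scalars_zero)
    fix g x assume g: "(\<Sum>x\<in>C \<union> D. scaleA (g x) x) = 0" and x: "x \<in> C \<union> D"
    let ?c = "\<Sum>x\<in>C. scaleA (g x) x" and ?d = "\<Sum>x\<in>D. scaleA (g x) x"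
    have s: "?c + ?d = 0" using g fin CD by (simp add: sum.union_disjoint)
    have cI: "?c \<in> I" and dK: "?d \<in> K"
      using C(1) D(1) by (auto intro!: A.subspace_sum A.subspace_scale sI sK)
    have "?c = - ?d" using s by (simp add: eq_neg_iff_add_eq_0)
    then have "?c \<in> K" using dK A.subspace_neg[OF sK] by simp
    then have "?c = 0" using IK0[OF cI] by simp
    moreover from this have "?d = 0" using s by simp
    ultimately show "g x = 0"
      using x A.independentD[OF C(2) fin(1) subset_refl] A.independentD[OF D(2) fin(2) subset_refl] by blast
  qed (use fin in simp)
  have span: "A.span (C \<union> D) = UNIV"
  proof -
    have "x \<in> A.span (C \<union> D)" for x
    proof -
      obtain y z where "y \<in> I" "z \<in> K" "x = y + z" using IK(2) by blast
      moreover from this have "y \<in> A.span (C \<union> D)" "z \<in> A.span (C \<union> D)"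
        using C(3) D(3) A.span_mono[of C "C \<union> D"] A.span_mono[of D "C \<union> D"] by blast+
      ultimately show ?thesis using A.span_add by simp
    qed
    then show ?thesis by blast
  qed
  have cE: "card (C \<union> D) = card E"
    using A.dim_eq_card_independent[OF ind] span A.dim_UNIV A.dim_span by metis
  have small: "A.dim L < card E" if "A.subspace L" "L \<noteq> UNIV" for L
    using that A.subspace_dim_equal[of L UNIV] A.dim_UNIV by (metis A.subspace_UNIV not_less subset_UNIV)
  have lt: "card C < card E" "card D < card E" using small sI sK I(3) K(3) C(4) D(4) by simp_all
  have bound: "real (codim B n) \<le> (2 * real (card E)) * (real (card E) - 1 / 2) ^ n"
    if n: "n \<ge> 1" for n
  proof -
    let ?X = "({1..n} \<rightarrow>\<^sub>E C) \<union> ({1..n} \<rightarrow>\<^sub>E D)"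
    have "f t = 0" if f: "H_fun {1..n} f" and t: "t \<in> {1..n} \<rightarrow>\<^sub>E C \<union> D" "t \<notin> ?X" for f t
      using f
    proof (induct rule: H_fun.induct)
      case (mono q h)
      obtain i where i: "i \<in> {1..n}" "t i \<notin> C" using t by (auto simp: PiE_iff)
      obtain j where j: "j \<in> {1..n}" "t j \<notin> D" using t by (auto simp: PiE_iff)
      have "t i \<in> K" "t j \<in> I" using i j t C(1) D(1) by (auto simp: PiE_iff)
      then have "act (h i) (t i) \<in> K" "act (h j) (t j) \<in> I" using I(2) K(2) unfolding H_invariant_def by auto
      then have "nonempty_prod (map (\<lambda>i. act (h i) (t i)) q) \<in> K"
        "nonempty_prod (map (\<lambda>i. act (h i) (t i)) q) \<in> I"
        using i j mono by (auto intro!: nonempty_prod_in_ideal I K)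
      then show ?case using IK0 by blast
    qed auto
    moreover have "finite ?X" using fin by (simp add: finite_PiE)
    ultimately have "codim B n \<le> card ?X * card (C \<union> D)"
      using fin by (intro H_codim_bounds(1)[OF B n _ ind span]) auto
    also have "\<dots> \<le> (card C ^ n + card D ^ n) * card E"
      unfolding cE using card_Un_le[of "{1..n} \<rightarrow>\<^sub>E C" "{1..n} \<rightarrow>\<^sub>E D"] by (simp add: card_PiE)
    finally have "real (codim B n) \<le> real ((card C ^ n + card D ^ n) * card E)"
      by (simp only: of_nat_le_iff)
    also have "\<dots> = (real (card C) ^ n + real (card D) ^ n) * real (card E)" by simp
    also have "\<dots> \<le> ((real (card E) - 1 / 2) ^ n + (real (card E) - 1 / 2) ^ n) * real (card E)"
      using lt by (intro mult_right_mono add_mono power_mono) auto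
    finally show ?thesis by (simp add: mult_ac)
  qed
  have "card E > 0" using lt by linarith
  then show ?thesis using bound by (intro exI[of _ "2 * real (card E)"]) simp
qed

section \<open>Codimension growth and \<open>H\<close>-simplicity\<close>

lemma H_codim_bound_not_H_simple:
  assumes B: "H.independent B" "H.span B = UNIV"
    and J: "H_invariant act A.jacobson_radical" and nz: "\<exists>a::'a. a \<noteq> 0"
    and ns: "\<not> H_simple scaleA act"
  shows "\<exists>C>0. \<forall>n\<ge>1. real (codim B n) \<le> C * (real (card E) - 1 / 2) ^ n"
proof (cases "A.jacobson_radical = {0}")
  case False
  then show ?thesis by (rule H_codim_bound_radical[OF B J])
next
  case True
  note nn = A.nilpotent_left_ideal_zero[OF True]
  obtain u :: 'a where u: "\<And>x. u * x = x" "\<And>x. x * u = x"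
    using A.identity_element_exists[OF True] by blast
  obtain a :: 'a where "a \<noteq> 0" using nz by blast
  then have "u \<noteq> 0" using u(1)[of a] by auto
  moreover have "u \<in> A.span {a * b | a b. True}" by (intro A.span_base CollectI exI[of _ u]) (simp add: u)
  ultimately have "A.span {a * b | a b. True} \<noteq> {0}" by blast
  then obtain I where I: "A.two_sided_ideal I" "H_invariant act I" "I \<noteq> {0}" "I \<noteq> UNIV"
    using ns unfolding H_simple_def by blast
  note II = two_sided_idealD[OF I(1)]
  obtain e where e: "e \<in> I" "\<And>x. x \<in> I \<Longrightarrow> e * x = x \<and> x * e = x"
    using A.ideal_identity[OF nn I(1)] by blast
  let ?K = "{x. \<forall>a\<in>I. x * a = 0}"
  show ?thesis
  proof (rule H_codim_bound_direct_sum[OF B I(1,2,4)])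
    show "A.two_sided_ideal ?K"
      unfolding A.two_sided_ideal_def A.subspace_def using II
      by (auto simp: distrib_right A.scale_mult_left[symmetric] mult.assoc)
    show "H_invariant act ?K" by (rule H_invariant_left_annihilator[OF I(2)])
    show "?K \<noteq> UNIV"
    proof
      assume "?K = UNIV"
      then have "e * e = 0" using e(1) by blast
      then have "e = 0" using e by auto
      then have "x = 0" if "x \<in> I" for x using e(2)[OF that] by simp
      then show False using I(3) e(1) by blast
    qed
    show "I \<inter> ?K = {0}"
    proof
      show "I \<inter> ?K \<subseteq> {0}" using e by auto
      show "{0} \<subseteq> I \<inter> ?K" using A.subspace_0[OF II(1)] by simp
    qed
    show "\<exists>y\<in>I. \<exists>z\<in>?K. x = y + z" for x
    proof (intro bexI)
      show "x = x * e + (x - x * e)" by simp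
      show "x - x * e \<in> ?K" using e by (simp add: left_diff_distrib mult.assoc)
      show "x * e \<in> I" using II e by blast
    qed
  qed
qed

text \<open>If the radical were \<open>A\<close>, then \<open>A\<close> would be nilpotent. But the span of \<open>A A\<close> is a nonzero \<open>H\<close>-invariant ideal, so it
  is \<open>A\<close>, and then the nilpotency exponent can be lowered step by step to \<open>0\<close>.\<close>

lemma jacobson_radical_zero_if_H_simple:
  assumes s: "H_simple scaleA act" and J: "H_invariant act A.jacobson_radical"
  shows "A.jacobson_radical = {0}"
proof (rule ccontr)
  assume "A.jacobson_radical \<noteq> {0}"
  then have U: "A.jacobson_radical = UNIV"
    using s J A.two_sided_ideal_jacobson_radical unfolding H_simple_def by blast
  let ?P = "A.span {a * b | a b. True}"
  have prod: "a * b \<in> ?P" for a b by (rule A.span_base) blast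
  have "A.two_sided_ideal ?P" unfolding A.two_sided_ideal_def using prod A.subspace_span by blast
  moreover have "H_invariant act ?P"
    unfolding H_invariant_def
  proof (intro allI ballI)
    fix h x assume "x \<in> ?P"
    then show "act h x \<in> ?P"
    proof (induct rule: A.span_induct)
      case base
      show ?case unfolding A.subspace_def
        by (auto simp: act_zero_right act_add_right act_scale_right A.span_zero intro: A.span_add A.span_scale)
    next
      case (step x)
      then obtain a b where x: "x = a * b" by blast
      have "(\<Sum>(p, q)\<leftarrow>ts. act p a * act q b) \<in> ?P" for ts
      proof (induct ts)
        case (Cons t ts)
        then show ?case using A.span_add[OF prod Cons] by (cases t) simp
      qed (simp add: A.span_zero)
      then show ?case unfolding x act_prod .
    qed
  qed
  ultimately have PU: "?P = UNIV" using s unfolding H_simple_def by blast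
  obtain p where p: "\<And>xs y. length xs = p \<Longrightarrow> foldr (*) xs y = (0::'a)"
    using A.nilpotent_jacobson_radical unfolding A.nilpotent_def U by auto
  have down: "foldr (*) xs y = 0" if "\<And>xs y. length xs = Suc k \<Longrightarrow> foldr (*) xs y = (0::'a)" "length xs = k"
    for k xs and y :: 'a
  proof -
    interpret l: Vector_Spaces.linear scaleA scaleA "foldr (*) xs" by (rule A.linear_foldr_mult)
    have "foldr (*) xs (a * b) = 0" for a b using that(1)[of "xs @ [a]" b] that(2) by simp
    then show ?thesis using l.eq_0_on_span[of "{a * b | a b. True}" y] PU by blast
  qed
  have "\<forall>xs y. length xs = p - k \<longrightarrow> foldr (*) xs y = (0::'a)" for k
  proof (induct k)
    case 0
    then show ?case using p by simp
  next
    case (Suc k)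
    show ?case
    proof (cases "k < p")
      case True
      then have "p - k = Suc (p - Suc k)" by simp
      then show ?thesis using Suc down[of "p - Suc k"] by simp
    next
      case False
      then show ?thesis using Suc by simp
    qed
  qed
  from this[of p] have "y = 0" for y :: 'a by simp
  then have "?P = {0}" using PU by blast
  then show False using s unfolding H_simple_def by blast
qed

lemma H_codim_limit_H_simple:
  assumes B: "H.independent B" "H.span B = UNIV"
    and J: "H_invariant act A.jacobson_radical" and nz: "\<exists>a::'a. a \<noteq> 0"
    and s: "H_simple scaleA act"
  shows "(\<lambda>n. root n (real (codim B n))) \<longlonglongrightarrow> real (card E)"
proof -
  have J0: "A.jacobson_radical = {0}" by (rule jacobson_radical_zero_if_H_simple[OF s J])
  note nn = A.nilpotent_left_ideal_zero[OF J0]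
  obtain u :: 'a where u: "\<And>x. u * x = x" "\<And>x. x * u = x"
    using A.identity_element_exists[OF J0] by blast
  obtain a :: 'a where "a \<noteq> 0" using nz by blast
  then have u0: "u \<noteq> 0" using u(1)[of a] by auto
  interpret S: unital_H_simple_algebra scaleH comult counit antipode scaleA act E u
    using u u0 s unfolding H_simple_def by unfold_locales auto
  show ?thesis
    using S.dim_A_pos H_codim_le_power[OF B] S.H_simple_codim_lower_bound[OF B nn]
    by (intro root_limit_sandwich) auto
qed

end

theorem theorem19:
  fixes scaleH :: "'f::{alg_closed_field, field_char_0} \<Rightarrow> 'h::ring_1 \<Rightarrow> 'h"
    and comult :: "'h \<Rightarrow> ('h \<times> 'h) list"
    and counit :: "'h \<Rightarrow> 'f"
    and antipode :: "'h \<Rightarrow> 'h"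
    and scaleA :: "'f \<Rightarrow> 'a::ring \<Rightarrow> 'a"
    and act :: "'h \<Rightarrow> 'a \<Rightarrow> 'a"
    and B :: "'h set"
  assumes "H_module_algebra scaleH comult counit antipode scaleA act"
    and "bij antipode"
    and "\<exists>E. finite_dimensional_vector_space scaleA E"
    and "\<exists>a::'a. a \<noteq> 0"
    and "H_invariant act (assoc_algebra.jacobson_radical scaleA)"
    and "\<not> module.dependent scaleH B" and "module.span scaleH B = UNIV"
  shows "((\<lambda>n. root n (real (H_codim scaleH scaleA act B n)))
            \<longlonglongrightarrow> real (vector_space.dim scaleA (UNIV :: 'a set)))
         \<longleftrightarrow> H_simple scaleA act"
proof -
  obtain E where E: "finite_dimensional_vector_space scaleA E" using assms(3) by blast
  interpret fd_H_module_algebra scaleH comult counit antipode scaleA act E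
    by (intro fd_H_module_algebra.intro fd_algebra.intro E assms(1) H_module_algebra.axioms(2)[OF assms(1)])
  note B = assms(6,7) and J = assms(5) and nz = assms(4)
  have dim: "A.dim UNIV = card E" by (rule A.dim_UNIV)
  obtain a :: 'a where a: "a \<noteq> 0" using nz by blast
  have "card E > 0"
  proof (rule ccontr)
    assume "\<not> card E > 0"
    then have "E = {}" using A.finite_Basis by simp
    then have "a \<in> A.span {}" using A.span_Basis by simp
    then show False using a by simp
  qed
  then have q: "real (card E) - 1 / 2 > 0" by linarith
  show ?thesis
  proof
    assume lim: "(\<lambda>n. root n (real (H_codim scaleH scaleA act B n))) \<longlonglongrightarrow> real (A.dim UNIV)"
    show "H_simple scaleA act"
    proof (rule ccontr)
      assume "\<not> H_simple scaleA act"
      then obtain C where C: "C > 0"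
        "\<And>n. n \<ge> 1 \<Longrightarrow> real (H_codim scaleH scaleA act B n) \<le> C * (real (card E) - 1 / 2) ^ n"
        using H_codim_bound_not_H_simple[OF B J nz] by blast
      have "\<not> (\<lambda>n. root n (real (H_codim scaleH scaleA act B n))) \<longlonglongrightarrow> real (card E)"
        by (rule root_limit_excluded[OF C(1) q _ C(2)]) auto
      then show False using lim unfolding dim by blast
    qed
  next
    assume "H_simple scaleA act"
    then show "(\<lambda>n. root n (real (H_codim scaleH scaleA act B n))) \<longlonglongrightarrow> real (A.dim UNIV)"
      unfolding dim by (rule H_codim_limit_H_simple[OF B J nz])
  qed
qed

end
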